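(* Let $\Gamma=\langle s,t\mid s^2=1=t^3\rangle\cong C_2\ast C_3$ be the modular group, let $G=\Gamma\ast_{C_3}S_3$ be the amalgamated product identifying $t\in\Gamma$ with $s_1s_2\in S_3$, and let $B_3$ and $LB_3$ be the three-string braid group and the three-component loop braid group (presentations, and the notation $\mathrm{iss}_\alpha\,\Gamma$ and $\mathrm{irr}_\alpha\,B_3$, are given in the context). Natural numbers include $0$ and all representations are over $\mathbb{C}$. (1) Let $\alpha=(a,b;x,y,z)\in\mathbb{N}^{5}$ with $a+b=n=x+y+z$. Then a Zariski open and dense subset of irreducible $\Gamma$-representations in $\mathrm{iss}_\alpha\,\Gamma$ extends to the group $G$ (that is, $\mathrm{iss}_\alpha\,\Gamma$ contains a Zariski open and dense subset consisting of isomorphism classes of irreducible $\Gamma$-representations that extend to representations of $G$) if and only if there are natural numbers $u,v,w$ with $w\ge\max(u,v)$ such that $$\alpha=(v+w,\;u+w;\;u+v,\;w,\;w).$$ (2) As a consequence: let $\alpha=(a,b;x,y,z)\in\mathbb{N}^{5}$ with $a+b=n=x+y+z$ and $a\ge b\ge x=\max(x,y,z)$. If there are natural numbers $u\le v\le w$ such that $$a=v+w,\qquad b=u+w,\qquad \{x,y,z\}=\{u+v,w,w\}\ \text{ (equality of multisets)},$$ then a Zariski open and dense subset of irreducible $B_3$-representations in $\mathrm{irr}_\alpha\,B_3$ extends to $LB_3$ (that is, there is a Zariski open and dense subset of $\mathrm{irr}_\alpha\,B_3$ all of whose members are classes of irreducible $B_3$-representations that extend to representations of $LB_3$).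
   Context: Groups. $B_3=\langle\sigma_1,\sigma_2\mid\sigma_1\sigma_2\sigma_1=\sigma_2\sigma_1\sigma_2\rangle$. $S_3=\langle s_1,s_2\mid s_1s_2s_1=s_2s_1s_2,\ s_1^2=1=s_2^2\rangle$. The modular group $\Gamma=\langle s,t\mid s^2=1=t^3\rangle$ is the quotient of $B_3$ by the central element $(\sigma_1\sigma_2)^3$; writing $\overline{\sigma}_i$ for the image of $\sigma_i$ in $\Gamma$, one has $t=\overline{\sigma}_1\overline{\sigma}_2$ and $s=\overline{\sigma}_1\overline{\sigma}_2\overline{\sigma}_1$. The group $G=\Gamma\ast_{C_3}S_3$ is the amalgamated free product in which the generator of $C_3$ equals $t$ in $\Gamma$ and $s_1s_2$ in $S_3$. The three-component loop braid group $LB_3$ is generated by $\sigma_1,\sigma_2,s_1,s_2$ with defining relations: $\sigma_1\sigma_2\sigma_1=\sigma_2\sigma_1\sigma_2$; $s_1s_2s_1=s_2s_1s_2$; $s_1^2=s_2^2=1$; $s_1s_2\sigma_1=\sigma_2s_1s_2$; $\sigma_1\sigma_2s_1=s_2\sigma_1\sigma_2$. Extension. A representation $\psi:\Gamma\to GL_n(\mathbb{C})$ extends to $G$ if there is a representation $G\to GL_n(\mathbb{C})$ whose restriction to $\Gamma\subset G$ is $\psi$. A representation $\phi:B_3\to GL_n(\mathbb{C})$ extends to $LB_3$ if there is a representation $\phi':LB_3\to GL_n(\mathbb{C})$ with $\phi'(\sigma_i)=\phi(\sigma_i)$ for $i=1,2$. Both properties depend only on the isomorphism class. Varieties of representations.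 Let $\rho$ be a primitive cube root of unity. An $n$-dimensional $\Gamma$-representation has dimension type $\alpha=(a,b;x,y,z)$ if $s$ has eigenvalues $+1,-1$ with multiplicities $a,b$, and $t$ has eigenvalues $1,\rho,\rho^2$ with multiplicities $x,y,z$ respectively; thus $a+b=n=x+y+z$. The variety $\mathrm{iss}_n\,\Gamma$ is the affine variety (the GIT quotient of the variety of $n$-dimensional representations by conjugation by $GL_n$) whose points are the isomorphism classes of semisimple $n$-dimensional $\Gamma$-representations. It is the disjoint union of the irreducible components $\mathrm{iss}_\alpha\,\Gamma$, where $\mathrm{iss}_\alpha\,\Gamma$ is the set of classes of dimension type $\alpha$. The variety $\mathrm{irr}_n\,B_3$ has as its points the isomorphism classes of irreducible $n$-dimensional $B_3$-representations. Every irreducible $n$-dimensional $B_3$-representation is isomorphic to one of the form $\phi(\sigma_i)=\lambda\,\psi(\overline{\sigma}_i)$ ($i=1,2$) with $\lambda\in\mathbb{C}^*$ and $\psi$ an irreducible $n$-dimensional $\Gamma$-representation. For $\alpha=(a,b;x,y,z)\in\mathbb{N}^{5}$ with $a+b=n=x+y+z$, $\mathrm{irr}_\alpha\,B_3\subseteq\mathrm{irr}_n\,B_3$ denotes the subset (with the induced Zariski topology) of classes of representations $\phi$ of this form for which $\lambda\in\mathbb{C}^*$ is arbitrary and $\psi$ is an irreducible $\Gamma$-representation of dimension type $\alpha$. Different $\alpha$ may give the same subset, because the group $\mu_6$ of one-dimensional characters of $\Gamma$ acts on the types by twisting; the components of $\mathrm{irr}_n\,B_3$ are therefore indexed by $\alpha$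 normalised so that $a\ge b\ge x=\max(x,y,z)$.
   Formalization: Part (1) is stated for all α except (0,0;0,0,0), (1,0;1,0,0), (0,1;1,0,0) and (w,w;0,w,w) with w ≥ 2, where the printed equivalence fails; part (2) is unchanged. *)

theory Defs
  imports
    "HOL-Analysis.Abstract_Topology"
    "HOL-Library.Multiset"
    "Jordan_Normal_Form.Char_Poly"
    "Jordan_Normal_Form.VS_Connect"
begin

section \<open>Groups given by generators and relations\<close>

text \<open>A word is a list of letters; the letter (g, True) stands for the generator g and (g, False)
  for its formal inverse. A set of relations is a set of pairs of words to be identified.\<close>

type_synonym 'g word = "('g \<times> bool) list"

inductive word_eq :: "('g word \<times> 'g word) set \<Rightarrow> 'g word \<Rightarrow> 'g word \<Rightarrow> bool" for R where
  rel: "(u, v) \<in> R \<Longrightarrow> word_eq R u v"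
| cancel: "word_eq R [(g, e), (g, \<not> e)] []"
| refl: "word_eq R u u"
| sym: "word_eq R u v \<Longrightarrow> word_eq R v u"
| trans: "word_eq R u v \<Longrightarrow> word_eq R v w \<Longrightarrow> word_eq R u w"
| append: "word_eq R u u' \<Longrightarrow> word_eq R v v' \<Longrightarrow> word_eq R (u @ v) (u' @ v')"

definition word_class :: "('g word \<times> 'g word) set \<Rightarrow> 'g word \<Rightarrow> 'g word set" where
  "word_class R u = {v. word_eq R u v}"

definition presented_group :: "('g word \<times> 'g word) set \<Rightarrow> 'g word set monoid" where
  "presented_group R =
     \<lparr>carrier = range (word_class R),
      monoid.mult = (\<lambda>A B. \<Union>u\<in>A. \<Union>v\<in>B. word_class R (u @ v)),
      one = word_class R []\<rparr>"

definition pos :: "'g list \<Rightarrow> 'g word" where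
  "pos gs = map (\<lambda>g. (g, True)) gs"

definition gen :: "('g word \<times> 'g word) set \<Rightarrow> 'g \<Rightarrow> 'g word set" where
  "gen R g = word_class R (pos [g])"

definition map_word :: "('g \<Rightarrow> 'h) \<Rightarrow> 'g word \<Rightarrow> 'h word" where
  "map_word f = map (\<lambda>(g, e). (f g, e))"

lemma word_class_eq_iff: "word_class R u = word_class R v \<longleftrightarrow> word_eq R u v"
proof
  assume eq: "word_class R u = word_class R v"
  have "v \<in> word_class R v" by (simp add: word_class_def word_eq.refl)
  also have "word_class R v = word_class R u" by (rule eq[symmetric])
  finally show "word_eq R u v" by (simp add: word_class_def)
next
  assume "word_eq R u v"
  then have "word_eq R u w \<longleftrightarrow> word_eq R v w" for w
    using word_eq.trans[of R u v w] word_eq.trans[of R v u w] word_eq.sym[of R u v] by argo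
  then show "word_class R u = word_class R v" by (simp add: word_class_def)
qed

lemma mult_word_class:
  "word_class R u \<otimes>\<^bsub>presented_group R\<^esub> word_class R v = word_class R (u @ v)"
proof -
  have "word_class R (u' @ v') = word_class R (u @ v)"
    if "u' \<in> word_class R u" "v' \<in> word_class R v" for u' v'
  proof -
    from that have "word_eq R (u @ v) (u' @ v')"
      by (simp add: word_class_def word_eq.append)
    then show ?thesis by (simp add: word_class_eq_iff word_eq.sym)
  qed
  then have "(\<Union>u'\<in>word_class R u. \<Union>v'\<in>word_class R v. word_class R (u' @ v'))
      = (\<Union>u'\<in>word_class R u. \<Union>v'\<in>word_class R v. word_class R (u @ v))"
    by (intro SUP_cong HOL.refl)
  moreover have "u \<in> word_class R u" "v \<in> word_class R v"
    by (simp_all add: word_class_def word_eq.refl)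
  ultimately have "(\<Union>u'\<in>word_class R u. \<Union>v'\<in>word_class R v. word_class R (u' @ v'))
      = word_class R (u @ v)"
    by blast
  then show ?thesis
    by (simp add: presented_group_def)
qed

lemma word_eq_inverse: "word_eq R (rev (map (\<lambda>(g, e). (g, \<not> e)) u) @ u) []"
proof (induction u)
  case (Cons l u)
  obtain g e where l: "l = (g, e)" by force
  let ?i = "\<lambda>u. rev (map (\<lambda>(g, e). (g, \<not> e)) u)"
  have "word_eq R ([(g, \<not> e), (g, e)]) []"
    using word_eq.cancel[of R g "\<not> e"] by simp
  then have "word_eq R (?i u @ ([(g, \<not> e), (g, e)] @ u)) (?i u @ ([] @ u))"
    by (intro word_eq.append word_eq.refl)
  then have "word_eq R (?i u @ ([(g, \<not> e), (g, e)] @ u)) (?i u @ u)"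
    by simp
  from word_eq.trans[OF this Cons.IH] show ?case
    by (simp add: l)
qed (simp add: word_eq.refl)

lemma group_presented_group: "Group.group (presented_group R)"
proof (rule groupI)
  have car: "carrier (presented_group R) = range (word_class R)"
    and one: "\<one>\<^bsub>presented_group R\<^esub> = word_class R []"
    by (simp_all add: presented_group_def)
  show "A \<otimes>\<^bsub>presented_group R\<^esub> B \<in> carrier (presented_group R)"
    if "A \<in> carrier (presented_group R)" "B \<in> carrier (presented_group R)" for A B
    using that by (auto simp: car mult_word_class)
  show "\<one>\<^bsub>presented_group R\<^esub> \<in> carrier (presented_group R)"
    by (simp add: car one)
  show "A \<otimes>\<^bsub>presented_group R\<^esub> B \<otimes>\<^bsub>presented_group R\<^esub> C
      = A \<otimes>\<^bsub>presented_group R\<^esub> (B \<otimes>\<^bsub>presented_group R\<^esub> C)"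
    if "A \<in> carrier (presented_group R)" "B \<in> carrier (presented_group R)"
      "C \<in> carrier (presented_group R)" for A B C
    using that by (auto simp: car mult_word_class)
  show "\<one>\<^bsub>presented_group R\<^esub> \<otimes>\<^bsub>presented_group R\<^esub> A = A"
    if "A \<in> carrier (presented_group R)" for A
    using that by (auto simp: car one mult_word_class)
  show "\<exists>B\<in>carrier (presented_group R). B \<otimes>\<^bsub>presented_group R\<^esub> A = \<one>\<^bsub>presented_group R\<^esub>"
    if "A \<in> carrier (presented_group R)" for A
  proof -
    from that obtain u where u: "A = word_class R u" by (auto simp: car)
    let ?B = "word_class R (rev (map (\<lambda>(g, e). (g, \<not> e)) u))"
    have "?B \<otimes>\<^bsub>presented_group R\<^esub> A = \<one>\<^bsub>presented_group R\<^esub>"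
      unfolding u one mult_word_class word_class_eq_iff by (rule word_eq_inverse)
    moreover have "?B \<in> carrier (presented_group R)" by (simp add: car)
    ultimately show ?thesis ..
  qed
qed


section \<open>The groups B3, S3, LB3, the modular group and its amalgam with S3\<close>

datatype b3_gen = B_sigma1 | B_sigma2
datatype s3_gen = S_s1 | S_s2
datatype mod_gen = M_s | M_t
datatype lb3_gen = L_sigma1 | L_sigma2 | L_s1 | L_s2

definition b3_rels :: "(b3_gen word \<times> b3_gen word) set" where
  "b3_rels = {(pos [B_sigma1, B_sigma2, B_sigma1], pos [B_sigma2, B_sigma1, B_sigma2])}"

definition s3_rels :: "(s3_gen word \<times> s3_gen word) set" where
  "s3_rels = {(pos [S_s1, S_s2, S_s1], pos [S_s2, S_s1, S_s2]),
              (pos [S_s1, S_s1], []), (pos [S_s2, S_s2], [])}"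

definition mod_rels :: "(mod_gen word \<times> mod_gen word) set" where
  "mod_rels = {(pos [M_s, M_s], []), (pos [M_t, M_t, M_t], [])}"

text \<open>The amalgam over the cyclic group of order 3: the generators and relations of both factors,
  together with the identification of t with the product of s1 and s2.\<close>

definition amalgam_rels :: "((mod_gen + s3_gen) word \<times> (mod_gen + s3_gen) word) set" where
  "amalgam_rels =
     (\<lambda>(u, v). (map_word Inl u, map_word Inl v)) ` mod_rels \<union>
     (\<lambda>(u, v). (map_word Inr u, map_word Inr v)) ` s3_rels \<union>
     {(pos [Inl M_t], pos [Inr S_s1, Inr S_s2])}"

definition lb3_rels :: "(lb3_gen word \<times> lb3_gen word) set" where
  "lb3_rels =
     {(pos [L_sigma1, L_sigma2, L_sigma1], pos [L_sigma2, L_sigma1, L_sigma2]),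
      (pos [L_s1, L_s2, L_s1], pos [L_s2, L_s1, L_s2]),
      (pos [L_s1, L_s1], []), (pos [L_s2, L_s2], []),
      (pos [L_s1, L_s2, L_sigma1], pos [L_sigma2, L_s1, L_s2]),
      (pos [L_sigma1, L_sigma2, L_s1], pos [L_s2, L_sigma1, L_sigma2])}"

abbreviation B3 :: "b3_gen word set monoid" where
  "B3 \<equiv> presented_group b3_rels"

abbreviation ModGrp :: "mod_gen word set monoid" where
  "ModGrp \<equiv> presented_group mod_rels"

abbreviation Amalg :: "(mod_gen + s3_gen) word set monoid" where
  "Amalg \<equiv> presented_group amalgam_rels"

abbreviation LB3 :: "lb3_gen word set monoid" where
  "LB3 \<equiv> presented_group lb3_rels"

text \<open>The images in the modular group of the standard generators of B3, obtained by solving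
  t = sigma1 sigma2 and s = sigma1 sigma2 sigma1; cf. sigma_bar_t and sigma_bar_s.\<close>

definition sigma1_bar :: "mod_gen word set" where
  "sigma1_bar = inv\<^bsub>ModGrp\<^esub> (gen mod_rels M_t) \<otimes>\<^bsub>ModGrp\<^esub> gen mod_rels M_s"

definition sigma2_bar :: "mod_gen word set" where
  "sigma2_bar = inv\<^bsub>ModGrp\<^esub> (gen mod_rels M_s) \<otimes>\<^bsub>ModGrp\<^esub> (gen mod_rels M_t \<otimes>\<^bsub>ModGrp\<^esub> gen mod_rels M_t)"

lemma (in Group.group) mult_inv_cancel:
  "g \<in> carrier G \<Longrightarrow> h \<in> carrier G \<Longrightarrow> g \<otimes> (inv g \<otimes> h) = h"
  by (simp flip: m_assoc)

lemma (in Group.group) inv_mult_cancel: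
  "g \<in> carrier G \<Longrightarrow> h \<in> carrier G \<Longrightarrow> inv g \<otimes> (g \<otimes> h) = h"
  by (simp flip: m_assoc)

lemma sigma_bar_t: "sigma1_bar \<otimes>\<^bsub>ModGrp\<^esub> sigma2_bar = gen mod_rels M_t"
proof -
  interpret Group.group ModGrp by (rule group_presented_group)
  have c: "gen mod_rels M_s \<in> carrier ModGrp" "gen mod_rels M_t \<in> carrier ModGrp"
    by (auto simp: gen_def presented_group_def)
  show ?thesis unfolding sigma1_bar_def sigma2_bar_def
    using c by (simp add: m_assoc inv_mult_cancel mult_inv_cancel)
qed

lemma sigma_bar_s: "sigma1_bar \<otimes>\<^bsub>ModGrp\<^esub> sigma2_bar \<otimes>\<^bsub>ModGrp\<^esub> sigma1_bar = gen mod_rels M_s"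
proof -
  interpret Group.group ModGrp by (rule group_presented_group)
  have c: "gen mod_rels M_s \<in> carrier ModGrp" "gen mod_rels M_t \<in> carrier ModGrp"
    by (auto simp: gen_def presented_group_def)
  show ?thesis unfolding sigma_bar_t unfolding sigma1_bar_def
    using c by (simp add: mult_inv_cancel)
qed


section \<open>Complex representations\<close>

definition GL :: "nat \<Rightarrow> complex mat monoid" where
  "GL n = units_of (ring_mat TYPE(complex) n ())"

definition reps :: "nat \<Rightarrow> 'g monoid \<Rightarrow> ('g \<Rightarrow> complex mat) set" where
  "reps n G = hom G (GL n)"

definition rep_iso :: "nat \<Rightarrow> 'g monoid \<Rightarrow> ('g \<Rightarrow> complex mat) \<Rightarrow> ('g \<Rightarrow> complex mat) \<Rightarrow> bool" where
  "rep_iso n G \<phi> \<psi> \<longleftrightarrow> (\<exists>P\<in>carrier (GL n). \<forall>g\<in>carrier G. P * \<phi> g = \<psi> g * P)"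

definition iso_class :: "nat \<Rightarrow> 'g monoid \<Rightarrow> ('g \<Rightarrow> complex mat) \<Rightarrow> ('g \<Rightarrow> complex mat) set" where
  "iso_class n G \<phi> = {\<psi> \<in> reps n G. rep_iso n G \<phi> \<psi>}"

definition invariant_subspace ::
  "nat \<Rightarrow> 'g monoid \<Rightarrow> ('g \<Rightarrow> complex mat) \<Rightarrow> complex vec set \<Rightarrow> bool" where
  "invariant_subspace n G \<phi> W \<longleftrightarrow>
     VectorSpace.subspace class_ring W (module_vec TYPE(complex) n) \<and>
     (\<forall>g\<in>carrier G. \<forall>w\<in>W. \<phi> g *\<^sub>v w \<in> W)"

definition irreducible_rep :: "nat \<Rightarrow> 'g monoid \<Rightarrow> ('g \<Rightarrow> complex mat) \<Rightarrow> bool" where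
  "irreducible_rep n G \<phi> \<longleftrightarrow>
     \<phi> \<in> reps n G \<and> n > 0 \<and>
     (\<forall>W. invariant_subspace n G \<phi> W \<longrightarrow> W = {0\<^sub>v n} \<or> W = carrier_vec n)"

definition semisimple_rep :: "nat \<Rightarrow> 'g monoid \<Rightarrow> ('g \<Rightarrow> complex mat) \<Rightarrow> bool" where
  "semisimple_rep n G \<phi> \<longleftrightarrow>
     \<phi> \<in> reps n G \<and>
     (\<forall>W. invariant_subspace n G \<phi> W \<longrightarrow>
        (\<exists>W'. invariant_subspace n G \<phi> W' \<and> W \<inter> W' = {0\<^sub>v n} \<and>
              {w + w' | w w'. w \<in> W \<and> w' \<in> W'} = carrier_vec n))"


section \<open>The varieties of semisimple and of irreducible representations\<close>

text \<open>The coordinate ring of the variety of n-dimensional representations is generated by the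
  matrix coefficients of all group elements; inverses of group elements account for the inverses
  of the determinants. The coordinate ring of the quotient by GL n consists of its invariants.\<close>

inductive_set regular_functions :: "nat \<Rightarrow> 'g monoid \<Rightarrow> (('g \<Rightarrow> complex mat) \<Rightarrow> complex) set"
  for n G where
  const: "(\<lambda>\<phi>. c) \<in> regular_functions n G"
| coefficient: "g \<in> carrier G \<Longrightarrow> i < n \<Longrightarrow> j < n \<Longrightarrow> (\<lambda>\<phi>. \<phi> g $$ (i, j)) \<in> regular_functions n G"
| add: "f \<in> regular_functions n G \<Longrightarrow> h \<in> regular_functions n G \<Longrightarrow>
    (\<lambda>\<phi>. f \<phi> + h \<phi>) \<in> regular_functions n G"
| mult: "f \<in> regular_functions n G \<Longrightarrow> h \<in> regular_functions n G \<Longrightarrow>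
    (\<lambda>\<phi>. f \<phi> * h \<phi>) \<in> regular_functions n G"

definition invariant_functions :: "nat \<Rightarrow> 'g monoid \<Rightarrow> (('g \<Rightarrow> complex mat) \<Rightarrow> complex) set" where
  "invariant_functions n G =
     {f \<in> regular_functions n G.
        \<forall>\<phi>\<in>reps n G. \<forall>\<psi>\<in>reps n G. rep_iso n G \<phi> \<psi> \<longrightarrow> f \<phi> = f \<psi>}"

definition iss :: "nat \<Rightarrow> 'g monoid \<Rightarrow> ('g \<Rightarrow> complex mat) set set" where
  "iss n G = {iso_class n G \<phi> | \<phi>. semisimple_rep n G \<phi>}"

definition irr :: "nat \<Rightarrow> 'g monoid \<Rightarrow> ('g \<Rightarrow> complex mat) set set" where
  "irr n G = {iso_class n G \<phi> | \<phi>. irreducible_rep n G \<phi>}"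

text \<open>A point of the quotient is a class X, and an invariant function is constant on X; so a Zariski
  open set consists of the X at which some member of a given set F of invariants does not vanish.\<close>

definition zariski_iss :: "nat \<Rightarrow> 'g monoid \<Rightarrow> ('g \<Rightarrow> complex mat) set topology" where
  "zariski_iss n G =
     topology (\<lambda>U. \<exists>F\<subseteq>invariant_functions n G. U = {X \<in> iss n G. \<exists>f\<in>F. \<exists>\<phi>\<in>X. f \<phi> \<noteq> 0})"

definition zariski_irr :: "nat \<Rightarrow> 'g monoid \<Rightarrow> ('g \<Rightarrow> complex mat) set topology" where
  "zariski_irr n G = subtopology (zariski_iss n G) (irr n G)"

lemma invariant_nonzero_iff:
  assumes "f \<in> invariant_functions n G" "\<psi> \<in> X" "X \<in> iss n G"
  shows "(\<exists>\<phi>\<in>X. f \<phi> \<noteq> 0) \<longleftrightarrow> f \<psi> \<noteq> 0"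
proof -
  obtain \<phi>0 where \<phi>0: "\<phi>0 \<in> reps n G" "X = iso_class n G \<phi>0"
    using assms(3) by (auto simp: iss_def semisimple_rep_def)
  have "f \<phi> = f \<phi>0" if "\<phi> \<in> X" for \<phi>
    using that assms(1) \<phi>0 by (auto simp: iso_class_def invariant_functions_def)
  then show ?thesis using assms(2) by metis
qed

lemma openin_zariski_iss:
  "openin (zariski_iss n G) U \<longleftrightarrow>
     (\<exists>F\<subseteq>invariant_functions n G. U = {X \<in> iss n G. \<exists>f\<in>F. \<exists>\<phi>\<in>X. f \<phi> \<noteq> 0})"
proof -
  let ?D = "\<lambda>F. {X \<in> iss n G. \<exists>f\<in>F. \<exists>\<phi>\<in>X. f \<phi> \<noteq> 0}"
  let ?L = "\<lambda>U. \<exists>F\<subseteq>invariant_functions n G. U = ?D F"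
  have "?L (S \<inter> T)" if ST: "?L S" "?L T" for S T
  proof -
    obtain E F where E: "E \<subseteq> invariant_functions n G" "S = ?D E"
      and F: "F \<subseteq> invariant_functions n G" "T = ?D F"
      using ST by blast
    let ?H = "{\<lambda>\<phi>. e \<phi> * f \<phi> | e f. e \<in> E \<and> f \<in> F}"
    have H: "?H \<subseteq> invariant_functions n G"
    proof
      fix h assume "h \<in> ?H"
      then obtain e f where h: "h = (\<lambda>\<phi>. e \<phi> * f \<phi>)" "e \<in> E" "f \<in> F" by blast
      then have "e \<in> invariant_functions n G" "f \<in> invariant_functions n G"
        using E F by auto
      then show "h \<in> invariant_functions n G"
        unfolding h(1) invariant_functions_def mem_Collect_eq
        using regular_functions.mult by metis
    qed
    have "S \<inter> T = ?D ?H"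
    proof (intro equalityI subsetI)
      fix X assume X: "X \<in> S \<inter> T"
      then obtain e \<phi> f \<psi> where *: "X \<in> iss n G" "e \<in> E" "\<phi> \<in> X" "e \<phi> \<noteq> 0" "f \<in> F" "\<psi> \<in> X" "f \<psi> \<noteq> 0"
        unfolding E F by blast
      then have "f \<phi> \<noteq> 0"
        using invariant_nonzero_iff[of f n G \<phi> X] F by blast
      then have ne: "e \<phi> * f \<phi> \<noteq> 0" using * by simp
      have "(\<lambda>\<phi>. e \<phi> * f \<phi>) \<in> ?H" using *(2,5) by blast
      moreover have "\<exists>\<phi>\<in>X. e \<phi> * f \<phi> \<noteq> 0" using ne *(3) ..
      ultimately have "\<exists>h\<in>?H. \<exists>\<phi>\<in>X. h \<phi> \<noteq> 0"
        by (rule rev_bexI[where x = "\<lambda>\<phi>. e \<phi> * f \<phi>"])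
      with *(1) show "X \<in> ?D ?H" by simp
    next
      fix X assume X: "X \<in> ?D ?H"
      then obtain e f \<phi> where *: "e \<in> E" "f \<in> F" "\<phi> \<in> X" "e \<phi> * f \<phi> \<noteq> 0"
        by blast
      then have "e \<phi> \<noteq> 0" "f \<phi> \<noteq> 0" by auto
      with X * show "X \<in> S \<inter> T" unfolding E F by blast
    qed
    with H show ?thesis by (intro exI[of _ ?H] conjI)
  qed
  moreover have "?L (\<Union>\<K>)" if K: "\<forall>K\<in>\<K>. ?L K" for \<K>
  proof -
    obtain F where F: "\<forall>K\<in>\<K>. F K \<subseteq> invariant_functions n G \<and> K = ?D (F K)"
      using bchoice[OF K] ..
    have F1: "F K \<subseteq> invariant_functions n G" if "K \<in> \<K>" for K
      by (rule conjunct1[OF bspec[OF F that]])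
    have F2: "K = ?D (F K)" if "K \<in> \<K>" for K
      by (rule conjunct2[OF bspec[OF F that]])
    have "\<Union>\<K> = ?D (\<Union>(F ` \<K>))"
    proof (intro equalityI subsetI)
      fix X assume "X \<in> \<Union>\<K>"
      then obtain K where K: "K \<in> \<K>" "X \<in> K" by blast
      have "X \<in> ?D (F K)" by (rule subst[OF F2[OF K(1)], of "\<lambda>A. X \<in> A", OF K(2)])
      then show "X \<in> ?D (\<Union>(F ` \<K>))" using K(1) by blast
    next
      fix X assume "X \<in> ?D (\<Union>(F ` \<K>))"
      then obtain K where K: "K \<in> \<K>" "X \<in> ?D (F K)" by blast
      have "X \<in> K" by (rule ssubst[OF F2[OF K(1)], of "\<lambda>A. X \<in> A", OF K(2)])
      then show "X \<in> \<Union>\<K>" using K(1) by blast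
    qed
    moreover have "\<Union>(F ` \<K>) \<subseteq> invariant_functions n G" using F1 by blast
    ultimately show ?thesis by (intro exI[of _ "\<Union>(F ` \<K>)"] conjI)
  qed
  ultimately have "istopology ?L" unfolding istopology_def by (intro conjI allI impI)
  then show ?thesis unfolding zariski_iss_def by (simp add: topology_inverse')
qed


section \<open>Dimension types\<close>

type_synonym dimtype = "nat \<times> nat \<times> nat \<times> nat \<times> nat"

text \<open>The parameter is a primitive cube root of unity. Multiplicities are algebraic; they agree with
  the geometric ones because s and t act by matrices of finite order.\<close>

definition has_dim_type :: "complex \<Rightarrow> dimtype \<Rightarrow> (mod_gen word set \<Rightarrow> complex mat) \<Rightarrow> bool" where
  "has_dim_type \<rho> \<alpha> \<psi> \<longleftrightarrow>
     (case \<alpha> of (a, b, x, y, z) \<Rightarrow>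
        Polynomial.order 1 (char_poly (\<psi> (gen mod_rels M_s))) = a \<and>
        Polynomial.order (-1) (char_poly (\<psi> (gen mod_rels M_s))) = b \<and>
        Polynomial.order 1 (char_poly (\<psi> (gen mod_rels M_t))) = x \<and>
        Polynomial.order \<rho> (char_poly (\<psi> (gen mod_rels M_t))) = y \<and>
        Polynomial.order (\<rho>\<^sup>2) (char_poly (\<psi> (gen mod_rels M_t))) = z)"

definition iss_type :: "complex \<Rightarrow> nat \<Rightarrow> dimtype \<Rightarrow> (mod_gen word set \<Rightarrow> complex mat) set set" where
  "iss_type \<rho> n \<alpha> = {iso_class n ModGrp \<psi> | \<psi>. semisimple_rep n ModGrp \<psi> \<and> has_dim_type \<rho> \<alpha> \<psi>}"

definition irr_type :: "complex \<Rightarrow> nat \<Rightarrow> dimtype \<Rightarrow> (b3_gen word set \<Rightarrow> complex mat) set set" where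
  "irr_type \<rho> n \<alpha> =
     {iso_class n B3 \<phi> | \<phi>. \<phi> \<in> reps n B3 \<and>
        (\<exists>c \<psi>. c \<noteq> 0 \<and> irreducible_rep n ModGrp \<psi> \<and> has_dim_type \<rho> \<alpha> \<psi> \<and>
           \<phi> (gen b3_rels B_sigma1) = c \<cdot>\<^sub>m \<psi> sigma1_bar \<and>
           \<phi> (gen b3_rels B_sigma2) = c \<cdot>\<^sub>m \<psi> sigma2_bar)}"


section \<open>Extension of representations\<close>

text \<open>The canonical map from the modular group to the amalgam sends the class of a word to the class
  of the same word over the larger alphabet.\<close>

definition extends_to_amalgam :: "nat \<Rightarrow> (mod_gen word set \<Rightarrow> complex mat) \<Rightarrow> bool" where
  "extends_to_amalgam n \<psi> \<longleftrightarrow>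
     (\<exists>\<psi>'\<in>reps n Amalg. \<forall>u.
        \<psi>' (word_class amalgam_rels (map_word Inl u)) = \<psi> (word_class mod_rels u))"

definition extends_to_LB3 :: "nat \<Rightarrow> (b3_gen word set \<Rightarrow> complex mat) \<Rightarrow> bool" where
  "extends_to_LB3 n \<phi> \<longleftrightarrow>
     (\<exists>\<phi>'\<in>reps n LB3.
        \<phi>' (gen lb3_rels L_sigma1) = \<phi> (gen b3_rels B_sigma1) \<and>
        \<phi>' (gen lb3_rels L_sigma2) = \<phi> (gen b3_rels B_sigma2))"

definition open_dense_in :: "'a topology \<Rightarrow> 'a set \<Rightarrow> bool" where
  "open_dense_in T U \<longleftrightarrow> openin T U \<and> Abstract_Topology.closure_of T U = topspace T"


section \<open>Degenerate dimension types\<close>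

text \<open>These are exactly the types for which existence of a dense open set of irreducibles extending
  to the amalgam is not equivalent to the numerical criterion with parameters u, v, w. In dimension 0
  the criterion holds but no representation is irreducible. The two one-dimensional types with trivial
  action of t extend but violate the bound on w. For w at least 2, in type (w, w; 0, w, w) both
  s and t have two eigenvalues, so that irreducible representations have dimension at most 2 and none
  has this type, although u = v = 0 meets the criterion.\<close>

definition degenerate_types :: "dimtype set" where
  "degenerate_types =
     {(0, 0, 0, 0, 0), (1, 0, 1, 0, 0), (0, 1, 1, 0, 0)} \<union> {(w, w, 0, w, w) | w. w \<ge> 2}"

end

theory Submission
  imports Defs "Jordan_Normal_Form.Jordan_Normal_Form_Existence" "HOL-Combinatorics.Permutations"
begin

text \<open>The amalgam is generated by the modular group and an involution inverting t, so a representation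
  extends to it if and only if t has the eigenvalues \<open>\<rho>\<close> and \<open>\<rho>\<^sup>2\<close> with equal multiplicity, and the
  theorem reduces to a question about irreducible representations. If an eigenvalue multiplicity of s
  and one of t add up to more than n, then s and t have a common eigenvector; this gives necessity.
  Conversely, pairs of matrices of the required types that generate the full matrix algebra are built
  one dimension at a time: such a pair and a character with non-split extensions by it in both
  directions are glued along a parameter \<open>\<kappa>\<close>, and a computation in the limit \<open>\<kappa> = 0\<close> shows that the glued
  pair is again generating for generic \<open>\<kappa>\<close>. Where the invariant determinant of the traces of
  \<open>\<phi> (g\<^sub>i) * \<phi> (g\<^sub>j)\<close> does not vanish, \<open>\<phi>\<close> is irreducible, and these open sets are dense because any two
  representations of the same type are joined by a rational curve of such representations. In the
  second part all members of the component extend, after a twist of t by a cube root of unity.\<close>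

subsection \<open>Homomorphisms out of presented groups\<close>

text \<open>Once y = z = w is known, the parameters u = b - w and v = a - w only record
  inequalities: u, v \<ge> 0 and w \<ge> max u v say that no eigenvalue multiplicity of s and no one
  of t together exceed n. The excluded types are those where these inequalities do not yield an
  irreducible pair, or where dimension 1 escapes them. The induction carries \<open>full\<close>
  instead of irreducibility because fullness is an open condition: it is witnessed by one nonzero
  determinant, which stays nonzero for generic values of a parameter and, in the form of
  \<open>gram\<close>, is an invariant function. The obstacle is that at \<kappa> = 0 the glued pair
  is block triangular and so never full. What survives the passage to the limit is the corner column
  divided by \<kappa>; this column multiplies like a derivation, and so does the corner row, and the
  two non-splitting conditions say that neither can be removed by a change of basis. The character
  removed at each stage carries the largest multiplicities, as another choice may violate the
  inequalities one dimension lower.\<close>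

definition weval :: "('a, 'b) monoid_scheme \<Rightarrow> ('g \<Rightarrow> 'a) \<Rightarrow> 'g word \<Rightarrow> 'a" where
  "weval H f w = foldr (\<lambda>(g, e) x. (if e then f g else inv\<^bsub>H\<^esub> f g) \<otimes>\<^bsub>H\<^esub> x) w \<one>\<^bsub>H\<^esub>"

lemma weval_Nil [simp]: "weval H f [] = \<one>\<^bsub>H\<^esub>"
  and weval_Cons [simp]: "weval H f ((g, e) # w) = (if e then f g else inv\<^bsub>H\<^esub> f g) \<otimes>\<^bsub>H\<^esub> weval H f w"
  by (simp_all add: weval_def)

lemma weval_map_word: "weval H f (map_word h w) = weval H (\<lambda>g. f (h g)) w"
  by (induction w) (auto simp: map_word_def)

context Group.group
begin

lemma weval_closed [simp]: "(\<And>g. f g \<in> carrier G) \<Longrightarrow> weval G f w \<in> carrier G"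
  by (induction w) auto

lemma weval_append:
  assumes "\<And>g. f g \<in> carrier G"
  shows "weval G f (u @ v) = weval G f u \<otimes> weval G f v"
proof (induction u)
  case (Cons l u)
  obtain g e where "l = (g, e)" by force
  then show ?case using Cons assms by (simp add: m_assoc)
qed (simp add: assms)

lemma weval_word_eq:
  assumes f: "\<And>g. f g \<in> carrier G"
    and R: "\<And>u v. (u, v) \<in> R \<Longrightarrow> weval G f u = weval G f v"
  shows "word_eq R u v \<Longrightarrow> weval G f u = weval G f v"
proof (induction rule: word_eq.induct)
  case (cancel g e)
  then show ?case using f by auto
next
  case (append u u' v v')
  then show ?case by (simp add: weval_append f)
qed (use R in auto)

text \<open>Von Dyck's theorem. A class is evaluated at an arbitrarily chosen representative; the
  choice does not matter because every rule generating \<open>word_eq\<close> holds in the target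
  group once the relations do.\<close>

lemma presented_group_lift:
  assumes f: "\<And>g. f g \<in> carrier G"
    and R: "\<And>u v. (u, v) \<in> R \<Longrightarrow> weval G f u = weval G f v"
  obtains \<phi> where "\<phi> \<in> hom (presented_group R) G" "\<And>w. \<phi> (word_class R w) = weval G f w"
proof -
  define \<phi> where "\<phi> A = weval G f (SOME w. w \<in> A)" for A
  have \<phi>: "\<phi> (word_class R w) = weval G f w" for w
  proof -
    have "(SOME v. v \<in> word_class R w) \<in> word_class R w"
      by (rule someI[of _ w]) (simp add: word_class_def word_eq.refl)
    then have "word_eq R w (SOME v. v \<in> word_class R w)" by (simp add: word_class_def)
    from weval_word_eq[OF f R this] show ?thesis by (simp add: \<phi>_def)
  qed
  have "\<phi> \<in> hom (presented_group R) G"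
  proof (rule homI)
    fix A assume "A \<in> carrier (presented_group R)"
    then obtain u where "A = word_class R u" by (auto simp: presented_group_def)
    then show "\<phi> A \<in> carrier G" using f by (simp add: \<phi>)
  next
    fix A B assume "A \<in> carrier (presented_group R)" "B \<in> carrier (presented_group R)"
    then obtain u v where "A = word_class R u" "B = word_class R v"
      by (auto simp: presented_group_def)
    then show "\<phi> (A \<otimes>\<^bsub>presented_group R\<^esub> B) = \<phi> A \<otimes> \<phi> B"
      using f by (simp add: \<phi> mult_word_class weval_append)
  qed
  with \<phi> that show ?thesis by blast
qed

lemma hom_weval:
  assumes \<phi>: "\<phi> \<in> hom (presented_group R) G"
  shows "\<phi> (word_class R w) = weval G (\<lambda>g. \<phi> (gen R g)) w"
proof (induction w)
  interpret P: Group.group "presented_group R" by (rule group_presented_group)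
  interpret group_hom "presented_group R" G \<phi>
    using \<phi> by unfold_locales
  have car: "word_class R u \<in> carrier (presented_group R)" for u
    by (simp add: presented_group_def)
  have one: "word_class R [] = \<one>\<^bsub>presented_group R\<^esub>"
    by (simp add: presented_group_def)
  {
    case Nil
    show ?case by (simp add: one)
  next
    case (Cons l w)
    obtain g e where l: "l = (g, e)" by force
    have gen: "gen R g = word_class R [(g, True)]" by (simp add: gen_def pos_def)
    have "word_class R [(g, False)] \<otimes>\<^bsub>presented_group R\<^esub> word_class R [(g, True)] = \<one>\<^bsub>presented_group R\<^esub>"
      using word_eq.cancel[of R g False] by (simp add: mult_word_class word_class_eq_iff flip: one)
    then have inv: "word_class R [(g, False)] = inv\<^bsub>presented_group R\<^esub> gen R g"
      by (metis P.inv_equality car gen)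
    have "\<phi> (word_class R [(g, e)]) = (if e then \<phi> (gen R g) else inv (\<phi> (gen R g)))"
      using car by (cases e) (auto simp: inv gen)
    moreover have "word_class R (l # w) = word_class R [(g, e)] \<otimes>\<^bsub>presented_group R\<^esub> word_class R w"
      by (simp add: l mult_word_class)
    ultimately show ?case using Cons car by (simp add: l)
  }
qed

lemma hom_presented_eqI:
  assumes "\<phi> \<in> hom (presented_group R) G" "\<psi> \<in> hom (presented_group R) G"
    and "\<And>g. \<phi> (gen R g) = \<psi> (gen R g)" and "A \<in> carrier (presented_group R)"
  shows "\<phi> A = \<psi> A"
proof -
  obtain w where "A = word_class R w" using assms(4) by (auto simp: presented_group_def)
  then show ?thesis using assms by (simp add: hom_weval)
qed

lemma hom_relation:
  assumes \<phi>: "\<phi> \<in> hom (presented_group R) G" and "(u, v) \<in> R"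
  shows "weval G (\<lambda>g. \<phi> (gen R g)) u = weval G (\<lambda>g. \<phi> (gen R g)) v"
  using assms by (metis hom_weval word_class_eq_iff word_eq.rel)

end

subsection \<open>Matrix representations\<close>

lemma gen_carrier [simp]: "gen R g \<in> carrier (presented_group R)"
  by (simp add: gen_def presented_group_def)

lemma word_class_carrier [simp]: "word_class R w \<in> carrier (presented_group R)"
  by (simp add: presented_group_def)

lemma presented_group_carrierE:
  assumes "A \<in> carrier (presented_group R)" obtains w where "A = word_class R w"
  using assms by (auto simp: presented_group_def)

lemma group_GL: "Group.group (GL n)"
proof -
  interpret ring "ring_mat TYPE(complex) n ()" by (rule ring_mat)
  show ?thesis unfolding GL_def by (rule units_group)
qed

lemma GL_mult [simp]: "A \<otimes>\<^bsub>GL n\<^esub> B = A * B"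
  and GL_one [simp]: "\<one>\<^bsub>GL n\<^esub> = 1\<^sub>m n"
  by (simp_all add: GL_def units_of_def ring_mat_simps)

lemma carrier_GL:
  "A \<in> carrier (GL n) \<longleftrightarrow> A \<in> carrier_mat n n \<and> (\<exists>B\<in>carrier_mat n n. A * B = 1\<^sub>m n \<and> B * A = 1\<^sub>m n)"
  by (auto simp: GL_def units_of_def Units_def ring_mat_simps)

lemma GL_mat: "A \<in> carrier (GL n) \<Longrightarrow> A \<in> carrier_mat n n"
  by (simp add: carrier_GL)

lemma GL_I: "A \<in> carrier_mat n n \<Longrightarrow> B \<in> carrier_mat n n \<Longrightarrow> A * B = 1\<^sub>m n \<Longrightarrow> B * A = 1\<^sub>m n \<Longrightarrow> A \<in> carrier (GL n)"
  by (auto simp: carrier_GL)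

lemma GL_inv_eqI:
  assumes "A \<in> carrier_mat n n" "B \<in> carrier_mat n n" "A * B = 1\<^sub>m n" "B * A = 1\<^sub>m n"
  shows "inv\<^bsub>GL n\<^esub> A = B"
proof -
  interpret Group.group "GL n" by (rule group_GL)
  show ?thesis using assms by (intro inv_equality) (auto intro: GL_I)
qed

lemma GL_inv_mat [simp]: "A \<in> carrier (GL n) \<Longrightarrow> inv\<^bsub>GL n\<^esub> A \<in> carrier_mat n n"
  and GL_inv_left [simp]: "A \<in> carrier (GL n) \<Longrightarrow> inv\<^bsub>GL n\<^esub> A * A = 1\<^sub>m n"
  and GL_inv_right [simp]: "A \<in> carrier (GL n) \<Longrightarrow> A * inv\<^bsub>GL n\<^esub> A = 1\<^sub>m n"
proof -
  interpret Group.group "GL n" by (rule group_GL)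
  assume A: "A \<in> carrier (GL n)"
  show "inv\<^bsub>GL n\<^esub> A \<in> carrier_mat n n" using A by (auto intro: GL_mat)
  show "inv\<^bsub>GL n\<^esub> A * A = 1\<^sub>m n" using l_inv[OF A] by simp
  show "A * inv\<^bsub>GL n\<^esub> A = 1\<^sub>m n" using r_inv[OF A] by simp
qed

lemma rep_mat [simp]: "\<phi> \<in> reps n G \<Longrightarrow> g \<in> carrier G \<Longrightarrow> \<phi> g \<in> carrier_mat n n"
  by (auto simp: reps_def hom_def Pi_iff intro: GL_mat)

lemma rep_GL: "\<phi> \<in> reps n G \<Longrightarrow> g \<in> carrier G \<Longrightarrow> \<phi> g \<in> carrier (GL n)"
  by (auto simp: reps_def hom_def Pi_iff)

lemma rep_mult: "\<phi> \<in> reps n G \<Longrightarrow> g \<in> carrier G \<Longrightarrow> h \<in> carrier G \<Longrightarrow> \<phi> (g \<otimes>\<^bsub>G\<^esub> h) = \<phi> g * \<phi> h"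
  by (auto simp: reps_def hom_def)

lemmas rep_weval = group.hom_weval[OF group_GL, folded reps_def]
lemmas rep_relation = group.hom_relation[OF group_GL, folded reps_def]
lemmas rep_eqI = group.hom_presented_eqI[OF group_GL, folded reps_def]
lemmas rep_lift = group.presented_group_lift[OF group_GL, folded reps_def]

abbreviation "s_mat \<psi> \<equiv> \<psi> (gen mod_rels M_s)"
abbreviation "t_mat \<psi> \<equiv> \<psi> (gen mod_rels M_t)"

text \<open>Cubes are bracketed to the right throughout, since \<open>weval\<close> folds a word
  from the right.\<close>

lemma mod_rep_relations:
  assumes \<psi>: "\<psi> \<in> reps n ModGrp"
  shows "s_mat \<psi> * s_mat \<psi> = 1\<^sub>m n" "t_mat \<psi> * (t_mat \<psi> * t_mat \<psi>) = 1\<^sub>m n"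
    "s_mat \<psi> \<in> carrier_mat n n" "t_mat \<psi> \<in> carrier_mat n n"
proof -
  show *: "s_mat \<psi> \<in> carrier_mat n n" "t_mat \<psi> \<in> carrier_mat n n" using \<psi> by auto
  show "s_mat \<psi> * s_mat \<psi> = 1\<^sub>m n" "t_mat \<psi> * (t_mat \<psi> * t_mat \<psi>) = 1\<^sub>m n"
    using rep_relation[OF \<psi>, of "pos [M_s, M_s]" "[]"]
      rep_relation[OF \<psi>, of "pos [M_t, M_t, M_t]" "[]"] *
    by (simp_all add: mod_rels_def pos_def)
qed

lemma mod_rep_exists:
  assumes "S \<in> carrier_mat n n" "T \<in> carrier_mat n n"
    and "S * S = 1\<^sub>m n" "T * (T * T) = 1\<^sub>m n"
  obtains \<psi> where "\<psi> \<in> reps n ModGrp" "s_mat \<psi> = S" "t_mat \<psi> = T"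
proof -
  define f where "f g = (case g of M_s \<Rightarrow> S | M_t \<Rightarrow> T)" for g
  have "S \<in> carrier (GL n)" "T \<in> carrier (GL n)"
    using assms by (auto intro: GL_I[of S n S] GL_I[of T n "T * T"] simp: assoc_mult_mat[of T n n T n T n])
  then have f: "f g \<in> carrier (GL n)" for g by (cases g) (auto simp: f_def)
  have R: "weval (GL n) f u = weval (GL n) f v" if "(u, v) \<in> mod_rels" for u v
    using that assms by (auto simp: mod_rels_def f_def pos_def)
  obtain \<psi> where "\<psi> \<in> reps n ModGrp" "\<And>w. \<psi> (word_class mod_rels w) = weval (GL n) f w"
    using rep_lift[OF f R] by metis
  moreover from this have "s_mat \<psi> = S" "t_mat \<psi> = T"
    using assms by (simp_all add: gen_def pos_def f_def)
  ultimately show ?thesis using that by blast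
qed


subsection \<open>Linear algebra\<close>

abbreviation eigmult :: "complex \<Rightarrow> complex mat \<Rightarrow> nat" where
  "eigmult a A \<equiv> Polynomial.order a (char_poly A)"

lemma pair_index_less:
  fixes a b n :: nat
  assumes "a < n" "b < n"
  shows "a * n + b < n * n"
proof -
  have "a * n + b < Suc a * n" using assms by simp
  also have "\<dots> \<le> n * n" using assms by (intro mult_le_mono1) simp
  finally show ?thesis .
qed

text \<open>Take as many members of V as possible that can be completed to rows of an invertible matrix.
  If there are fewer than d, the cofactors of the next row annihilate V.\<close>

lemma det_or_annihilator:
  fixes V :: "(nat \<Rightarrow> 'a :: comm_ring_1) set"
  shows "(\<exists>r. (\<forall>i<d. r i \<in> V) \<and> det (mat d d (\<lambda>(i, j). r i j)) \<noteq> 0) \<or>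
         (\<exists>x. (\<exists>j<d. x j \<noteq> 0) \<and> (\<forall>v\<in>V. (\<Sum>j<d. v j * x j) = 0))"
proof -
  define M where "M r = mat d d (\<lambda>(i, j). r i j :: 'a)" for r
  define P where "P k \<longleftrightarrow> (\<exists>r. (\<forall>i<k. r i \<in> V) \<and> det (M r) \<noteq> 0)" for k
  have "M (\<lambda>i j. if i = j then 1 else 0) = 1\<^sub>m d" by (auto simp: M_def)
  then have P0: "P 0" unfolding P_def by (metis det_one less_nat_zero_code zero_neq_one)
  show ?thesis
  proof (cases "P d")
    case True
    then show ?thesis by (auto simp: P_def M_def)
  next
    case False
    then obtain k where k: "k < d" "P k" "\<not> P (Suc k)"
      using P0 by (metis less_Suc_eq_le nat_induct_at_least not_less zero_le inc_induct
          dec_induct)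
    then obtain r where r: "\<forall>i<k. r i \<in> V" "det (M r) \<noteq> 0" by (auto simp: P_def)
    define x where "x j = cofactor (M r) k j" for j
    have expand: "det (M (r(k := v))) = (\<Sum>j<d. v j * x j)" for v
    proof -
      have "mat_delete (M (r(k := v))) k j = mat_delete (M r) k j" for j
        unfolding mat_delete_def M_def by (rule eq_matI) auto
      then have "cofactor (M (r(k := v))) k j = x j" for j
        by (simp add: x_def cofactor_def)
      then show ?thesis
        using laplace_expansion_row[of "M (r(k := v))" d k] k(1) by (simp add: M_def)
    qed
    \<comment> \<open>Putting back row k itself recovers the nonzero determinant of
      \<open>M r\<close>, so not all cofactors vanish.\<close>
    have "(\<Sum>j<d. r k j * x j) \<noteq> 0" using r(2) expand[of "r k"] by simp
    then have "\<exists>j<d. x j \<noteq> 0" by (metis (mono_tags, lifting) lessThan_iff mult_zero_right sum.neutral)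
    moreover have "(\<Sum>j<d. v j * x j) = 0" if "v \<in> V" for v
    proof -
      have "\<forall>i<Suc k. (r(k := v)) i \<in> V" using r(1) that by (simp add: less_Suc_eq)
      then show ?thesis using k(3) expand[of v] unfolding P_def by metis
    qed
    ultimately show ?thesis by auto
  qed
qed

text \<open>Fewer than d rows cannot fill a d by d matrix without a repetition, and a repetition
  makes the determinant zero; so the second alternative of \<open>det_or_annihilator\<close> must
  hold.\<close>

lemma few_equations:
  fixes r :: "'i \<Rightarrow> nat \<Rightarrow> 'a :: comm_ring_1"
  assumes "finite I" "card I < d"
  obtains x where "\<exists>j<d. x j \<noteq> 0" "\<And>i. i \<in> I \<Longrightarrow> (\<Sum>j<d. r i j * x j) = 0"
proof -
  have False if q: "\<forall>i<d. q i \<in> r ` I" "det (mat d d (\<lambda>(i, j). q i j)) \<noteq> 0" for q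
  proof -
    have "inj_on q {..<d}"
    proof (rule inj_onI, rule ccontr)
      fix i j assume ij: "i \<in> {..<d}" "j \<in> {..<d}" "q i = q j" "i \<noteq> j"
      have "row (mat d d (\<lambda>(i, j). q i j)) i = row (mat d d (\<lambda>(i, j). q i j)) j"
        by (rule eq_vecI) (use ij in auto)
      then show False using det_identical_rows[of "mat d d (\<lambda>(i, j). q i j)" d i j] ij q by auto
    qed
    moreover have "q ` {..<d} \<subseteq> r ` I" using q by auto
    ultimately have "card {..<d} \<le> card (r ` I)"
      using assms by (metis card_inj_on_le finite_imageI)
    then show False using card_image_le[OF assms(1), of r] assms(2) by simp
  qed
  then show ?thesis using det_or_annihilator[of d "r ` I"] that by blast
qed

section \<open>Diagonalising matrices of finite order\<close>

lemma diag_block_mat_eq_one: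
  "diag_block_mat As = 1\<^sub>m n \<Longrightarrow> \<forall>A\<in>set As. square_mat A \<Longrightarrow> A \<in> set As \<Longrightarrow> A = 1\<^sub>m (dim_row A)"
proof (induction As arbitrary: n)
  case (Cons B As)
  define C where "C = diag_block_mat As"
  have sq: "square_mat B" "square_mat C"
    using Cons.prems by (auto simp: C_def dim_diag_block_mat intro!: arg_cong[of _ _ sum_list])
  have eq: "four_block_mat B (0\<^sub>m (dim_row B) (dim_col C)) (0\<^sub>m (dim_row C) (dim_col B)) C = 1\<^sub>m n"
    using Cons.prems by (simp add: C_def Let_def)
  from arg_cong[OF eq, of dim_row] have n: "n = dim_row B + dim_row C" by simp
  have "B $$ (i, j) = (if i = j then 1 else 0)" if "i < dim_row B" "j < dim_row B" for i j
    using arg_cong[OF eq, of "\<lambda>M. M $$ (i, j)"] that sq n by auto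
  then have B: "B = 1\<^sub>m (dim_row B)" using sq by (intro eq_matI) auto
  have "C $$ (i, j) = (if i = j then 1 else 0)" if "i < dim_row C" "j < dim_row C" for i j
    using arg_cong[OF eq, of "\<lambda>M. M $$ (i + dim_row B, j + dim_row B)"] that sq n by auto
  then have "C = 1\<^sub>m (dim_row C)" using sq by (intro eq_matI) auto
  then show ?case using Cons B by (auto simp: C_def)
qed simp

text \<open>The entry next to the diagonal in the k-th power is k a^(k-1), which cannot vanish in
  characteristic 0 when a^k = 1.\<close>

lemma jordan_block_finite_order:
  fixes a :: complex
  assumes "jordan_block m a ^\<^sub>m k = 1\<^sub>m m" "m > 0" "k > 0"
  shows "m = 1"
proof (rule ccontr)
  assume "m \<noteq> 1"
  then have m: "0 < m" "1 < m" using assms by auto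
  have "a ^ k = 1" using arg_cong[OF assms(1), of "\<lambda>M. M $$ (0, 0)"] m by (simp add: jordan_block_pow)
  moreover have "of_nat k * a ^ (k - 1) = 0"
    using arg_cong[OF assms(1), of "\<lambda>M. M $$ (0, 1)"] m by (simp add: jordan_block_pow)
  ultimately show False using assms(3) by (auto simp: power_0_left)
qed

lemma jordan_matrix_diagonal:
  "\<forall>(m, a)\<in>set n_as. m = 1 \<Longrightarrow> jordan_matrix n_as = mat_diag (length n_as) (\<lambda>i. snd (n_as ! i))"
proof (induction n_as)
  case Nil
  then show ?case by (auto simp: jordan_matrix_def mat_diag_def)
next
  case (Cons p n_as)
  then obtain a where p: "p = (1, a)" by (cases p) auto
  have "jordan_matrix (p # n_as) = four_block_mat (jordan_block 1 a) (0\<^sub>m 1 (length n_as))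
    (0\<^sub>m (length n_as) 1) (mat_diag (length n_as) (\<lambda>i. snd (n_as ! i)))"
    using Cons by (simp add: p jordan_matrix_def Let_def mat_diag_def)
  also have "\<dots> = mat_diag (length (p # n_as)) (\<lambda>i. snd ((p # n_as) ! i))"
    by (rule eq_matI) (auto simp: mat_diag_def jordan_block_def p nth_Cons')
  finally show ?case .
qed

lemma similar_GL:
  assumes "similar_mat A B" "A \<in> carrier_mat n n"
  obtains P where "P \<in> carrier (GL n)" "A * P = P * B" "B \<in> carrier_mat n n"
proof -
  from similar_matD[OF assms(1)] obtain m P Q where *: "{A, B, P, Q} \<subseteq> carrier_mat m m"
    "P * Q = 1\<^sub>m m" "Q * P = 1\<^sub>m m" "A = P * B * Q" by blast
  with assms(2) have m: "m = n" by auto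
  have "A * P = P * B * (Q * P)" unfolding *(4) using * by (intro assoc_mult_mat) auto
  then have "A * P = P * B" using * by auto
  then show ?thesis using * that[of P] by (auto simp: m intro: GL_I)
qed

lemma GL_similar:
  assumes "P \<in> carrier (GL n)" "A * P = P * B" "A \<in> carrier_mat n n" "B \<in> carrier_mat n n"
  shows "similar_mat A B"
proof -
  obtain Q where Q: "Q \<in> carrier_mat n n" "P * Q = 1\<^sub>m n" "Q * P = 1\<^sub>m n"
    using assms(1) by (auto simp: carrier_GL)
  have P: "P \<in> carrier_mat n n" using assms(1) by (rule GL_mat)
  have "A = A * (P * Q)" using assms Q by simp
  also have "\<dots> = A * P * Q" using assms P Q by (intro assoc_mult_mat[symmetric]) auto
  finally have "A = P * B * Q" using assms(2) by simp
  then show ?thesis using assms P Q by (intro similar_matI[of _ _ P Q n]) auto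
qed

lemma pow_2_3: "A \<in> carrier_mat n n \<Longrightarrow> A ^\<^sub>m 2 = A * A" "A \<in> carrier_mat n n \<Longrightarrow> A ^\<^sub>m 3 = A * (A * A)"
  by (auto simp: numeral_2_eq_2 numeral_3_eq_3 assoc_mult_mat[of A n n A n A n])

lemma order_char_poly_diag:
  "eigmult a (mat_diag n D) = card {i. i < n \<and> D i = (a :: complex)}"
proof -
  have cp: "char_poly (mat_diag n D) = (\<Prod>i<n. [:- D i, 1:])"
  proof -
    have "char_poly (mat_diag n D) = (\<Prod>a\<leftarrow>diag_mat (mat_diag n D). [:- a, 1:])"
      by (rule char_poly_upper_triangular) (auto simp: mat_diag_def)
    also have "diag_mat (mat_diag n D) = map D [0..<n]" by (auto simp: diag_mat_def mat_diag_def)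
    also have "(\<Prod>a\<leftarrow>map D [0..<n]. [:- a, 1:]) = (\<Prod>i<n. [:- D i, 1:])"
      by (simp add: comp_def prod.distinct_set_conv_list[symmetric] atLeast0LessThan)
    finally show ?thesis .
  qed
  have "Polynomial.order a (\<Prod>i<m. [:- D i, 1:]) = card {i. i < m \<and> D i = a}" for m
  proof (induction m)
    case (Suc m)
    have ne: "(\<Prod>i<m. [:- D i, 1:]) \<noteq> 0" by (auto simp: prod_zero_iff)
    have "{i. i < Suc m \<and> D i = a} = {i. i < m \<and> D i = a} \<union> (if D m = a then {m} else {})"
      by (auto simp: less_Suc_eq)
    moreover have "Polynomial.order a [:- D m, 1:] = (if D m = a then 1 else 0)"
      using order_power_n_n[of a 1] by (auto intro!: order_0I)
    moreover have "Polynomial.order a ((\<Prod>i<m. [:- D i, 1:]) * [:- D m, 1:]) =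
      Polynomial.order a (\<Prod>i<m. [:- D i, 1:]) + Polynomial.order a [:- D m, 1:]"
      using ne by (intro order_mult) (auto simp del: mult_pCons_right)
    ultimately show ?case using Suc by (simp del: mult_pCons_right)
  qed simp
  then show ?thesis by (simp add: cp)
qed

text \<open>A power equal to the identity is the identity on each Jordan block, and this forces all
  blocks to have size 1. The algebraic multiplicities in a dimension type thereby become numbers of
  indices.\<close>

lemma finite_order_diagonal:
  fixes A :: "complex mat"
  assumes A: "A \<in> carrier_mat n n" and "A ^\<^sub>m k = 1\<^sub>m n" "k > 0"
  obtains P D where "P \<in> carrier (GL n)" "A * P = P * mat_diag n D"
    "\<And>i. i < n \<Longrightarrow> D i ^ k = 1"
    "\<And>a. eigmult a A = card {i. i < n \<and> D i = a}"
proof -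
  obtain as where "char_poly A = (\<Prod>a\<leftarrow>as. [:- a, 1:])"
    using char_poly_factorized[OF A] by auto
  from jordan_nf_exists[OF A this] obtain n_as where J: "jordan_nf A n_as" ..
  then have n_as: "0 \<notin> fst ` set n_as" and sim: "similar_mat A (jordan_matrix n_as)"
    by (auto simp: jordan_nf_def)
  from similar_GL[OF sim A] obtain P where P: "P \<in> carrier (GL n)" "A * P = P * jordan_matrix n_as"
    "jordan_matrix n_as \<in> carrier_mat n n" by blast
  have "similar_mat (A ^\<^sub>m k) (jordan_matrix n_as ^\<^sub>m k)"
    using sim unfolding similar_mat_def by (blast intro: similar_mat_wit_pow)
  from similar_GL[OF this, of n] A obtain Q where Q: "Q \<in> carrier (GL n)"
    "1\<^sub>m n * Q = Q * (jordan_matrix n_as ^\<^sub>m k)" using assms(2) by auto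
  \<comment> \<open>A matrix similar to the identity is the identity.\<close>
  have "jordan_matrix n_as ^\<^sub>m k = (inv\<^bsub>GL n\<^esub> Q * Q) * jordan_matrix n_as ^\<^sub>m k"
    using P Q by auto
  also have "\<dots> = inv\<^bsub>GL n\<^esub> Q * (Q * jordan_matrix n_as ^\<^sub>m k)"
    using P Q GL_mat[OF Q(1)] by (intro assoc_mult_mat[of _ n n _ n _ n]) auto
  also have "\<dots> = 1\<^sub>m n" using Q GL_mat[OF Q(1)] by (simp flip: Q(2))
  finally have Jk: "diag_block_mat (map (\<lambda>(n, a). jordan_block n a ^\<^sub>m k) n_as) = 1\<^sub>m n"
    by (simp add: jordan_matrix_pow)
  have m1: "m = 1" if "(m, a) \<in> set n_as" for m a
  proof -
    have "jordan_block m a ^\<^sub>m k \<in> set (map (\<lambda>(n, a). jordan_block n a ^\<^sub>m k) n_as)"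
      using image_eqI[OF _ that, of _ "\<lambda>(n, a). jordan_block n a ^\<^sub>m k"] by simp
    then have "jordan_block m a ^\<^sub>m k = 1\<^sub>m (dim_row (jordan_block m a ^\<^sub>m k))"
      by (rule diag_block_mat_eq_one[OF Jk, rotated]) auto
    then show ?thesis using that n_as assms(3)
      by (intro jordan_block_finite_order[of m a k]) (force simp: image_iff)+
  qed
  define D where "D i = snd (n_as ! i)" for i
  have JD: "jordan_matrix n_as = mat_diag (length n_as) D"
    unfolding D_def[abs_def] using m1 by (intro jordan_matrix_diagonal) auto
  with P(3) have len: "length n_as = n" by (auto simp: mat_diag_def)
  have "mat_diag n D ^\<^sub>m j = mat_diag n (\<lambda>i. D i ^ j)" for j
    by (induction j) (simp_all add: carrier_matD(1)[OF mat_diag_dim] mult.commute)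
  then have Dk: "mat_diag n (\<lambda>i. D i ^ k) = 1\<^sub>m n"
    using Jk JD len by (simp flip: jordan_matrix_pow)
  have "D i ^ k = 1" if "i < n" for i
    using arg_cong[OF Dk, of "\<lambda>M. M $$ (i, i)"] that by (simp add: mat_diag_def)
  moreover have "eigmult a A = card {i. i < n \<and> D i = a}" for a
    using char_poly_similar[OF sim] by (simp add: JD len order_char_poly_diag)
  ultimately show ?thesis using that[of P D] P by (simp add: JD len)
qed

text \<open>The inverse is given explicitly because for an involution p both factors are the same
  matrix, which then squares to the identity.\<close>

lemma perm_mat_GL:
  assumes p: "p permutes {..<n}"
  shows "mat n n (\<lambda>(i, j). if i = p j then 1 else 0) \<in> carrier (GL n)"
    "mat n n (\<lambda>(i, j). if i = p j then 1 else 0) * mat n n (\<lambda>(i, j). if j = p i then 1 else 0) = (1\<^sub>m n :: complex mat)"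
proof -
  let ?A = "mat n n (\<lambda>(i, j). if i = p j then 1 else (0 :: complex))"
  let ?B = "mat n n (\<lambda>(i, j). if j = p i then 1 else (0 :: complex))"
  have lt: "p i < n" if "i < n" for i using p that by (metis lessThan_iff permutes_in_image)
  have lt': "inv_into UNIV p i < n" if "i < n" for i
    using permutes_inv[OF p] that by (metis lessThan_iff permutes_in_image)
  have pinv: "i = p k \<longleftrightarrow> k = inv_into UNIV p i" for i k using permutes_inverses[OF p] by metis
  have inj: "p i = p j \<longleftrightarrow> i = j" for i j using p by (meson injD permutes_inj)
  show AB: "?A * ?B = 1\<^sub>m n"
  proof (rule eq_matI)
    fix i j assume ij: "i < dim_row (1\<^sub>m n)" "j < dim_col (1\<^sub>m n)"
    then have "(?A * ?B) $$ (i, j) = (\<Sum>k = 0..<n. (if i = p k then 1 else 0) * (if j = p k then 1 else 0))"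
      by (simp add: scalar_prod_def)
    also have "\<dots> = (\<Sum>k = 0..<n. if k = inv_into UNIV p i then (if j = i then 1 else 0) else 0)"
    proof (rule sum.cong)
      fix k assume "k \<in> {0..<n}"
      show "(if i = p k then 1 else 0) * (if j = p k then 1 else 0) =
        (if k = inv_into UNIV p i then (if j = i then 1 else 0) else (0 :: complex))"
        using pinv[of i k] by auto
    qed simp
    finally show "(?A * ?B) $$ (i, j) = 1\<^sub>m n $$ (i, j)" using ij lt' by (simp add: sum.delta)
  qed auto
  have BA: "?B * ?A = 1\<^sub>m n"
  proof (rule eq_matI)
    fix i j assume ij: "i < dim_row (1\<^sub>m n)" "j < dim_col (1\<^sub>m n)"
    then have "(?B * ?A) $$ (i, j) = (\<Sum>k = 0..<n. (if k = p i then 1 else 0) * (if k = p j then 1 else 0))"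
      by (simp add: scalar_prod_def)
    also have "\<dots> = (\<Sum>k = 0..<n. if k = p i then (if j = i then 1 else 0) else 0)"
      by (rule sum.cong) (auto simp: inj)
    finally show "(?B * ?A) $$ (i, j) = 1\<^sub>m n $$ (i, j)" using ij lt by (simp add: sum.delta)
  qed auto
  show "?A \<in> carrier (GL n)" by (rule GL_I[OF _ _ AB BA]) auto
qed

text \<open>Two diagonal matrices with the same multiset of entries differ by a permutation matrix.
  Comparing multiplicities at the k-th roots of unity suffices, as no other eigenvalue
  occurs.\<close>

lemma finite_order_conjugate:
  fixes A B :: "complex mat"
  assumes A: "A \<in> carrier_mat n n" "A ^\<^sub>m k = 1\<^sub>m n" and B: "B \<in> carrier_mat n n" "B ^\<^sub>m k = 1\<^sub>m n"
    and k: "k > 0"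
    and mult: "\<And>a. a ^ k = 1 \<Longrightarrow> eigmult a A = eigmult a B"
  obtains R where "R \<in> carrier (GL n)" "B * R = R * A"
proof -
  interpret GL: Group.group "GL n" by (rule group_GL)
  obtain P D where P: "P \<in> carrier (GL n)" "A * P = P * mat_diag n D" "\<And>i. i < n \<Longrightarrow> D i ^ k = 1"
    "\<And>a. eigmult a A = card {i. i < n \<and> D i = a}"
    using finite_order_diagonal[OF A k] by metis
  obtain Q E where Q: "Q \<in> carrier (GL n)" "B * Q = Q * mat_diag n E" "\<And>i. i < n \<Longrightarrow> E i ^ k = 1"
    "\<And>a. eigmult a B = card {i. i < n \<and> E i = a}"
    using finite_order_diagonal[OF B k] by metis
  have "card {i. i < n \<and> D i = a} = card {i. i < n \<and> E i = a}" for a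
  proof (cases "a ^ k = 1")
    case True
    then show ?thesis using mult P(4) Q(4) by simp
  next
    case False
    then have "{i. i < n \<and> D i = a} = {}" "{i. i < n \<and> E i = a} = {}" using P(3) Q(3) by auto
    then show ?thesis by (simp only: card.empty)
  qed
  then have "image_mset D (mset_set {..<n}) = image_mset E (mset_set {..<n})"
    by (intro multiset_eqI) (simp add: count_image_mset_eq_card_vimage)
  then obtain p where p: "p permutes {..<n}" "\<forall>i\<in>{..<n}. D i = E (p i)"
    by (rule image_mset_eq_implies_permutes[OF finite_lessThan])
  define M where "M = mat n n (\<lambda>(i, j). if i = p j then 1 else (0 :: complex))"
  have M: "M \<in> carrier (GL n)" unfolding M_def by (rule perm_mat_GL[OF p(1)])
  have Mm: "M \<in> carrier_mat n n" by (simp add: M_def)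
  have ME: "mat_diag n E * M = M * mat_diag n D"
    unfolding mat_diag_mult_left[OF Mm] mat_diag_mult_right[OF Mm]
    by (rule eq_matI) (use p(2) in \<open>auto simp: M_def\<close>)
  note [simp] = GL_mat[OF P(1)] GL_mat[OF Q(1)] Mm GL_inv_mat[OF P(1)]
  define P' where "P' = inv\<^bsub>GL n\<^esub> P"
  have [simp]: "P' \<in> carrier_mat n n" by (simp add: P'_def)
  note assoc = assoc_mult_mat[of _ n n _ n _ n] mult_carrier_mat[of _ n n _ n]
  have PP: "P * P' = 1\<^sub>m n" "P' * P = 1\<^sub>m n" using P by (simp_all add: P'_def)
  have DP: "mat_diag n D * P' = P' * A"
  proof -
    have "P' * A = P' * (A * (P * P'))" using A by (simp add: PP)
    also have "\<dots> = P' * ((A * P) * P')" using A by (simp add: assoc)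
    also have "\<dots> = (P' * P) * (mat_diag n D * P')" unfolding P(2) by (simp add: assoc)
    also have "\<dots> = mat_diag n D * P'" unfolding PP by (rule left_mult_one_mat[of _ n n]) (simp add: assoc)
    finally show ?thesis by simp
  qed
  have "B * (Q * (M * P')) = (B * Q) * (M * P')" using B by (simp add: assoc)
  also have "\<dots> = Q * ((mat_diag n E * M) * P')" unfolding Q(2) by (simp add: assoc)
  also have "\<dots> = Q * (M * (mat_diag n D * P'))" unfolding ME by (simp add: assoc)
  also have "\<dots> = (Q * (M * P')) * A" unfolding DP using A by (simp add: assoc)
  finally have "B * (Q * (M * P')) = (Q * (M * P')) * A" .
  moreover have "Q * (M * P') \<in> carrier (GL n)"
    using GL.m_closed[OF Q(1) GL.m_closed[OF M GL.inv_closed[OF P(1)]]] by (simp add: P'_def)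
  ultimately show ?thesis using that by blast
qed


subsection \<open>Noncommutative polynomials in two matrices\<close>

text \<open>Polynomials are kept as syntax so that one and the same expression can be evaluated at a
  pair, at its deformations and, through \<open>upper\<close>, \<open>lower\<close> and
  \<open>chi\<close>, in their limit.\<close>

datatype nc = NConst complex | NS | NT | NAdd nc nc | NMul nc nc

primrec nev :: "nat \<Rightarrow> complex mat \<Rightarrow> complex mat \<Rightarrow> nc \<Rightarrow> complex mat" where
  "nev n S T (NConst c) = c \<cdot>\<^sub>m 1\<^sub>m n"
| "nev n S T NS = S"
| "nev n S T NT = T"
| "nev n S T (NAdd f g) = nev n S T f + nev n S T g"
| "nev n S T (NMul f g) = nev n S T f * nev n S T g"

text \<open>For n > 0 this is irreducibility of the pair, by Burnside's theorem, in the form that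
  the induction on the dimension produces and consumes.\<close>

definition full :: "nat \<Rightarrow> complex mat \<Rightarrow> complex mat \<Rightarrow> bool" where
  "full n S T \<longleftrightarrow> (\<forall>M\<in>carrier_mat n n. \<exists>f. nev n S T f = M)"

lemma nev_closed: "S \<in> carrier_mat n n \<Longrightarrow> T \<in> carrier_mat n n \<Longrightarrow> nev n S T f \<in> carrier_mat n n"
  by (induction f) (auto intro: mult_carrier_mat[of _ n n])

lemma nev_sum:
  fixes d :: nat
  assumes "S \<in> carrier_mat n n" "T \<in> carrier_mat n n"
  shows "\<exists>f. nev n S T f = mat n n (\<lambda>(i, j). \<Sum>r<d. x r * nev n S T (F r) $$ (i, j))"
proof (induction d)
  case 0
  show ?case by (rule exI[of _ "NConst 0"]) auto
next
  case (Suc d)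
  then obtain f where f: "nev n S T f = mat n n (\<lambda>(i, j). \<Sum>r<d. x r * nev n S T (F r) $$ (i, j))" by blast
  have "nev n S T (F d) \<in> carrier_mat n n" using assms by (rule nev_closed)
  then have "nev n S T (NAdd f (NMul (NConst (x d)) (F d))) =
    mat n n (\<lambda>(i, j). \<Sum>r<Suc d. x r * nev n S T (F r) $$ (i, j))"
    by (auto simp: f mult_smult_assoc_mat[of _ n n _ n])
  then show ?case by blast
qed

section \<open>Matrix units and bordered matrices\<close>

definition E_mat :: "nat \<Rightarrow> nat \<Rightarrow> nat \<Rightarrow> complex mat" where
  "E_mat n i j = mat n n (\<lambda>(a, b). if a = i \<and> b = j then 1 else 0)"

lemma E_mat_carrier [simp]: "E_mat n i j \<in> carrier_mat n n"
  by (simp add: E_mat_def)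

lemma E_mat_mult: "j < n \<Longrightarrow> E_mat n i j * E_mat n k l = (if j = k then E_mat n i l else 0\<^sub>m n n)"
  by (rule eq_matI) (auto simp: E_mat_def scalar_prod_def if_distrib[of "\<lambda>x. x * _"] cong: if_cong)

text \<open>The last row is stored as a column vector h, which is why products act on it by
  transposes.\<close>

definition blk :: "nat \<Rightarrow> complex mat \<Rightarrow> complex vec \<Rightarrow> complex vec \<Rightarrow> complex \<Rightarrow> complex mat" where
  "blk n A g h c = mat (Suc n) (Suc n)
     (\<lambda>(i, j). if i < n then if j < n then A $$ (i, j) else g $ i else if j < n then h $ j else c)"

lemma blk_carrier [simp]: "blk n A g h c \<in> carrier_mat (Suc n) (Suc n)"
  by (simp add: blk_def)

lemma blk_one: "blk n (1\<^sub>m n) (0\<^sub>v n) (0\<^sub>v n) 1 = 1\<^sub>m (Suc n)"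
  by (rule eq_matI) (auto simp: blk_def)

lemma blk_mult:
  assumes "A \<in> carrier_mat n n" "A' \<in> carrier_mat n n" "g \<in> carrier_vec n" "g' \<in> carrier_vec n"
    "h \<in> carrier_vec n" "h' \<in> carrier_vec n"
  shows "blk n A g h c * blk n A' g' h' c' =
    blk n (A * A' + mat n n (\<lambda>(i, j). g $ i * h' $ j)) (A *\<^sub>v g' + c' \<cdot>\<^sub>v g)
      (A'\<^sup>T *\<^sub>v h + c \<cdot>\<^sub>v h') (h \<bullet> g' + c * c')" (is "?B * ?B' = ?C")
proof (rule eq_matI)
  fix i j
  assume "i < dim_row ?C" "j < dim_col ?C"
  then have ij: "i < Suc n" "j < Suc n" by (auto simp: blk_def)
  have "(?B * ?B') $$ (i, j) = (\<Sum>k = 0..<Suc n. ?B $$ (i, k) * ?B' $$ (k, j))"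
    using ij by (simp add: scalar_prod_def blk_def)
  also have "\<dots> = (\<Sum>k = 0..<n. ?B $$ (i, k) * ?B' $$ (k, j)) + ?B $$ (i, n) * ?B' $$ (n, j)" by simp
  finally show "(?B * ?B') $$ (i, j) = ?C $$ (i, j)"
    using ij assms by (auto simp: blk_def scalar_prod_def mult.commute intro!: sum.cong)
qed (auto simp: blk_def)

text \<open>The matrix is block triangular. Both directions occur: the deformation borders S by a
  row and T by a column.\<close>

lemma char_poly_blk:
  assumes A: "A \<in> carrier_mat n n" and "g = 0\<^sub>v n \<or> h = 0\<^sub>v n"
  shows "char_poly (blk n A g h c) = char_poly A * [:- c, 1:]"
proof -
  define P where "P = char_poly_matrix A"
  define G where "G = mat n 1 (\<lambda>(i, _). [:- (g $ i):])"
  define H where "H = mat 1 n (\<lambda>(_, j). [:- (h $ j):])"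
  define C where "C = mat 1 1 (\<lambda>_. [:- c, 1:])"
  have car: "P \<in> carrier_mat n n" "G \<in> carrier_mat n 1" "H \<in> carrier_mat 1 n" "C \<in> carrier_mat 1 1"
    using A by (auto simp: P_def G_def H_def C_def char_poly_matrix_def)
  have eq: "char_poly_matrix (blk n A g h c) = four_block_mat P G H C"
    by (rule eq_matI) (use A in \<open>auto simp: P_def G_def H_def C_def char_poly_matrix_def blk_def less_Suc_eq\<close>)
  have "det C = [:- c, 1:]" unfolding C_def by (subst det_single) auto
  moreover have "det (four_block_mat P G H C) = det P * det C"
  proof (cases "g = 0\<^sub>v n")
    case True
    then have "G = 0\<^sub>m n 1" by (auto simp: G_def)
    then show ?thesis using det_four_block_mat_upper_right_zero[OF car(1) _ car(3,4)] by simp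
  next
    case False
    then have "H = 0\<^sub>m 1 n" using assms(2) by (auto simp: H_def)
    then show ?thesis using det_four_block_mat_lower_left_zero[OF car(1,2) _ car(4)] by simp
  qed
  ultimately show ?thesis by (simp add: char_poly_def eq P_def)
qed

text \<open>Transitivity of the matrix algebra on nonzero vectors, by which a single nonzero value
  of \<open>upper\<close> or \<open>lower\<close> yields all vectors.\<close>

lemma mat_with_value:
  fixes g g' :: "complex vec"
  assumes "g \<in> carrier_vec n" "g' \<in> carrier_vec n" "g \<noteq> 0\<^sub>v n"
  obtains M where "M \<in> carrier_mat n n" "M *\<^sub>v g = g'"
proof -
  have "\<exists>k<n. g $ k \<noteq> 0"
  proof (rule ccontr)
    assume "\<not> ?thesis"
    then have "g = 0\<^sub>v n" using assms by (intro eq_vecI) auto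
    with assms show False by simp
  qed
  then obtain k where k: "k < n" "g $ k \<noteq> 0" by blast
  have "mat n n (\<lambda>(i, j). if j = k then g' $ i / g $ k else 0) *\<^sub>v g = g'"
  proof (rule eq_vecI)
    fix i assume "i < dim_vec g'"
    then have "(mat n n (\<lambda>(i, j). if j = k then g' $ i / g $ k else 0) *\<^sub>v g) $ i =
      (\<Sum>j = 0..<n. (if j = k then g' $ i / g $ k else 0) * g $ j)"
      using assms by (simp add: scalar_prod_def)
    also have "\<dots> = (\<Sum>j = 0..<n. if j = k then g' $ i / g $ k * g $ j else 0)"
      by (intro sum.cong) auto
    finally show "(mat n n (\<lambda>(i, j). if j = k then g' $ i / g $ k else 0) *\<^sub>v g) $ i = g' $ i"
      using k by simp
  qed (use assms in auto)
  then show ?thesis by (rule that[rotated]) simp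
qed

subsection \<open>Enlarging a full pair by one dimension\<close>

text \<open>The pair (\<sigma>, \<omega>) is a character. The column \<xi> describes an extension in
  which only t is bordered, the row y one in the other direction in which only s is bordered. A
  splitting would be an eigenvector of the form (v, 1), and \<open>nonsplit_\<xi>\<close> and
  \<open>nonsplit_y\<close> forbid it. The last assumption says that in dimension 1 the pair is not
  the character itself.\<close>

locale one_step =
  fixes n :: nat and S T :: "complex mat" and \<sigma> \<omega> :: complex and \<xi> y :: "complex vec"
  assumes n: "n > 0"
    and S: "S \<in> carrier_mat n n" and T: "T \<in> carrier_mat n n"
    and full: "full n S T"
    and \<xi>: "\<xi> \<in> carrier_vec n" and y: "y \<in> carrier_vec n"
    and nonsplit_\<xi>: "\<And>v. v \<in> carrier_vec n \<Longrightarrow> S *\<^sub>v v = \<sigma> \<cdot>\<^sub>v v \<Longrightarrow> T *\<^sub>v v + \<xi> \<noteq> \<omega> \<cdot>\<^sub>v v"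
    and nonsplit_y: "\<And>v. v \<in> carrier_vec n \<Longrightarrow> T\<^sup>T *\<^sub>v v = \<omega> \<cdot>\<^sub>v v \<Longrightarrow> S\<^sup>T *\<^sub>v v + y \<noteq> \<sigma> \<cdot>\<^sub>v v"
    and one_dim: "n = 1 \<Longrightarrow> S $$ (0, 0) \<noteq> \<sigma> \<or> T $$ (0, 0) \<noteq> \<omega>"
begin

abbreviation ev where "ev \<equiv> nev n S T"

primrec chi :: "nc \<Rightarrow> complex" where
  "chi (NConst c) = c"
| "chi NS = \<sigma>"
| "chi NT = \<omega>"
| "chi (NAdd f g) = chi f + chi g"
| "chi (NMul f g) = chi f * chi g"

text \<open>The corner column of the polynomial evaluated at the extension by \<xi>: the derivation
  that is 0 at s and \<xi> at t. Dually, \<open>lower\<close> is the corner row for the extension by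
  y.\<close>

primrec upper :: "nc \<Rightarrow> complex vec" where
  "upper (NConst c) = 0\<^sub>v n"
| "upper NS = 0\<^sub>v n"
| "upper NT = \<xi>"
| "upper (NAdd f g) = upper f + upper g"
| "upper (NMul f g) = ev f *\<^sub>v upper g + chi g \<cdot>\<^sub>v upper f"

primrec lower :: "nc \<Rightarrow> complex vec" where
  "lower (NConst c) = 0\<^sub>v n"
| "lower NS = y"
| "lower NT = 0\<^sub>v n"
| "lower (NAdd f g) = lower f + lower g"
| "lower (NMul f g) = (ev g)\<^sup>T *\<^sub>v lower f + chi f \<cdot>\<^sub>v lower g"

lemma ev_closed [simp]: "ev f \<in> carrier_mat n n"
  by (rule nev_closed[OF S T])

lemma upper_closed [simp]: "upper f \<in> carrier_vec n"
  by (induction f) (auto simp: \<xi> intro!: add_carrier_vec mult_mat_vec_carrier[of _ n n])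

lemma lower_closed [simp]: "lower f \<in> carrier_vec n"
  by (induction f) (auto simp: y intro!: add_carrier_vec mult_mat_vec_carrier[of _ n n])

lemma ev_dim [simp]: "dim_row (ev f) = n" "dim_col (ev f) = n"
  and upper_dim [simp]: "dim_vec (upper f) = n" and lower_dim [simp]: "dim_vec (lower f) = n"
  by (rule carrier_matD[OF ev_closed] carrier_vecD[OF upper_closed] carrier_vecD[OF lower_closed])+

lemma ev_surj: "M \<in> carrier_mat n n \<Longrightarrow> \<exists>f. ev f = M"
  using full by (simp add: full_def)

text \<open>A character of the full matrix algebra vanishes on nilpotents, hence on all matrix units, so
  it exists only in dimension 1.\<close>

lemma separating_element: "\<exists>e. ev e = 0\<^sub>m n n \<and> chi e = 1"
proof (rule ccontr)
  assume none: "\<not> ?thesis"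
  have zero: "chi f = 0" if "ev f = 0\<^sub>m n n" for f
  proof (rule ccontr)
    assume "chi f \<noteq> 0"
    then have "ev (NMul (NConst (1 / chi f)) f) = 0\<^sub>m n n \<and> chi (NMul (NConst (1 / chi f)) f) = 1"
      by (simp add: that)
    with none show False by blast
  qed
  show False
  proof (cases "n = 1")
    case True
    have eq: "S + (- (S $$ (0, 0))) \<cdot>\<^sub>m 1\<^sub>m n = 0\<^sub>m n n" "T + (- (T $$ (0, 0))) \<cdot>\<^sub>m 1\<^sub>m n = 0\<^sub>m n n"
      using S T True by (auto intro!: eq_matI)
    have "chi (NAdd NS (NConst (- (S $$ (0, 0))))) = 0" "chi (NAdd NT (NConst (- (T $$ (0, 0))))) = 0"
      by (rule zero, simp add: eq)+
    then have "S $$ (0, 0) = \<sigma>" "T $$ (0, 0) = \<omega>" unfolding chi.simps by simp_all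
    then show False using one_dim[OF True] by simp
  next
    case False
    \<comment> \<open>By assumption \<open>chi\<close> factors through the matrix algebra, and J is
      the kernel of the induced character.\<close>
    define J where "J = {M. \<exists>f. ev f = M \<and> chi f = 0}"
    have J_I: "M \<in> J" if "ev f = M" "chi f = 0" for f M using that unfolding J_def by blast
    have J: "M * N \<in> J" if "M \<in> J" "N \<in> J" for M N
    proof -
      from that obtain f g where "ev f = M" "chi f = 0" "ev g = N" "chi g = 0" by (auto simp: J_def)
      then have "ev (NMul f g) = M * N \<and> chi (NMul f g) = 0" by simp
      then show ?thesis unfolding J_def by blast
    qed
    have off: "E_mat n i j \<in> J" if "i \<noteq> j" "i < n" "j < n" for i j
    proof -
      obtain f where f: "ev f = E_mat n i j" using ev_surj[of "E_mat n i j"] by auto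
      then have "ev (NMul f f) = 0\<^sub>m n n" using that by (simp add: E_mat_mult)
      from zero[OF this] have "chi f = 0" by simp
      with f show ?thesis by (auto simp: J_def)
    qed
    have diag: "E_mat n i i \<in> J" if "i < n" for i
    proof -
      define j where "j = (if i = 0 then 1 else 0 :: nat)"
      have "j < n" "j \<noteq> i" using False n by (auto simp: j_def)
      then show ?thesis using J[OF off[of i j] off[of j i]] that by (simp add: E_mat_mult)
    qed
    have "k \<le> n \<Longrightarrow> mat n n (\<lambda>(i, j). if i = j \<and> i < k then 1 else 0) \<in> J" for k
    proof (induction k)
      case 0
      have "ev (NConst 0) = mat n n (\<lambda>(i, j). if i = j \<and> i < 0 then 1 else 0)" by auto
      then show ?case by (rule J_I) simp
    next
      case (Suc k)
      then obtain f where f: "ev f = mat n n (\<lambda>(i, j). if i = j \<and> i < k then 1 else 0)" "chi f = 0"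
        by (auto simp: J_def)
      obtain g where g: "ev g = E_mat n k k" "chi g = 0" using diag[of k] Suc.prems by (auto simp: J_def)
      have "ev (NAdd f g) = mat n n (\<lambda>(i, j). if i = j \<and> i < Suc k then 1 else 0)"
        by (auto simp: f g E_mat_def intro!: eq_matI)
      then show ?case by (rule J_I) (simp add: f g)
    qed
    from this[of n] obtain f where f: "ev f = mat n n (\<lambda>(i, j). if i = j \<and> i < n then 1 else 0)" "chi f = 0"
      by (auto simp: J_def)
    \<comment> \<open>f has the value 1 at the pair but 0 under \<open>chi\<close>, so f - 1
      vanishes at the pair and not under \<open>chi\<close>.\<close>
    have "ev (NAdd f (NConst (- 1))) = 0\<^sub>m n n" by (auto simp: f intro!: eq_matI)
    from zero[OF this] show False using f by simp
  qed
qed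

text \<open>A polynomial that vanishes at the pair and under \<open>chi\<close> can still have a
  nonzero corner column, for otherwise the column of a separating element would split the extension
  by \<xi>. Left multiplication then moves this column to any vector.\<close>

lemma upper_surj:
  assumes g: "g \<in> carrier_vec n"
  shows "\<exists>f. ev f = 0\<^sub>m n n \<and> chi f = 0 \<and> upper f = g \<and> lower f = 0\<^sub>v n"
proof -
  obtain e where e: "ev e = 0\<^sub>m n n" "chi e = 1" using separating_element by blast
  \<comment> \<open>This is (f - chi f) e: the factor e kills the value at the pair, and subtracting
    chi f kills the corner and the row.\<close>
  define X where "X f = NAdd (NMul f e) (NMul (NConst (- chi f)) e)" for f
  have X: "ev (X f) = 0\<^sub>m n n" "chi (X f) = 0" "lower (X f) = 0\<^sub>v n"
    "upper (X f) = ev f *\<^sub>v upper e + upper f - chi f \<cdot>\<^sub>v upper e" for f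
  proof -
    show "ev (X f) = 0\<^sub>m n n" "chi (X f) = 0" "lower (X f) = 0\<^sub>v n"
      by (auto simp: X_def e right_mult_zero_mat[of _ n n] intro!: eq_vecI)
    show "upper (X f) = ev f *\<^sub>v upper e + upper f - chi f \<cdot>\<^sub>v upper e"
      by (rule eq_vecI) (auto simp: X_def e)
  qed
  have "\<exists>f. upper (X f) \<noteq> 0\<^sub>v n"
  proof (rule ccontr)
    assume "\<not> ?thesis"
    then have z: "upper (X NS) = 0\<^sub>v n" "upper (X NT) = 0\<^sub>v n" by auto
    have "S *\<^sub>v upper e = \<sigma> \<cdot>\<^sub>v upper e"
    proof (rule eq_vecI)
      fix i assume "i < dim_vec (\<sigma> \<cdot>\<^sub>v upper e)"
      then show "(S *\<^sub>v upper e) $ i = (\<sigma> \<cdot>\<^sub>v upper e) $ i"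
        using arg_cong[OF z(1)[unfolded X(4)], of "\<lambda>v. v $ i"] S by simp
    qed (use S in auto)
    moreover have "T *\<^sub>v upper e + \<xi> = \<omega> \<cdot>\<^sub>v upper e"
    proof (rule eq_vecI)
      fix i assume "i < dim_vec (\<omega> \<cdot>\<^sub>v upper e)"
      then show "(T *\<^sub>v upper e + \<xi>) $ i = (\<omega> \<cdot>\<^sub>v upper e) $ i"
        using arg_cong[OF z(2)[unfolded X(4)], of "\<lambda>v. v $ i"] T \<xi> by simp
    qed (use T \<xi> in auto)
    ultimately show False using nonsplit_\<xi>[of "upper e"] by simp
  qed
  then obtain F where F: "upper (X F) \<noteq> 0\<^sub>v n" by blast
  obtain M where "M \<in> carrier_mat n n" "M *\<^sub>v upper (X F) = g"
    using mat_with_value[OF upper_closed g F] .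
  then obtain f where "ev f *\<^sub>v upper (X F) = g" using ev_surj by metis
  then have "ev (NMul f (X F)) = 0\<^sub>m n n \<and> chi (NMul f (X F)) = 0 \<and> upper (NMul f (X F)) = g \<and>
    lower (NMul f (X F)) = 0\<^sub>v n"
    using g by (auto simp: X(1-3) right_mult_zero_mat[of _ n n] intro!: eq_vecI)
  then show ?thesis by blast
qed

text \<open>The mirror image of \<open>upper_surj\<close>: the separating element now stands on the
  left, the splitting concerns the extension by y, and right multiplication moves the row.\<close>

lemma lower_surj:
  assumes h: "h \<in> carrier_vec n"
  shows "\<exists>f. ev f = 0\<^sub>m n n \<and> chi f = 0 \<and> upper f = 0\<^sub>v n \<and> lower f = h"
proof -
  obtain e where e: "ev e = 0\<^sub>m n n" "chi e = 1" using separating_element by blast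
  define X where "X f = NAdd (NMul e f) (NMul (NConst (- chi f)) e)" for f
  have X: "ev (X f) = 0\<^sub>m n n" "chi (X f) = 0" "upper (X f) = 0\<^sub>v n"
    "lower (X f) = (ev f)\<^sup>T *\<^sub>v lower e + lower f - chi f \<cdot>\<^sub>v lower e" for f
  proof -
    show "ev (X f) = 0\<^sub>m n n" "chi (X f) = 0" "upper (X f) = 0\<^sub>v n"
      by (auto simp: X_def e left_mult_zero_mat[of _ n n] right_mult_zero_mat[of _ n n] intro!: eq_vecI)
    show "lower (X f) = (ev f)\<^sup>T *\<^sub>v lower e + lower f - chi f \<cdot>\<^sub>v lower e"
      by (rule eq_vecI) (auto simp: X_def e)
  qed
  have "\<exists>f. lower (X f) \<noteq> 0\<^sub>v n"
  proof (rule ccontr)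
    assume "\<not> ?thesis"
    then have z: "lower (X NS) = 0\<^sub>v n" "lower (X NT) = 0\<^sub>v n" by auto
    have "S\<^sup>T *\<^sub>v lower e + y = \<sigma> \<cdot>\<^sub>v lower e"
    proof (rule eq_vecI)
      fix i assume "i < dim_vec (\<sigma> \<cdot>\<^sub>v lower e)"
      then show "(S\<^sup>T *\<^sub>v lower e + y) $ i = (\<sigma> \<cdot>\<^sub>v lower e) $ i"
        using arg_cong[OF z(1)[unfolded X(4)], of "\<lambda>v. v $ i"] S y by simp
    qed (use S y in auto)
    moreover have "T\<^sup>T *\<^sub>v lower e = \<omega> \<cdot>\<^sub>v lower e"
    proof (rule eq_vecI)
      fix i assume "i < dim_vec (\<omega> \<cdot>\<^sub>v lower e)"
      then show "(T\<^sup>T *\<^sub>v lower e) $ i = (\<omega> \<cdot>\<^sub>v lower e) $ i"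
        using arg_cong[OF z(2)[unfolded X(4)], of "\<lambda>v. v $ i"] T by simp
    qed (use T in auto)
    ultimately show False using nonsplit_y[of "lower e"] by simp
  qed
  then obtain F where F: "lower (X F) \<noteq> 0\<^sub>v n" by blast
  obtain M where M: "M \<in> carrier_mat n n" "M *\<^sub>v lower (X F) = h"
    using mat_with_value[OF lower_closed h F] .
  then obtain f where "ev f = M\<^sup>T" using ev_surj by (metis transpose_carrier_mat)
  then have "(ev f)\<^sup>T *\<^sub>v lower (X F) = h" using M by simp
  then have "ev (NMul (X F) f) = 0\<^sub>m n n \<and> chi (NMul (X F) f) = 0 \<and> upper (NMul (X F) f) = 0\<^sub>v n \<and>
    lower (NMul (X F) f) = h"
    using h by (auto simp: X(1-3) left_mult_zero_mat[of _ n n] intro!: eq_vecI)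
  then show ?thesis by blast
qed

text \<open>A multiple of the separating element corrects the corner; the two borders are then
  corrected by polynomials that change nothing else.\<close>

lemma limit_surj:
  assumes M: "M \<in> carrier_mat n n" and g: "g \<in> carrier_vec n" and h: "h \<in> carrier_vec n"
  shows "\<exists>f. ev f = M \<and> upper f = g \<and> lower f = h \<and> chi f = c"
proof -
  obtain f0 where f0: "ev f0 = M" using ev_surj[OF M] ..
  obtain e where e: "ev e = 0\<^sub>m n n" "chi e = 1" using separating_element by blast
  define f1 where "f1 = NAdd f0 (NMul (NConst (c - chi f0)) e)"
  have f1: "ev f1 = M" "chi f1 = c" using M by (auto simp: f1_def f0 e right_mult_zero_mat[of _ n n])
  obtain f2 where f2: "ev f2 = 0\<^sub>m n n" "chi f2 = 0" "upper f2 = g - upper f1" "lower f2 = 0\<^sub>v n"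
    using upper_surj[of "g - upper f1"] g by auto
  obtain f3 where f3: "ev f3 = 0\<^sub>m n n" "chi f3 = 0" "upper f3 = 0\<^sub>v n" "lower f3 = h - lower f1"
    using lower_surj[of "h - lower f1"] h by auto
  show ?thesis
    by (rule exI[of _ "NAdd f1 (NAdd f2 f3)"]) (use M g h in \<open>auto simp: f1 f2 f3 intro!: eq_vecI\<close>)
qed

abbreviation limit where "limit f \<equiv> blk n (ev f) (upper f) (lower f) (chi f)"
definition S' where "S' = blk n S (0\<^sub>v n) y \<sigma>"
text \<open>At \<kappa> = 0 the column disappears and the pair is block triangular. The factor
  \<kappa> is placed so that it can be divided out of the corner column of every value.\<close>

definition T' where "T' \<kappa> = blk n T (\<kappa> \<cdot>\<^sub>v \<xi>) (0\<^sub>v n) \<omega>"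

text \<open>Dividing the upper right block of the values at \<open>(S', T' \<kappa>)\<close> by \<open>\<kappa>\<close> and letting \<open>\<kappa>\<close> tend
  to 0 gives the quadruple of \<open>ev\<close>, \<open>upper\<close>, \<open>lower\<close> and \<open>chi\<close>.\<close>

lemma nev_polynomial:
  "\<exists>Q. (\<forall>\<kappa>. nev (Suc n) S' (T' \<kappa>) f =
          mat (Suc n) (Suc n) (\<lambda>(i, j). (if i < n \<and> j = n then \<kappa> else 1) * poly (Q i j) \<kappa>)) \<and>
       mat (Suc n) (Suc n) (\<lambda>(i, j). poly (Q i j) 0) = limit f"
  (is "\<exists>Q. ?P f Q")
proof (induction f)
  case (NConst c)
  show ?case
    by (rule exI[of _ "\<lambda>i j. if i = j then [:c:] else 0"]) (auto simp: blk_def less_Suc_eq intro!: eq_matI)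
next
  case NS
  show ?case
    by (rule exI[of _ "\<lambda>i j. if i < n \<and> j = n then 0 else [:S' $$ (i, j):]"])
      (auto simp: S'_def blk_def less_Suc_eq intro!: eq_matI)
next
  case NT
  show ?case
    by (rule exI[of _ "\<lambda>i j. if i < n \<and> j = n then [:\<xi> $ i:] else [:T' 1 $$ (i, j):]"])
      (use \<xi> in \<open>auto simp: T'_def blk_def less_Suc_eq intro!: eq_matI\<close>)
next
  case (NAdd f g)
  then obtain Q Q' where Q: "?P f Q" "?P g Q'" by blast
  have "poly (Q i j) 0 + poly (Q' i j) 0 = limit f $$ (i, j) + limit g $$ (i, j)" if "i < Suc n" "j < Suc n" for i j
    using that Q by (simp flip: conjunct2[OF Q(1)] conjunct2[OF Q(2)])
  then show ?case using Q
    by (intro exI[of _ "\<lambda>i j. Q i j + Q' i j"])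
      (auto simp: blk_def algebra_simps intro!: eq_matI)
next
  case (NMul f g)
  then obtain Q Q' where Q: "?P f Q" "?P g Q'" by blast
  define w where "w \<kappa> i j = (if i < n \<and> j = n then \<kappa> else (1 :: complex))" for \<kappa> i j
  \<comment> \<open>The weights are multiplicative along i, k, j except when a column entry meets a
    row entry or conversely, where one factor \<kappa> too many appears. It vanishes at 0, which
    removes from the block product exactly the two terms absent from \<open>ev\<close> and
    \<open>chi\<close>.\<close>
  define v where "v i k j = (if (i < n \<and> k = n \<and> j < n) \<or> (i = n \<and> k < n \<and> j = n) then [:0, 1:] else (1 :: complex poly))"
    for i k j
  have wv: "w \<kappa> i k * w \<kappa> k j = w \<kappa> i j * poly (v i k j) \<kappa>" if "i < Suc n" "k < Suc n" "j < Suc n" for \<kappa> i k j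
    using that by (auto simp: w_def v_def)
  define R where "R i j = (\<Sum>k = 0..<Suc n. v i k j * Q i k * Q' k j)" for i j
  have "nev (Suc n) S' (T' \<kappa>) (NMul f g) = mat (Suc n) (Suc n) (\<lambda>(i, j). w \<kappa> i j * poly (R i j) \<kappa>)" for \<kappa>
  proof -
    have f: "nev (Suc n) S' (T' \<kappa>) f = mat (Suc n) (Suc n) (\<lambda>(i, j). w \<kappa> i j * poly (Q i j) \<kappa>)"
      "nev (Suc n) S' (T' \<kappa>) g = mat (Suc n) (Suc n) (\<lambda>(i, j). w \<kappa> i j * poly (Q' i j) \<kappa>)"
      using Q by (auto simp: w_def)
    have "(\<Sum>k = 0..<Suc n. (w \<kappa> i k * poly (Q i k) \<kappa>) * (w \<kappa> k j * poly (Q' k j) \<kappa>)) =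
      w \<kappa> i j * poly (R i j) \<kappa>" if "i < Suc n" "j < Suc n" for i j
    proof -
      have "(w \<kappa> i k * poly (Q i k) \<kappa>) * (w \<kappa> k j * poly (Q' k j) \<kappa>) =
        w \<kappa> i j * (poly (v i k j) \<kappa> * poly (Q i k) \<kappa> * poly (Q' k j) \<kappa>)" if "k < Suc n" for k
        using wv[OF \<open>i < Suc n\<close> that \<open>j < Suc n\<close>, of \<kappa>] by (metis (no_types, lifting) mult.assoc mult.left_commute)
      then show ?thesis unfolding R_def poly_sum poly_mult sum_distrib_left
        by (intro sum.cong) auto
    qed
    then show ?thesis by (auto simp: f scalar_prod_def simp del: sum.op_ivl_Suc intro!: eq_matI)
  qed
  moreover have "mat (Suc n) (Suc n) (\<lambda>(i, j). poly (R i j) 0) = limit (NMul f g)"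
  proof (rule eq_matI)
    fix i j
    assume "i < dim_row (limit (NMul f g))" "j < dim_col (limit (NMul f g))"
    then have ij: "i < Suc n" "j < Suc n" by (auto simp: blk_def)
    define F G where "F = limit f"
      and "G = limit g"
    have Q0: "poly (Q i j) 0 = F $$ (i, j)" "poly (Q' i j) 0 = G $$ (i, j)" if "i < Suc n" "j < Suc n" for i j
      using that by (simp_all add: F_def G_def flip: conjunct2[OF Q(1)] conjunct2[OF Q(2)])
    have "poly (R i j) 0 = (\<Sum>k = 0..<Suc n. poly (v i k j) 0 * F $$ (i, k) * G $$ (k, j))"
      unfolding R_def poly_sum poly_mult by (intro sum.cong) (use ij in \<open>auto simp: Q0\<close>)
    also have "\<dots> = (\<Sum>k = 0..<n. poly (v i k j) 0 * F $$ (i, k) * G $$ (k, j)) +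
      poly (v i n j) 0 * F $$ (i, n) * G $$ (n, j)" by simp
    also have "\<dots> = limit (NMul f g) $$ (i, j)"
      using ij by (auto simp: F_def G_def v_def blk_def scalar_prod_def less_Suc_eq mult.commute
          intro!: sum.cong sum.neutral)
    finally show "mat (Suc n) (Suc n) (\<lambda>(i, j). poly (R i j) 0) $$ (i, j) =
      limit (NMul f g) $$ (i, j)"
      using ij by simp
  qed (auto simp: blk_def)
  ultimately show ?case unfolding w_def by blast
qed

text \<open>Choose m * m polynomials whose limits are the matrix units. The coordinate matrix of
  their rescaled values is polynomial in \<kappa> and is the identity at \<kappa> = 0, so its
  determinant is a nonzero polynomial. Where it does not vanish and \<kappa> is nonzero, the values
  themselves span all matrices.\<close>

lemma full_deformation: "\<exists>\<kappa>. full (Suc n) S' (T' \<kappa>)"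
proof -
  define m where "m = Suc n"
  have m: "m > 0" by (simp add: m_def)
  define d where "d = m * m"
  have "\<exists>f. limit f = E_mat m (r div m) (r mod m)" for r
  proof -
    let ?E = "E_mat m (r div m) (r mod m)"
    obtain f where "ev f = mat n n (\<lambda>(i, j). ?E $$ (i, j))" "upper f = vec n (\<lambda>i. ?E $$ (i, n))"
      "lower f = vec n (\<lambda>j. ?E $$ (n, j))" "chi f = ?E $$ (n, n)"
      using limit_surj[of "mat n n (\<lambda>(i, j). ?E $$ (i, j))" "vec n (\<lambda>i. ?E $$ (i, n))"
          "vec n (\<lambda>j. ?E $$ (n, j))" "?E $$ (n, n)"] by auto
    then have "limit f = ?E"
      by (intro eq_matI) (auto simp: blk_def E_mat_def m_def less_Suc_eq)
    then show ?thesis by blast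
  qed
  then obtain F where F: "\<And>r. limit (F r) = E_mat m (r div m) (r mod m)"
    by metis
  have "\<forall>r. \<exists>Q. (\<forall>\<kappa>. nev m S' (T' \<kappa>) (F r) =
          mat m m (\<lambda>(i, j). (if i < n \<and> j = n then \<kappa> else 1) * poly (Q i j) \<kappa>)) \<and>
       mat m m (\<lambda>(i, j). poly (Q i j) 0) = E_mat m (r div m) (r mod m)"
    using nev_polynomial unfolding m_def[symmetric] F[symmetric] by blast
  from choice[OF this] obtain Q where "\<forall>r. (\<forall>\<kappa>. nev m S' (T' \<kappa>) (F r) =
          mat m m (\<lambda>(i, j). (if i < n \<and> j = n then \<kappa> else 1) * poly (Q r i j) \<kappa>)) \<and>
       mat m m (\<lambda>(i, j). poly (Q r i j) 0) = E_mat m (r div m) (r mod m)" ..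
  then have Q: "nev m S' (T' \<kappa>) (F r) =
          mat m m (\<lambda>(i, j). (if i < n \<and> j = n then \<kappa> else 1) * poly (Q r i j) \<kappa>)"
       "mat m m (\<lambda>(i, j). poly (Q r i j) 0) = E_mat m (r div m) (r mod m)" for r \<kappa>
    by blast+
  define B where "B = mat d d (\<lambda>(r, s). Q r (s div m) (s mod m))"
  define Bv where "Bv \<kappa> = mat d d (\<lambda>(r, s). poly (Q r (s div m) (s mod m)) \<kappa>)" for \<kappa>
  have ring_hom: "comm_ring_hom (\<lambda>p. poly p \<kappa>)" for \<kappa> :: complex
    by unfold_locales auto
  have detB: "poly (det B) \<kappa> = det (Bv \<kappa>)" for \<kappa>
  proof -
    have "map_mat (\<lambda>p. poly p \<kappa>) B = Bv \<kappa>" by (auto simp: B_def Bv_def)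
    then show ?thesis using comm_ring_hom.hom_det[OF ring_hom, of \<kappa> B] by simp
  qed
  have lt: "s div m < m" "s mod m < m" if "s < d" for s
    using that m by (auto simp: d_def less_mult_imp_div_less)
  have "Bv 0 = 1\<^sub>m d"
  proof (rule eq_matI)
    fix r s assume rs: "r < dim_row (1\<^sub>m d)" "s < dim_col (1\<^sub>m d)"
    then have "Bv 0 $$ (r, s) = E_mat m (r div m) (r mod m) $$ (s div m, s mod m)"
      using lt by (simp add: Bv_def flip: Q(2))
    also have "\<dots> = 1\<^sub>m d $$ (r, s)" using rs lt by (auto simp: E_mat_def) (metis div_mult_mod_eq)
    finally show "Bv 0 $$ (r, s) = 1\<^sub>m d $$ (r, s)" .
  qed (auto simp: Bv_def)
  then have "det B \<noteq> 0" using detB[of 0] by auto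
  \<comment> \<open>The factor \<open>[:0, 1:]\<close> excludes \<kappa> = 0, where the rescaling of
    the corner column cannot be undone.\<close>
  then have "[:0, 1:] * det B \<noteq> 0" by (simp del: mult_pCons_left)
  then obtain \<kappa> where "poly ([:0, 1:] * det B) \<kappa> \<noteq> 0" using poly_all_0_iff_0 by blast
  then have \<kappa>: "\<kappa> \<noteq> 0" "det (Bv \<kappa>) \<noteq> 0" using detB by auto
  have Bv: "Bv \<kappa> \<in> carrier_mat d d" by (simp add: Bv_def)
  obtain C where C: "C \<in> carrier_mat d d" "C * Bv \<kappa> = 1\<^sub>m d"
  proof
    show "(1 / det (Bv \<kappa>)) \<cdot>\<^sub>m adj_mat (Bv \<kappa>) \<in> carrier_mat d d" using adj_mat[OF Bv] by simp
    show "(1 / det (Bv \<kappa>)) \<cdot>\<^sub>m adj_mat (Bv \<kappa>) * Bv \<kappa> = 1\<^sub>m d"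
      using adj_mat[OF Bv] \<kappa> Bv by (auto simp: mult_smult_assoc_mat[of _ d d _ d] intro!: eq_matI)
  qed
  have ST: "S' \<in> carrier_mat m m" "T' \<kappa> \<in> carrier_mat m m" by (simp_all add: S'_def T'_def m_def)
  have "\<exists>f. nev m S' (T' \<kappa>) f = N" if N: "N \<in> carrier_mat m m" for N
  proof -
    define w where "w i j = (if i < n \<and> j = n then \<kappa> else 1)" for i j
    have w: "w i j \<noteq> 0" for i j using \<kappa> by (simp add: w_def)
    \<comment> \<open>Dividing by the weights turns the target matrix into coordinates for the
      rescaled values.\<close>
    define N' where "N' s = N $$ (s div m, s mod m) / w (s div m) (s mod m)" for s
    define x where "x r = (\<Sum>s<d. N' s * C $$ (s, r))" for r
    have x: "(\<Sum>r<d. x r * Bv \<kappa> $$ (r, s)) = N' s" if s: "s < d" for s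
    proof -
      have "(\<Sum>r<d. x r * Bv \<kappa> $$ (r, s)) = (\<Sum>t<d. N' t * (\<Sum>r<d. C $$ (t, r) * Bv \<kappa> $$ (r, s)))"
        unfolding x_def sum_distrib_left sum_distrib_right
        by (subst sum.swap) (simp add: mult.assoc)
      also have "\<dots> = (\<Sum>t<d. N' t * (C * Bv \<kappa>) $$ (t, s))"
        using C(1) Bv s by (intro sum.cong) (auto simp: scalar_prod_def atLeast0LessThan)
      also have "\<dots> = (\<Sum>t<d. if t = s then N' t else 0)"
        unfolding C(2) using s by (intro sum.cong) auto
      also have "\<dots> = N' s" using s by simp
      finally show ?thesis .
    qed
    obtain f where f: "nev m S' (T' \<kappa>) f = mat m m (\<lambda>(i, j). \<Sum>r<d. x r * nev m S' (T' \<kappa>) (F r) $$ (i, j))"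
      using nev_sum[OF ST] by blast
    have "(\<Sum>r<d. x r * nev m S' (T' \<kappa>) (F r) $$ (i, j)) = N $$ (i, j)" if ij: "i < m" "j < m" for i j
    proof -
      define s where "s = i * m + j"
      have s: "s < d" "s div m = i" "s mod m = j"
        using ij pair_index_less[OF ij] by (simp_all add: s_def d_def)
      have "(\<Sum>r<d. x r * nev m S' (T' \<kappa>) (F r) $$ (i, j)) = w i j * (\<Sum>r<d. x r * Bv \<kappa> $$ (r, s))"
        unfolding sum_distrib_left Q(1) using ij s
        by (intro sum.cong) (auto simp: Bv_def w_def)
      then show ?thesis using x[OF s(1)] w by (simp add: N'_def s)
    qed
    then have "nev m S' (T' \<kappa>) f = N" unfolding f using N by (intro eq_matI) auto
    then show ?thesis ..
  qed
  then show ?thesis by (auto simp: full_def m_def)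
qed

end


subsection \<open>Eigenvectors of matrices of finite order\<close>

lemma mat_diag_mult_vec: "v \<in> carrier_vec n \<Longrightarrow> mat_diag n D *\<^sub>v v = vec n (\<lambda>i. D i * v $ i)"
  by (rule eq_vecI) (auto simp: mat_diag_def scalar_prod_def if_distrib[of "\<lambda>x. x * _"] cong: if_cong)

text \<open>Describes an eigenspace by linear equations, one for each diagonal entry different from
  a, so that they can be counted.\<close>

lemma diagonalized_eigenvector:
  fixes A :: "complex mat"
  assumes A: "A \<in> carrier_mat n n" and P: "P \<in> carrier (GL n)" "A * P = P * mat_diag n D"
    and u: "u \<in> carrier_vec n"
  shows "A *\<^sub>v u = a \<cdot>\<^sub>v u \<longleftrightarrow> (\<forall>i<n. D i \<noteq> a \<longrightarrow> (inv\<^bsub>GL n\<^esub> P *\<^sub>v u) $ i = 0)"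
proof -
  define Q where "Q = inv\<^bsub>GL n\<^esub> P"
  have [simp]: "P \<in> carrier_mat n n" "Q \<in> carrier_mat n n" using P by (simp_all add: GL_mat Q_def)
  define w where "w = Q *\<^sub>v u"
  have w: "w \<in> carrier_vec n" unfolding w_def using u by (intro mult_mat_vec_carrier[of _ n n]) auto
  have uw: "u = P *\<^sub>v w"
    unfolding w_def using u P by (simp add: Q_def flip: assoc_mult_mat_vec[of _ n n _ n])
  have "A *\<^sub>v u = (A * P) *\<^sub>v w"
    unfolding uw using A w by (intro assoc_mult_mat_vec[symmetric, of _ n n _ n]) auto
  also have "\<dots> = P *\<^sub>v (mat_diag n D *\<^sub>v w)"
    unfolding P(2) using w by (intro assoc_mult_mat_vec[of _ n n _ n]) auto
  finally have Au: "A *\<^sub>v u = P *\<^sub>v vec n (\<lambda>i. D i * w $ i)" using w by (simp add: mat_diag_mult_vec)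
  have au: "a \<cdot>\<^sub>v u = P *\<^sub>v (a \<cdot>\<^sub>v w)" unfolding uw using w by (simp add: mult_mat_vec[of _ n n])
  have inj: "x = y" if "P *\<^sub>v x = P *\<^sub>v y" "x \<in> carrier_vec n" "y \<in> carrier_vec n" for x y
  proof -
    have "(Q * P) *\<^sub>v x = (Q * P) *\<^sub>v y" using that by (simp add: assoc_mult_mat_vec[of _ n n _ n])
    then show ?thesis using that P by (simp add: Q_def)
  qed
  have "A *\<^sub>v u = a \<cdot>\<^sub>v u \<longleftrightarrow> vec n (\<lambda>i. D i * w $ i) = a \<cdot>\<^sub>v w"
    unfolding Au au using inj[of "vec n (\<lambda>i. D i * w $ i)" "a \<cdot>\<^sub>v w"] w by auto
  also have "\<dots> \<longleftrightarrow> (\<forall>i<n. D i * w $ i = a * w $ i)" using w by (auto simp: vec_eq_iff)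
  finally show ?thesis by (auto simp: w_def Q_def)
qed

lemma sum_vec_nonzero:
  assumes "\<exists>j<n. x j \<noteq> (0 :: complex)"
  shows "vec n x \<noteq> 0\<^sub>v n"
  using assms by (auto simp: vec_eq_iff)

text \<open>Each eigenspace is cut out by n minus its multiplicity equations. Together these are
  fewer than n, so a nonzero common solution exists. The sum type only keeps the two families of
  equations apart.\<close>

lemma common_eigenvector:
  fixes A B :: "complex mat"
  assumes A: "A \<in> carrier_mat n n" "A ^\<^sub>m k = 1\<^sub>m n" "k > 0"
    and B: "B \<in> carrier_mat n n" "B ^\<^sub>m l = 1\<^sub>m n" "l > 0"
    and less: "n < eigmult a A + eigmult b B"
  obtains u where "u \<in> carrier_vec n" "u \<noteq> 0\<^sub>v n" "A *\<^sub>v u = a \<cdot>\<^sub>v u" "B *\<^sub>v u = b \<cdot>\<^sub>v u"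
proof -
  obtain P D where P: "P \<in> carrier (GL n)" "A * P = P * mat_diag n D"
    and D: "eigmult a A = card {i. i < n \<and> D i = a}"
    using finite_order_diagonal[OF A] by metis
  obtain Q E where Q: "Q \<in> carrier (GL n)" "B * Q = Q * mat_diag n E"
    and E: "eigmult b B = card {i. i < n \<and> E i = b}"
    using finite_order_diagonal[OF B] by metis
  define I where "I = Inl ` {i. i < n \<and> D i \<noteq> a} \<union> Inr ` {i. i < n \<and> E i \<noteq> b}"
  have split: "card {i. i < n \<and> D i = a} + card {i. i < n \<and> D i \<noteq> a} = n" for D :: "nat \<Rightarrow> complex" and a
  proof -
    have "{..<n} = {i. i < n \<and> D i = a} \<union> {i. i < n \<and> D i \<noteq> a}" by auto
    then have "n = card ({i. i < n \<and> D i = a} \<union> {i. i < n \<and> D i \<noteq> a})" by (metis card_lessThan)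
    then show ?thesis by (subst (asm) card_Un_disjoint) auto
  qed
  have "card I = card {i. i < n \<and> D i \<noteq> a} + card {i. i < n \<and> E i \<noteq> b}"
    unfolding I_def by (subst card_Un_disjoint) (auto simp: card_image)
  then have "card I < n" using less D E split[of D a] split[of E b] by linarith
  have "finite I" by (auto simp: I_def)
  define rw where "rw i = (case i of Inl i \<Rightarrow> \<lambda>j. (inv\<^bsub>GL n\<^esub> P) $$ (i, j) | Inr i \<Rightarrow> \<lambda>j. (inv\<^bsub>GL n\<^esub> Q) $$ (i, j))" for i
  obtain x where x: "\<exists>j<n. x j \<noteq> 0" "\<And>i. i \<in> I \<Longrightarrow> (\<Sum>j<n. rw i j * x j) = 0"
    using few_equations[OF \<open>finite I\<close> \<open>card I < n\<close>, of rw] by blast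
  define u where "u = vec n x"
  have u: "u \<in> carrier_vec n" by (simp add: u_def)
  have eval: "(M *\<^sub>v u) $ i = (\<Sum>j<n. M $$ (i, j) * x j)" if "M \<in> carrier_mat n n" "i < n" for M i
    using that by (simp add: u_def scalar_prod_def atLeast0LessThan)
  have "\<forall>i<n. D i \<noteq> a \<longrightarrow> (inv\<^bsub>GL n\<^esub> P *\<^sub>v u) $ i = 0"
    using x(2)[of "Inl _"] P by (auto simp: I_def rw_def eval)
  moreover have "\<forall>i<n. E i \<noteq> b \<longrightarrow> (inv\<^bsub>GL n\<^esub> Q *\<^sub>v u) $ i = 0"
    using x(2)[of "Inr _"] Q by (auto simp: I_def rw_def eval)
  ultimately have "A *\<^sub>v u = a \<cdot>\<^sub>v u" "B *\<^sub>v u = b \<cdot>\<^sub>v u"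
    using diagonalized_eigenvector[OF A(1) P u, of a] diagonalized_eigenvector[OF B(1) Q u, of b] by auto
  moreover have "u \<noteq> 0\<^sub>v n" unfolding u_def using x(1) by (rule sum_vec_nonzero)
  ultimately show ?thesis using that u by blast
qed

text \<open>The two eigenspaces are spanned by fewer than n vectors in all, so some nonzero linear
  form r kills both. A unit vector on which r is nonzero lies outside their sum.\<close>

lemma vector_outside_eigenspaces:
  fixes A B :: "complex mat"
  assumes A: "A \<in> carrier_mat n n" "A ^\<^sub>m k = 1\<^sub>m n" "k > 0"
    and B: "B \<in> carrier_mat n n" "B ^\<^sub>m l = 1\<^sub>m n" "l > 0"
    and less: "eigmult a A + eigmult b B < n"
  obtains v where "v \<in> carrier_vec n"
    "\<And>u u'. u \<in> carrier_vec n \<Longrightarrow> u' \<in> carrier_vec n \<Longrightarrow> A *\<^sub>v u = a \<cdot>\<^sub>v u \<Longrightarrow> B *\<^sub>v u' = b \<cdot>\<^sub>v u' \<Longrightarrow> v \<noteq> u + u'"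
proof -
  obtain P D where P: "P \<in> carrier (GL n)" "A * P = P * mat_diag n D"
    and D: "eigmult a A = card {i. i < n \<and> D i = a}"
    using finite_order_diagonal[OF A] by metis
  obtain Q E where Q: "Q \<in> carrier (GL n)" "B * Q = Q * mat_diag n E"
    and E: "eigmult b B = card {i. i < n \<and> E i = b}"
    using finite_order_diagonal[OF B] by metis
  define I where "I = Inl ` {i. i < n \<and> D i = a} \<union> Inr ` {i. i < n \<and> E i = b}"
  have "card I = card {i. i < n \<and> D i = a} + card {i. i < n \<and> E i = b}"
    unfolding I_def by (subst card_Un_disjoint) (auto simp: card_image)
  then have "card I < n" using less D E by linarith
  have "finite I" by (auto simp: I_def)
  define rw where "rw i = (case i of Inl i \<Rightarrow> \<lambda>j. P $$ (j, i) | Inr i \<Rightarrow> \<lambda>j. Q $$ (j, i))" for i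
  obtain x where x: "\<exists>j<n. x j \<noteq> 0" "\<And>i. i \<in> I \<Longrightarrow> (\<Sum>j<n. rw i j * x j) = 0"
    using few_equations[OF \<open>finite I\<close> \<open>card I < n\<close>, of rw] by blast
  define r where "r = vec n x"
  have r: "r \<in> carrier_vec n" by (simp add: r_def)
  have kills: "r \<bullet> u = 0"
    if u: "u \<in> carrier_vec n" "C *\<^sub>v u = c \<cdot>\<^sub>v u" and C: "C \<in> carrier_mat n n"
      and R: "R \<in> carrier (GL n)" "C * R = R * mat_diag n F"
      and z: "\<And>i. i < n \<Longrightarrow> F i = c \<Longrightarrow> (\<Sum>j<n. R $$ (j, i) * x j) = 0" for C R F c u
  proof -
    define w where "w = inv\<^bsub>GL n\<^esub> R *\<^sub>v u"
    have w: "w \<in> carrier_vec n" unfolding w_def using u R by (intro mult_mat_vec_carrier[of _ n n]) auto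
    have Rm: "R \<in> carrier_mat n n" using R by (simp add: GL_mat)
    have "u = R *\<^sub>v w"
      unfolding w_def using u R Rm by (simp flip: assoc_mult_mat_vec[of _ n n _ n])
    have w0: "w $ i = 0" if "i < n" "F i \<noteq> c" for i
      using diagonalized_eigenvector[OF C R u(1), of c] u that by (auto simp: w_def)
    have "r \<bullet> u = (\<Sum>j<n. x j * (\<Sum>i<n. R $$ (j, i) * w $ i))"
      unfolding \<open>u = R *\<^sub>v w\<close> using Rm w by (simp add: r_def scalar_prod_def atLeast0LessThan)
    also have "\<dots> = (\<Sum>i<n. w $ i * (\<Sum>j<n. R $$ (j, i) * x j))"
      unfolding sum_distrib_left by (subst sum.swap) (simp add: mult.commute mult.left_commute)
    also have "\<dots> = 0" using w0 z by (intro sum.neutral) (metis lessThan_iff mult_eq_0_iff)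
    finally show ?thesis .
  qed
  obtain k where k: "k < n" "x k \<noteq> 0" using x(1) by blast
  show ?thesis
  proof (rule that[of "unit_vec n k"])
    fix u u' assume u: "u \<in> carrier_vec n" "u' \<in> carrier_vec n" "A *\<^sub>v u = a \<cdot>\<^sub>v u" "B *\<^sub>v u' = b \<cdot>\<^sub>v u'"
    have "r \<bullet> u = 0"
      using x(2)[of "Inl _"] by (intro kills[OF u(1,3) A(1) P]) (auto simp: I_def rw_def)
    moreover have "r \<bullet> u' = 0"
      using x(2)[of "Inr _"] by (intro kills[OF u(2,4) B(1) Q]) (auto simp: I_def rw_def)
    ultimately have "r \<bullet> (u + u') = 0" using u r by (simp add: scalar_prod_add_distrib[of _ n])
    moreover have "r \<bullet> unit_vec n k \<noteq> 0" using k r by (simp add: r_def)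
    ultimately show "unit_vec n k \<noteq> u + u'" by auto
  qed simp
qed

lemma char_poly_transpose: "A \<in> carrier_mat n n \<Longrightarrow> char_poly A\<^sup>T = char_poly (A :: complex mat)"
proof -
  assume A: "A \<in> carrier_mat n n"
  have "char_poly_matrix A\<^sup>T = (char_poly_matrix A)\<^sup>T"
    by (rule eq_matI) (use A in \<open>auto simp: char_poly_matrix_def\<close>)
  then show ?thesis unfolding char_poly_def using A by (simp add: det_transpose[of _ n])
qed

lemma order_linear: "Polynomial.order a [:- c, 1:] = (if a = c then 1 else (0 :: nat))" for a c :: complex
  using order_power_n_n[of a 1] by (auto intro!: order_0I)

subsection \<open>Existence of full pairs\<close>

text \<open>After diagonalising s, an extension by the character is given by a column (T - \<omega>)
  v, and it splits exactly when v lies in the sum of the \<sigma>-eigenspace of S and the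
  \<omega>-eigenspace of T. The inequality on multiplicities makes room for another v. Transposition
  preserves multiplicities and gives the opposite direction.\<close>

lemma full_pair_step:
  fixes S T :: "complex mat"
  assumes S: "S \<in> carrier_mat n n" "S * S = 1\<^sub>m n" and T: "T \<in> carrier_mat n n" "T * (T * T) = 1\<^sub>m n"
    and n: "n > 0" and full: "full n S T" and \<sigma>: "\<sigma> * \<sigma> = 1" and \<omega>: "\<omega> * (\<omega> * \<omega>) = 1"
    and less: "eigmult \<sigma> S + eigmult \<omega> T < n"
  obtains S' T' where "S' \<in> carrier_mat (Suc n) (Suc n)" "S' * S' = 1\<^sub>m (Suc n)"
    "T' \<in> carrier_mat (Suc n) (Suc n)" "T' * (T' * T') = 1\<^sub>m (Suc n)" "full (Suc n) S' T'"
    "char_poly S' = char_poly S * [:- \<sigma>, 1:]" "char_poly T' = char_poly T * [:- \<omega>, 1:]"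
proof -
  note car = S(1) T(1) and order_S = S(2) and order_T = T(2)
  have pow: "S ^\<^sub>m 2 = 1\<^sub>m n" "T ^\<^sub>m 3 = 1\<^sub>m n" using S T by (simp_all add: pow_2_3)
  have trans: "S\<^sup>T * S\<^sup>T = 1\<^sub>m n" "T\<^sup>T * (T\<^sup>T * T\<^sup>T) = 1\<^sub>m n"
  proof -
    show "S\<^sup>T * S\<^sup>T = 1\<^sub>m n" using S transpose_mult[of S n n S n] by simp
    have "(T * (T * T))\<^sup>T = T\<^sup>T * T\<^sup>T * T\<^sup>T"
      using car by (simp add: transpose_mult[of T n n _ n] mult_carrier_mat[of T n n T n])
    then show "T\<^sup>T * (T\<^sup>T * T\<^sup>T) = 1\<^sub>m n" using T by (simp add: assoc_mult_mat[of _ n n _ n _ n])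
  qed
  then have pow_t: "S\<^sup>T ^\<^sub>m 2 = 1\<^sub>m n" "T\<^sup>T ^\<^sub>m 3 = 1\<^sub>m n" using S T by (simp_all add: pow_2_3)
  obtain v where v: "v \<in> carrier_vec n" "\<And>u u'. u \<in> carrier_vec n \<Longrightarrow> u' \<in> carrier_vec n \<Longrightarrow>
      S *\<^sub>v u = \<sigma> \<cdot>\<^sub>v u \<Longrightarrow> T *\<^sub>v u' = \<omega> \<cdot>\<^sub>v u' \<Longrightarrow> v \<noteq> u + u'"
    using vector_outside_eigenspaces[OF S(1) pow(1) _ T(1) pow(2) _ less] by auto
  obtain v' where v': "v' \<in> carrier_vec n" "\<And>u u'. u \<in> carrier_vec n \<Longrightarrow> u' \<in> carrier_vec n \<Longrightarrow>
      S\<^sup>T *\<^sub>v u = \<sigma> \<cdot>\<^sub>v u \<Longrightarrow> T\<^sup>T *\<^sub>v u' = \<omega> \<cdot>\<^sub>v u' \<Longrightarrow> v' \<noteq> u + u'"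
    using vector_outside_eigenspaces[of "S\<^sup>T" n 2 "T\<^sup>T" 3 \<sigma> \<omega>] pow_t less car
    by (auto simp: char_poly_transpose)
  \<comment> \<open>Columns in the image of T - \<omega> are those that keep the bordered matrix of
    order 3; rows in the image of the transpose of S minus \<sigma> keep the other one an
    involution.\<close>
  define \<xi> where "\<xi> = T *\<^sub>v v - \<omega> \<cdot>\<^sub>v v"
  define y where "y = S\<^sup>T *\<^sub>v v' - \<sigma> \<cdot>\<^sub>v v'"
  have Tv: "T *\<^sub>v x \<in> carrier_vec n" "S *\<^sub>v x \<in> carrier_vec n" "S\<^sup>T *\<^sub>v x \<in> carrier_vec n" "T\<^sup>T *\<^sub>v x \<in> carrier_vec n"
    if "x \<in> carrier_vec n" for x using car that by (auto intro: mult_mat_vec_carrier[of _ n n])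
  have \<xi>: "\<xi> \<in> carrier_vec n" and y: "y \<in> carrier_vec n" using Tv v v' by (auto simp: \<xi>_def y_def)
  have lin: "(C *\<^sub>v (p - q)) = C *\<^sub>v p - C *\<^sub>v q" "C *\<^sub>v (c \<cdot>\<^sub>v p) = c \<cdot>\<^sub>v (C *\<^sub>v p)" "C *\<^sub>v (p + q) = C *\<^sub>v p + C *\<^sub>v q"
    if "C \<in> carrier_mat n n" "p \<in> carrier_vec n" "q \<in> carrier_vec n" for C :: "complex mat" and p q c
    using that by (auto simp: mult_minus_distrib_mat_vec[of _ n n] mult_mat_vec[of _ n n] mult_add_distrib_mat_vec[of _ n n])
  \<comment> \<open>A splitting vector u would write p as the sum of -u and the eigenvector p +
    u.\<close>
  have split: "\<exists>u'\<in>carrier_vec n. C *\<^sub>v u' = c \<cdot>\<^sub>v u' \<and> p = (- 1) \<cdot>\<^sub>v u + u'"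
    if *: "C \<in> carrier_mat n n" "p \<in> carrier_vec n" "u \<in> carrier_vec n"
      "C *\<^sub>v u + (C *\<^sub>v p - c \<cdot>\<^sub>v p) = c \<cdot>\<^sub>v u" for C :: "complex mat" and c p u
  proof (rule bexI[of _ "p + u"], intro conjI)
    show "C *\<^sub>v (p + u) = c \<cdot>\<^sub>v (p + u)"
    proof (rule eq_vecI)
      fix i assume "i < dim_vec (c \<cdot>\<^sub>v (p + u))"
      then have i: "i < n" using * by simp
      have "(C *\<^sub>v u) $ i + ((C *\<^sub>v p) $ i - c * p $ i) = c * u $ i"
        using arg_cong[OF *(4), of "\<lambda>v. v $ i"] *(1-3) i by simp
      moreover have "(C *\<^sub>v (p + u)) $ i = (C *\<^sub>v p) $ i + (C *\<^sub>v u) $ i"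
        unfolding lin(3)[OF *(1-3)] using *(1-3) i by simp
      ultimately have "(C *\<^sub>v (p + u)) $ i = c * p $ i + c * u $ i"
        by (metis add.assoc add.commute diff_add_cancel)
      then show "(C *\<^sub>v (p + u)) $ i = (c \<cdot>\<^sub>v (p + u)) $ i"
        using * i by (simp add: distrib_left)
    qed (use * in auto)
    show "p = (- 1) \<cdot>\<^sub>v u + (p + u)" using * by (auto intro!: eq_vecI)
    show "p + u \<in> carrier_vec n" using * by simp
  qed
  interpret one_step n S T \<sigma> \<omega> \<xi> y
  proof
    fix u assume u: "u \<in> carrier_vec n" "S *\<^sub>v u = \<sigma> \<cdot>\<^sub>v u"
    show "T *\<^sub>v u + \<xi> \<noteq> \<omega> \<cdot>\<^sub>v u"
    proof
      assume "T *\<^sub>v u + \<xi> = \<omega> \<cdot>\<^sub>v u"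
      then obtain u' where "u' \<in> carrier_vec n" "T *\<^sub>v u' = \<omega> \<cdot>\<^sub>v u'" "v = (- 1) \<cdot>\<^sub>v u + u'"
        using split[OF car(2) v(1) u(1), of \<omega>] unfolding \<xi>_def by blast
      then show False using v(2)[of "(- 1) \<cdot>\<^sub>v u" u'] u car by (auto simp: lin smult_smult_assoc mult.commute)
    qed
  next
    fix u assume u: "u \<in> carrier_vec n" "T\<^sup>T *\<^sub>v u = \<omega> \<cdot>\<^sub>v u"
    show "S\<^sup>T *\<^sub>v u + y \<noteq> \<sigma> \<cdot>\<^sub>v u"
    proof
      assume "S\<^sup>T *\<^sub>v u + y = \<sigma> \<cdot>\<^sub>v u"
      then obtain u' where u': "u' \<in> carrier_vec n" "S\<^sup>T *\<^sub>v u' = \<sigma> \<cdot>\<^sub>v u'" "v' = (- 1) \<cdot>\<^sub>v u + u'"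
        using split[of "S\<^sup>T", OF _ v'(1) u(1), of \<sigma>] car unfolding y_def by auto
      then have "v' = u' + (- 1) \<cdot>\<^sub>v u" using u by (simp add: comm_add_vec[of _ n])
      then show False using v'(2)[of u' "(- 1) \<cdot>\<^sub>v u"] u u' car by (auto simp: lin smult_smult_assoc mult.commute)
    qed
  next
    assume "n = 1"
    show "S $$ (0, 0) \<noteq> \<sigma> \<or> T $$ (0, 0) \<noteq> \<omega>"
    proof (rule ccontr)
      assume "\<not> ?thesis"
      then have "S *\<^sub>v v = \<sigma> \<cdot>\<^sub>v v" "T *\<^sub>v 0\<^sub>v n = \<omega> \<cdot>\<^sub>v 0\<^sub>v n"
        using \<open>n = 1\<close> car v(1) by (auto simp: vec_eq_iff scalar_prod_def)
      then show False using v(2)[of v "0\<^sub>v n"] v(1) by simp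
    qed
  qed (use n car full \<xi> y in auto)
  obtain \<kappa> where \<kappa>: "full (Suc n) S' (T' \<kappa>)" using full_deformation by blast
  \<comment> \<open>The corner row of the square: (S + \<sigma>)(S - \<sigma>) = 0,
    transposed.\<close>
  have Sy: "S\<^sup>T *\<^sub>v y + \<sigma> \<cdot>\<^sub>v y = 0\<^sub>v n"
  proof -
    have "S\<^sup>T *\<^sub>v (S\<^sup>T *\<^sub>v v') = v'"
      using car v' trans by (simp flip: assoc_mult_mat_vec[of _ n n _ n])
    then have "S\<^sup>T *\<^sub>v y = v' - \<sigma> \<cdot>\<^sub>v (S\<^sup>T *\<^sub>v v')" unfolding y_def using car v' Tv by (simp add: lin)
    then show ?thesis using car v' Tv[OF v'(1)] \<sigma>
      by (auto simp: y_def vec_eq_iff right_diff_distrib simp flip: mult.assoc)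
  qed
  \<comment> \<open>The corner column of the cube: T^2 + \<omega> T + \<omega>^2 applied to (T -
    \<omega>) v gives (T^3 - \<omega>^3) v = 0.\<close>
  have T\<xi>: "T *\<^sub>v (T *\<^sub>v \<xi> + \<omega> \<cdot>\<^sub>v \<xi>) + (\<omega> * \<omega>) \<cdot>\<^sub>v \<xi> = 0\<^sub>v n"
  proof -
    have 3: "T *\<^sub>v (T *\<^sub>v (T *\<^sub>v v)) = v"
    proof -
      have "T *\<^sub>v (T *\<^sub>v (T *\<^sub>v v)) = (T * (T * T)) *\<^sub>v v"
        using assoc_mult_mat_vec[OF car(2) car(2) v(1)] assoc_mult_mat_vec[OF car(2) mult_carrier_mat[OF car(2) car(2)] v(1)]
        by simp
      then show ?thesis using order_T v by simp
    qed
    have T1: "T *\<^sub>v \<xi> = T *\<^sub>v (T *\<^sub>v v) - \<omega> \<cdot>\<^sub>v (T *\<^sub>v v)" unfolding \<xi>_def using car v Tv by (simp add: lin)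
    have T2: "T *\<^sub>v (T *\<^sub>v \<xi>) = v - \<omega> \<cdot>\<^sub>v (T *\<^sub>v (T *\<^sub>v v))"
      unfolding T1 using car v Tv by (simp add: lin 3)
    have "T *\<^sub>v (T *\<^sub>v \<xi> + \<omega> \<cdot>\<^sub>v \<xi>) = T *\<^sub>v (T *\<^sub>v \<xi>) + \<omega> \<cdot>\<^sub>v (T *\<^sub>v \<xi>)"
      using car \<xi> Tv by (simp add: lin)
    also have "\<dots> = (v - \<omega> \<cdot>\<^sub>v (T *\<^sub>v (T *\<^sub>v v))) + \<omega> \<cdot>\<^sub>v (T *\<^sub>v (T *\<^sub>v v) - \<omega> \<cdot>\<^sub>v (T *\<^sub>v v))"
      by (simp only: T2, simp only: T1)
    finally have eq: "T *\<^sub>v (T *\<^sub>v \<xi> + \<omega> \<cdot>\<^sub>v \<xi>) =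
      (v - \<omega> \<cdot>\<^sub>v (T *\<^sub>v (T *\<^sub>v v))) + \<omega> \<cdot>\<^sub>v (T *\<^sub>v (T *\<^sub>v v) - \<omega> \<cdot>\<^sub>v (T *\<^sub>v v))" .
    have key: "(r - \<omega> * p) + \<omega> * (p - \<omega> * q) + (\<omega> * \<omega>) * (q - \<omega> * r) = 0" for p q r
    proof -
      have "(r - \<omega> * p) + \<omega> * (p - \<omega> * q) + (\<omega> * \<omega>) * (q - \<omega> * r) = r - (\<omega> * (\<omega> * \<omega>)) * r"
        by (simp add: algebra_simps)
      then show ?thesis using \<omega> by simp
    qed
    show ?thesis
    proof (rule eq_vecI)
      fix i assume "i < dim_vec (0\<^sub>v n :: complex vec)"
      then show "(T *\<^sub>v (T *\<^sub>v \<xi> + \<omega> \<cdot>\<^sub>v \<xi>) + (\<omega> * \<omega>) \<cdot>\<^sub>v \<xi>) $ i = 0\<^sub>v n $ i"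
        unfolding eq using key[of "v $ i" "(T *\<^sub>v (T *\<^sub>v v)) $ i" "(T *\<^sub>v v) $ i"] car v by (simp add: \<xi>_def)
    qed (use car \<xi> in auto)
  qed
  note z0 = zero_carrier_vec[of n]
  have zT: "C\<^sup>T *\<^sub>v 0\<^sub>v n + c \<cdot>\<^sub>v 0\<^sub>v n = 0\<^sub>v n" "C *\<^sub>v 0\<^sub>v n + c \<cdot>\<^sub>v 0\<^sub>v n = 0\<^sub>v n"
    if "C \<in> carrier_mat n n" for C :: "complex mat" and c
    using that by (auto intro!: eq_vecI)
  show ?thesis
  proof (rule that[of "S'" "T' \<kappa>"])
    have "mat n n (\<lambda>(i, j). 0\<^sub>v n $ i * y $ j) = 0\<^sub>m n n" by auto
    then have "S * S + mat n n (\<lambda>(i, j). 0\<^sub>v n $ i * y $ j) = 1\<^sub>m n" using order_S by simp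
    moreover have "y \<bullet> 0\<^sub>v n + \<sigma> * \<sigma> = 1" using y \<sigma> by simp
    ultimately show "S' * S' = 1\<^sub>m (Suc n)"
      unfolding S'_def blk_mult[OF car(1) car(1) z0 z0 y y] zT[OF car(1)] Sy by (simp add: blk_one)
    have z: "mat n n (\<lambda>(i, j). g $ i * 0\<^sub>v n $ j) = 0\<^sub>m n n" for g :: "complex vec" by auto
    define g where "g = T *\<^sub>v (\<kappa> \<cdot>\<^sub>v \<xi>) + \<omega> \<cdot>\<^sub>v (\<kappa> \<cdot>\<^sub>v \<xi>)"
    have g: "g \<in> carrier_vec n" unfolding g_def using \<xi> Tv by auto
    have \<kappa>\<xi>: "\<kappa> \<cdot>\<^sub>v \<xi> \<in> carrier_vec n" using \<xi> by simp
    have TT: "T * T \<in> carrier_mat n n" using car by (rule_tac mult_carrier_mat)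
    have "g = \<kappa> \<cdot>\<^sub>v (T *\<^sub>v \<xi> + \<omega> \<cdot>\<^sub>v \<xi>)"
      unfolding g_def lin(2)[OF car(2) \<xi> \<xi>] using car \<xi> by (auto intro!: eq_vecI simp: distrib_left mult.left_commute)
    then have "T *\<^sub>v g = \<kappa> \<cdot>\<^sub>v (T *\<^sub>v (T *\<^sub>v \<xi> + \<omega> \<cdot>\<^sub>v \<xi>))"
      using lin(2)[OF car(2), of "T *\<^sub>v \<xi> + \<omega> \<cdot>\<^sub>v \<xi>" "T *\<^sub>v \<xi> + \<omega> \<cdot>\<^sub>v \<xi>" \<kappa>] Tv(1)[OF \<xi>] \<xi> by auto
    then have "T *\<^sub>v g + (\<omega> * \<omega>) \<cdot>\<^sub>v (\<kappa> \<cdot>\<^sub>v \<xi>) =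
      \<kappa> \<cdot>\<^sub>v (T *\<^sub>v (T *\<^sub>v \<xi> + \<omega> \<cdot>\<^sub>v \<xi>) + (\<omega> * \<omega>) \<cdot>\<^sub>v \<xi>)"
      using car \<xi> by (auto intro!: eq_vecI simp: distrib_left)
    also have "\<dots> = 0\<^sub>v n" unfolding T\<xi> by auto
    finally have Tg: "T *\<^sub>v g + (\<omega> * \<omega>) \<cdot>\<^sub>v (\<kappa> \<cdot>\<^sub>v \<xi>) = 0\<^sub>v n" .
    have "T' \<kappa> * T' \<kappa> = blk n (T * T) g (0\<^sub>v n) (\<omega> * \<omega>)"
      unfolding T'_def blk_mult[OF car(2) car(2) \<kappa>\<xi> \<kappa>\<xi> z0 z0] zT[OF car(2)] z g_def
      using TT \<kappa>\<xi> by simp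
    moreover have "blk n T (\<kappa> \<cdot>\<^sub>v \<xi>) (0\<^sub>v n) \<omega> * blk n (T * T) g (0\<^sub>v n) (\<omega> * \<omega>) = 1\<^sub>m (Suc n)"
      unfolding blk_mult[OF car(2) TT \<kappa>\<xi> g z0 z0] zT[OF TT] z Tg
      using order_T \<omega> g by (simp add: blk_one)
    ultimately show "T' \<kappa> * (T' \<kappa> * T' \<kappa>) = 1\<^sub>m (Suc n)" by (simp add: T'_def)
    show "char_poly S' = char_poly S * [:- \<sigma>, 1:]" unfolding S'_def by (rule char_poly_blk[OF car(1)]) simp
    show "char_poly (T' \<kappa>) = char_poly T * [:- \<omega>, 1:]" unfolding T'_def by (rule char_poly_blk[OF car(2)]) simp
  qed (use \<kappa> in \<open>auto simp: S'_def T'_def\<close>)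
qed

lemma primitive_cube_root:
  fixes \<rho> :: complex
  assumes "\<rho> ^ 3 = 1" "\<rho> \<noteq> 1"
  shows "\<rho> \<noteq> 0" "\<rho> * (\<rho> * \<rho>) = 1" "\<rho>\<^sup>2 * (\<rho>\<^sup>2 * \<rho>\<^sup>2) = 1" "\<rho>\<^sup>2 \<noteq> 1" "\<rho>\<^sup>2 \<noteq> \<rho>"
    "1 + \<rho> + \<rho>\<^sup>2 = 0" "z ^ 3 = 1 \<Longrightarrow> z = 1 \<or> z = \<rho> \<or> z = \<rho>\<^sup>2"
proof -
  show "\<rho> \<noteq> 0" using assms by auto
  show r3: "\<rho> * (\<rho> * \<rho>) = 1" using assms by (simp add: power3_eq_cube mult.assoc)
  have "\<rho>\<^sup>2 * (\<rho>\<^sup>2 * \<rho>\<^sup>2) = (\<rho> * (\<rho> * \<rho>)) * (\<rho> * (\<rho> * \<rho>))" by (simp add: power2_eq_square ac_simps)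
  then show "\<rho>\<^sup>2 * (\<rho>\<^sup>2 * \<rho>\<^sup>2) = 1" using r3 by simp
  show "\<rho>\<^sup>2 \<noteq> 1" using r3 assms(2) by (auto simp: power2_eq_square)
  show "\<rho>\<^sup>2 \<noteq> \<rho>" using assms(2) \<open>\<rho> \<noteq> 0\<close> by (auto simp: power2_eq_square)
  have "(\<rho> - 1) * (1 + \<rho> + \<rho>\<^sup>2) = 0" using r3 by (simp add: algebra_simps power2_eq_square)
  then show s: "1 + \<rho> + \<rho>\<^sup>2 = 0" using assms(2) by simp
  assume z: "z ^ 3 = 1"
  have "(z - 1) * ((z - \<rho>) * (z - \<rho>\<^sup>2)) =
    z ^ 3 - z\<^sup>2 * (1 + \<rho> + \<rho>\<^sup>2) + z * (\<rho> * (1 + \<rho> + \<rho>\<^sup>2)) - \<rho> * (\<rho> * \<rho>)"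
    by (simp add: algebra_simps power2_eq_square power3_eq_cube)
  then have "(z - 1) * ((z - \<rho>) * (z - \<rho>\<^sup>2)) = 0" using r3 s z by simp
  then show "z = 1 \<or> z = \<rho> \<or> z = \<rho>\<^sup>2" by simp
qed

text \<open>As the two multiplicities of s add up to n, the condition B \<omega> \<le> A \<sigma>
  says that no multiplicity of s and none of t exceed n together, and so excludes common
  eigenvectors forced by dimension. Positivity excludes the case of two quadratic matrices, whose
  irreducible pairs have size at most 2. The induction removes one from the largest multiplicity of
  s and of t.\<close>

lemma full_pair_exists:
  fixes \<rho> :: complex and A B :: "complex \<Rightarrow> nat"
  assumes \<rho>: "\<rho> ^ 3 = 1" "\<rho> \<noteq> 1"
    and "n > 0" "A 1 + A (- 1) = n" "B 1 + B \<rho> + B (\<rho>\<^sup>2) = n"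
    and "n = 1 \<or> (\<forall>\<sigma>\<in>{1, - 1}. \<forall>\<omega>\<in>{1, \<rho>, \<rho>\<^sup>2}. B \<omega> \<le> A \<sigma>)"
    and "n \<le> 2 \<or> (\<forall>\<omega>\<in>{1, \<rho>, \<rho>\<^sup>2}. B \<omega> > 0)"
  shows "\<exists>S T. S \<in> carrier_mat n n \<and> S * S = 1\<^sub>m n \<and> T \<in> carrier_mat n n \<and> T * (T * T) = 1\<^sub>m n \<and>
    full n S T \<and> (\<forall>\<sigma>\<in>{1, - 1}. eigmult \<sigma> S = A \<sigma>) \<and>
    (\<forall>\<omega>\<in>{1, \<rho>, \<rho>\<^sup>2}. eigmult \<omega> T = B \<omega>)"
  using assms(3-)
proof (induction n arbitrary: A B)
  case (Suc m)
  note cube = primitive_cube_root[OF \<rho>]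
  note ne = \<rho>(2) cube(4,5) \<rho>(2)[symmetric] cube(4,5)[symmetric]
  obtain \<sigma> where \<sigma>: "\<sigma> \<in> {1, - 1 :: complex}" "\<And>\<sigma>'. \<sigma>' \<in> {1, - 1} \<Longrightarrow> A \<sigma>' \<le> A \<sigma>"
  proof (cases "A 1 \<le> A (- 1)")
    case True
    then show ?thesis by (intro that[of "- 1"]) auto
  next
    case False
    then show ?thesis by (intro that[of 1]) auto
  qed
  obtain \<omega> where \<omega>: "\<omega> \<in> {1, \<rho>, \<rho>\<^sup>2}" "\<And>\<omega>'. \<omega>' \<in> {1, \<rho>, \<rho>\<^sup>2} \<Longrightarrow> B \<omega>' \<le> B \<omega>"
  proof -
    have "finite (B ` {1, \<rho>, \<rho>\<^sup>2})" "B ` {1, \<rho>, \<rho>\<^sup>2} \<noteq> {}" by auto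
    from Max_in[OF this] Max_ge[OF this(1)] show ?thesis using that by (metis (no_types, lifting) image_iff)
  qed
  have \<sigma>2: "\<sigma> * \<sigma> = 1" using \<sigma>(1) by auto
  have \<omega>3: "\<omega> * (\<omega> * \<omega>) = 1" using \<omega>(1) cube by auto
  have pos: "A \<sigma> > 0" "B \<omega> > 0"
    using \<sigma>(2)[of 1] \<sigma>(2)[of "- 1"] \<omega>(2)[of 1] \<omega>(2)[of \<rho>] \<omega>(2)[of "\<rho>\<^sup>2"] Suc.prems(2,3) by auto
  show ?case
  proof (cases "m = 0")
    case True
    define S T :: "complex mat" where "S = \<sigma> \<cdot>\<^sub>m 1\<^sub>m 1" and "T = \<omega> \<cdot>\<^sub>m 1\<^sub>m 1"
    have "full 1 S T" unfolding full_def
    proof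
      fix M :: "complex mat" assume "M \<in> carrier_mat 1 1"
      then have "nev 1 S T (NConst (M $$ (0, 0))) = M" by auto
      then show "\<exists>f. nev 1 S T f = M" ..
    qed
    moreover have "char_poly (c \<cdot>\<^sub>m 1\<^sub>m 1) = [:- c, 1:]" for c :: complex
      unfolding char_poly_def char_poly_matrix_def by (subst det_single) auto
    moreover have "S * S = 1\<^sub>m 1" "T * (T * T) = 1\<^sub>m 1"
      using \<sigma>2 \<omega>3 by (auto simp: S_def T_def mult_smult_assoc_mat[of _ 1 1 _ 1] mult_smult_distrib[of _ 1 1 _ 1] intro!: eq_matI)
    moreover have "\<forall>\<sigma>'\<in>{1, - 1}. Polynomial.order \<sigma>' [:- \<sigma>, 1:] = A \<sigma>'"
      "\<forall>\<omega>'\<in>{1, \<rho>, \<rho>\<^sup>2}. Polynomial.order \<omega>' [:- \<omega>, 1:] = B \<omega>'"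
      using \<sigma>(1) \<omega>(1) pos Suc.prems(2,3) True ne unfolding order_linear by auto
    ultimately show ?thesis
      using True by (intro exI[of _ S] exI[of _ T]) (auto simp: S_def T_def)
  next
    case False
    define A' B' where "A' = A(\<sigma> := A \<sigma> - 1)" and "B' = B(\<omega> := B \<omega> - 1)"
    have le: "B 1 \<le> A 1" "B \<rho> \<le> A 1" "B (\<rho>\<^sup>2) \<le> A 1" "B 1 \<le> A (- 1)" "B \<rho> \<le> A (- 1)" "B (\<rho>\<^sup>2) \<le> A (- 1)"
      using Suc.prems(4) False by auto
    have Amax: "A 1 \<le> A \<sigma>" "A (- 1) \<le> A \<sigma>" and Bmax: "B 1 \<le> B \<omega>" "B \<rho> \<le> B \<omega>" "B (\<rho>\<^sup>2) \<le> B \<omega>"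
      using \<sigma>(2) \<omega>(2) by auto
    have sums: "A' 1 + A' (- 1) = m" "B' 1 + B' \<rho> + B' (\<rho>\<^sup>2) = m"
      using \<sigma>(1) \<omega>(1) pos Suc.prems(2,3) ne by (auto simp: A'_def B'_def)
    have bpos: "B 1 > 0 \<and> B \<rho> > 0 \<and> B (\<rho>\<^sup>2) > 0" if "m \<noteq> 1"
      using Suc.prems(5) False that by auto
    \<comment> \<open>If a second eigenvalue of t also had multiplicity A \<sigma>, then it and
      \<omega> would fill dimension Suc m and leave 0 for the third, against positivity.\<close>
    have "m = 1 \<or> (\<forall>\<sigma>\<in>{1, - 1}. \<forall>\<omega>\<in>{1, \<rho>, \<rho>\<^sup>2}. B' \<omega> \<le> A' \<sigma>)"
    proof (cases "m = 1")
      case False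
      show ?thesis
        using \<sigma>(1) \<omega>(1) Suc.prems(2,3) ne bpos[OF False] le Amax Bmax
        unfolding A'_def B'_def by (elim insertE emptyE) (simp_all, linarith+)
    qed simp
    \<comment> \<open>Were the largest multiplicity reduced to 0, all three would have been 1 and m
      would be 2.\<close>
    moreover have "m \<le> 2 \<or> (\<forall>\<omega>\<in>{1, \<rho>, \<rho>\<^sup>2}. B' \<omega> > 0)"
    proof (cases "m \<le> 2")
      case False
      then have "m \<noteq> 1" by simp
      from bpos[OF this] False show ?thesis
        using \<omega>(1) Suc.prems(3) ne Bmax
        unfolding B'_def by (elim insertE emptyE) simp_all
    qed simp
    ultimately obtain S T where ST: "S \<in> carrier_mat m m" "S * S = 1\<^sub>m m" "T \<in> carrier_mat m m"
      "T * (T * T) = 1\<^sub>m m" "full m S T"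
      "\<And>\<sigma>. \<sigma> \<in> {1, - 1} \<Longrightarrow> eigmult \<sigma> S = A' \<sigma>"
      "\<And>\<omega>. \<omega> \<in> {1, \<rho>, \<rho>\<^sup>2} \<Longrightarrow> eigmult \<omega> T = B' \<omega>"
      using Suc.IH[of A' B'] False sums by blast
    \<comment> \<open>Before the removal the sum is at most Suc m, because B \<omega> is bounded by
      the other multiplicity of s. The removal lowers the sum by 2 and the dimension by 1.\<close>
    have "A' \<sigma> + B' \<omega> < m"
      using \<sigma>(1) \<omega>(1) pos le Suc.prems(2) unfolding A'_def B'_def by auto
    then have less: "eigmult \<sigma> S + eigmult \<omega> T < m"
      using ST(6)[OF \<sigma>(1)] ST(7)[OF \<omega>(1)] by simp
    obtain S' T' where S'T': "S' \<in> carrier_mat (Suc m) (Suc m)" "S' * S' = 1\<^sub>m (Suc m)"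
      "T' \<in> carrier_mat (Suc m) (Suc m)" "T' * (T' * T') = 1\<^sub>m (Suc m)" "full (Suc m) S' T'"
      and cp: "char_poly S' = char_poly S * [:- \<sigma>, 1:]" "char_poly T' = char_poly T * [:- \<omega>, 1:]"
      using full_pair_step[OF ST(1-4) _ ST(5) \<sigma>2 \<omega>3 less] False by blast
    have "char_poly S \<noteq> 0" "char_poly T \<noteq> 0"
      using degree_monic_char_poly[OF ST(1)] degree_monic_char_poly[OF ST(3)] by auto
    then have ord: "eigmult a S' = eigmult a S + (if a = \<sigma> then 1 else 0)"
      "eigmult a T' = eigmult a T + (if a = \<omega> then 1 else 0)" for a
      unfolding cp by (subst order_mult; simp add: order_linear del: mult_pCons_right)+
    have "\<forall>\<sigma>'\<in>{1, - 1}. eigmult \<sigma>' S' = A \<sigma>'"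
      "\<forall>\<omega>'\<in>{1, \<rho>, \<rho>\<^sup>2}. eigmult \<omega>' T' = B \<omega>'"
      unfolding ord using ST(6,7) pos by (auto simp: A'_def B'_def)
    with S'T' show ?thesis by blast
  qed
qed simp


subsection \<open>Subspaces and irreducibility\<close>

lemma subspace_iff:
  "VectorSpace.subspace class_ring W (module_vec TYPE(complex) n) \<longleftrightarrow>
     W \<subseteq> carrier_vec n \<and> 0\<^sub>v n \<in> W \<and> (\<forall>v\<in>W. \<forall>w\<in>W. v + w \<in> W) \<and> (\<forall>c. \<forall>v\<in>W. c \<cdot>\<^sub>v v \<in> W)"
proof -
  have vs: "vectorspace class_ring (module_vec TYPE(complex) n)" by (rule vec_vs)
  then have "module class_ring (module_vec TYPE(complex) n)" by (simp add: vectorspace_def)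
  with vs show ?thesis
    unfolding VectorSpace.subspace_def submodule_def by (auto simp: module_vec_simps class_ring_simps)
qed

lemma invariant_subspaceD:
  assumes "invariant_subspace n G \<phi> W"
  shows "W \<subseteq> carrier_vec n" "0\<^sub>v n \<in> W" "v \<in> W \<Longrightarrow> w \<in> W \<Longrightarrow> v + w \<in> W" "v \<in> W \<Longrightarrow> c \<cdot>\<^sub>v v \<in> W"
    "g \<in> carrier G \<Longrightarrow> v \<in> W \<Longrightarrow> \<phi> g *\<^sub>v v \<in> W"
  using assms by (auto simp: invariant_subspace_def subspace_iff)

lemma trivial_invariant_subspaces:
  assumes "\<phi> \<in> reps n G"
  shows "invariant_subspace n G \<phi> {0\<^sub>v n}" "invariant_subspace n G \<phi> (carrier_vec n)"
proof -
  have "\<phi> g *\<^sub>v 0\<^sub>v n = 0\<^sub>v n" if "g \<in> carrier G" for g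
    using rep_mat[OF assms that] by (auto intro!: eq_vecI)
  then show "invariant_subspace n G \<phi> {0\<^sub>v n}" by (auto simp: invariant_subspace_def subspace_iff)
  show "invariant_subspace n G \<phi> (carrier_vec n)"
    using rep_mat[OF assms] by (auto simp: invariant_subspace_def subspace_iff intro: mult_mat_vec_carrier[of _ n n])
qed

lemma irreducible_imp_semisimple:
  assumes "irreducible_rep n G \<phi>"
  shows "semisimple_rep n G \<phi>"
  unfolding semisimple_rep_def
proof (intro conjI allI impI)
  show \<phi>: "\<phi> \<in> reps n G" using assms by (simp add: irreducible_rep_def)
  fix W assume "invariant_subspace n G \<phi> W"
  then consider "W = {0\<^sub>v n}" | "W = carrier_vec n" using assms by (auto simp: irreducible_rep_def)
  then show "\<exists>W'. invariant_subspace n G \<phi> W' \<and> W \<inter> W' = {0\<^sub>v n} \<and>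
      {w + w' |w w'. w \<in> W \<and> w' \<in> W'} = carrier_vec n"
  proof cases
    case 1
    have "{w + w' |w w'. w \<in> W \<and> w' \<in> carrier_vec n} = carrier_vec n"
      using 1 by (auto intro: left_zero_vec[symmetric])
    then show ?thesis using trivial_invariant_subspaces[OF \<phi>] 1 by (intro exI[of _ "carrier_vec n"]) auto
  next
    case 2
    have "{w + w' |w w'. w \<in> carrier_vec n \<and> w' \<in> {0\<^sub>v n}} = (carrier_vec n :: complex vec set)"
      by auto (metis right_zero_vec)
    then show ?thesis using trivial_invariant_subspaces[OF \<phi>] 2 by (intro exI[of _ "{0\<^sub>v n}"]) auto
  qed
qed

lemma rep_isoE:
  assumes "rep_iso n G \<phi> \<psi>" "\<phi> \<in> reps n G" "\<psi> \<in> reps n G"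
  obtains P Q where "P \<in> carrier_mat n n" "Q \<in> carrier_mat n n" "P * Q = 1\<^sub>m n" "Q * P = 1\<^sub>m n"
    "\<And>g. g \<in> carrier G \<Longrightarrow> P * \<phi> g = \<psi> g * P" "\<And>g. g \<in> carrier G \<Longrightarrow> \<psi> g = P * \<phi> g * Q"
proof -
  obtain P where P: "P \<in> carrier (GL n)" "\<And>g. g \<in> carrier G \<Longrightarrow> P * \<phi> g = \<psi> g * P"
    using assms by (auto simp: rep_iso_def)
  obtain Q where Q: "Q \<in> carrier_mat n n" "P * Q = 1\<^sub>m n" "Q * P = 1\<^sub>m n" using P(1) by (auto simp: carrier_GL)
  have "\<psi> g = P * \<phi> g * Q" if g: "g \<in> carrier G" for g
  proof -
    have "\<psi> g = \<psi> g * (P * Q)" using Q rep_mat[OF assms(3) g] by simp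
    also have "\<dots> = \<psi> g * P * Q"
      using Q rep_mat[OF assms(3) g] GL_mat[OF P(1)] by (intro assoc_mult_mat[symmetric]) auto
    finally show ?thesis using P(2)[OF g] by simp
  qed
  then show ?thesis using that P Q GL_mat[OF P(1)] by blast
qed

lemma irreducible_rep_iso:
  assumes irr: "irreducible_rep n G \<phi>" and iso: "rep_iso n G \<phi> \<psi>" and \<psi>: "\<psi> \<in> reps n G"
  shows "irreducible_rep n G \<psi>"
  unfolding irreducible_rep_def
proof (intro conjI allI impI)
  have \<phi>: "\<phi> \<in> reps n G" using irr by (simp add: irreducible_rep_def)
  show "\<psi> \<in> reps n G" "n > 0" using \<psi> irr by (auto simp: irreducible_rep_def)
  obtain P Q where P: "P \<in> carrier_mat n n" and Q: "Q \<in> carrier_mat n n" "P * Q = 1\<^sub>m n" "Q * P = 1\<^sub>m n"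
    and PQ: "\<And>g. g \<in> carrier G \<Longrightarrow> P * \<phi> g = \<psi> g * P"
    using rep_isoE[OF iso \<phi> \<psi>] by metis
  fix W assume W: "invariant_subspace n G \<psi> W"
  note WD = invariant_subspaceD[OF W]
  define W' where "W' = {v \<in> carrier_vec n. P *\<^sub>v v \<in> W}"
  have "P *\<^sub>v 0\<^sub>v n = 0\<^sub>v n" using P by (auto intro!: eq_vecI)
  moreover have "P *\<^sub>v (\<phi> g *\<^sub>v v) = \<psi> g *\<^sub>v (P *\<^sub>v v)" if "g \<in> carrier G" "v \<in> carrier_vec n" for g v
    using that P PQ rep_mat[OF \<phi>] rep_mat[OF \<psi>]
    by (simp flip: assoc_mult_mat_vec[of _ n n _ n])
  ultimately have "invariant_subspace n G \<phi> W'"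
    unfolding invariant_subspace_def subspace_iff
    using WD P rep_mat[OF \<phi>] by (auto simp: W'_def mult_add_distrib_mat_vec[of _ n n] mult_mat_vec[of _ n n]
        intro: mult_mat_vec_carrier[of _ n n])
  then have "W' = {0\<^sub>v n} \<or> W' = carrier_vec n" using irr by (auto simp: irreducible_rep_def)
  moreover have PQv: "P *\<^sub>v (Q *\<^sub>v w) = w" "Q *\<^sub>v w \<in> carrier_vec n" if "w \<in> carrier_vec n" for w
    using that P Q by (auto intro: mult_mat_vec_carrier[of _ n n] simp flip: assoc_mult_mat_vec[of _ n n _ n])
  moreover have "Q *\<^sub>v w \<in> W' \<longleftrightarrow> w \<in> W" if "w \<in> carrier_vec n" for w
    using PQv[OF that] by (simp add: W'_def)
  ultimately show "W = {0\<^sub>v n} \<or> W = carrier_vec n"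
  proof (elim disjE)
    assume *: "W' = {0\<^sub>v n}"
    have "w = 0\<^sub>v n" if "w \<in> W" for w
    proof -
      have w: "w \<in> carrier_vec n" using that WD by auto
      then have "Q *\<^sub>v w \<in> W'" using that PQv[OF w] by (simp add: W'_def)
      then have "P *\<^sub>v (Q *\<^sub>v w) = P *\<^sub>v 0\<^sub>v n" using * by simp
      then show ?thesis using PQv[OF w] \<open>P *\<^sub>v 0\<^sub>v n = 0\<^sub>v n\<close> by simp
    qed
    then show ?thesis using WD(2) by blast
  next
    assume *: "W' = carrier_vec n"
    have "w \<in> W" if "w \<in> carrier_vec n" for w
    proof -
      have "Q *\<^sub>v w \<in> W'" using PQv(2)[OF that] * by simp
      then show ?thesis using PQv(1)[OF that] by (simp add: W'_def)
    qed
    then show ?thesis using WD(1) by blast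
  qed
qed

text \<open>A proper subspace cannot contain n vectors with nonzero determinant, since these would
  span everything; so the annihilator in \<open>det_or_annihilator\<close> exists.\<close>

lemma functional_vanishing_on_subspace:
  assumes W: "W \<subseteq> carrier_vec n" "0\<^sub>v n \<in> W" "\<And>v w. v \<in> W \<Longrightarrow> w \<in> W \<Longrightarrow> v + w \<in> W"
    "\<And>c v. v \<in> W \<Longrightarrow> c \<cdot>\<^sub>v v \<in> W" and proper: "W \<noteq> carrier_vec n"
  obtains x :: "nat \<Rightarrow> complex" where "\<exists>j<n. x j \<noteq> 0" "\<And>w. w \<in> W \<Longrightarrow> (\<Sum>j<n. x j * w $ j) = 0"
proof -
  have False if r: "\<forall>i<n. r i \<in> (\<lambda>w j. w $ j) ` W" "det (mat n n (\<lambda>(i, j). r i j)) \<noteq> 0" for r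
  proof -
    define M where "M = mat n n (\<lambda>(i, j). r i j)"
    have M: "M \<in> carrier_mat n n" by (simp add: M_def)
    have "det M\<^sup>T \<noteq> 0" using r(2) M by (simp add: det_transpose[OF M] flip: M_def)
    from det_non_zero_imp_unit[OF _ this, of n] obtain N where N: "N \<in> carrier_mat n n" "M\<^sup>T * N = 1\<^sub>m n"
      using M by (auto simp: Units_def ring_mat_simps)
    have "v \<in> W" if v: "v \<in> carrier_vec n" for v
    proof -
      define c where "c = N *\<^sub>v v"
      have c: "c \<in> carrier_vec n" unfolding c_def using N v by (intro mult_mat_vec_carrier[of _ n n]) auto
      have "v = M\<^sup>T *\<^sub>v c" unfolding c_def using N v M by (simp flip: assoc_mult_mat_vec[of _ n n _ n])
      then have vi: "v $ j = (\<Sum>i<n. c $ i * r i j)" if "j < n" for j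
        using that c by (simp add: M_def scalar_prod_def atLeast0LessThan mult.commute)
      have "k \<le> n \<Longrightarrow> vec n (\<lambda>j. \<Sum>i<k. c $ i * r i j) \<in> W" for k
      proof (induction k)
        case 0
        then show ?case using W(2) by (simp add: zero_vec_def)
      next
        case (Suc k)
        then obtain w where w: "w \<in> W" "r k = (\<lambda>j. w $ j)" using r(1) by (metis Suc_le_eq imageE)
        have "vec n (\<lambda>j. \<Sum>i<Suc k. c $ i * r i j) = vec n (\<lambda>j. \<Sum>i<k. c $ i * r i j) + c $ k \<cdot>\<^sub>v w"
          using w W(1) by (intro eq_vecI) auto
        then show ?case using Suc W(3,4) w by simp
      qed
      from this[of n] have "vec n (\<lambda>j. \<Sum>i<n. c $ i * r i j) \<in> W" by simp
      also have "vec n (\<lambda>j. \<Sum>i<n. c $ i * r i j) = v" using v by (intro eq_vecI) (auto simp: vi)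
      finally show ?thesis .
    qed
    then show False using W(1) proper by auto
  qed
  then obtain x :: "nat \<Rightarrow> complex" where "\<exists>j<n. x j \<noteq> 0" "\<forall>v\<in>(\<lambda>w j. w $ j) ` W. (\<Sum>j<n. v j * x j) = 0"
    using det_or_annihilator[of n "(\<lambda>w j. w $ j) ` W"] by blast
  then show ?thesis using that by (simp add: mult.commute)
qed

subsection \<open>Gram determinants\<close>

text \<open>The trace form, written out in entries so that it is visibly polynomial in the matrix
  coefficients.\<close>

definition pairing :: "nat \<Rightarrow> complex mat \<Rightarrow> complex mat \<Rightarrow> complex" where
  "pairing n A B = (\<Sum>a<n. \<Sum>b<n. A $$ (a, b) * B $$ (b, a))"

text \<open>The discriminant of n * n group elements for the trace form. For a representation it is
  nonzero exactly when their images form a basis of the matrix algebra, and traces make it invariant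
  under conjugation.\<close>

definition gram :: "nat \<Rightarrow> (nat \<Rightarrow> 'g) \<Rightarrow> ('g \<Rightarrow> complex mat) \<Rightarrow> complex" where
  "gram n gs \<phi> = det (mat (n * n) (n * n) (\<lambda>(i, j). pairing n (\<phi> (gs i)) (\<phi> (gs j))))"

lemma pairing_trace:
  assumes "A \<in> carrier_mat n n" "B \<in> carrier_mat n n"
  shows "pairing n A B = (\<Sum>a<n. (A * B) $$ (a, a))"
  using assms by (auto simp: pairing_def scalar_prod_def atLeast0LessThan intro!: sum.cong)

lemma pairing_commute: "pairing n A B = pairing n B A"
  unfolding pairing_def by (subst sum.swap) (simp add: mult.commute)

lemma pairing_conjugate:
  assumes "A \<in> carrier_mat n n" "B \<in> carrier_mat n n" "P \<in> carrier_mat n n" "Q \<in> carrier_mat n n"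
    and "Q * P = 1\<^sub>m n"
  shows "pairing n (P * A * Q) (P * B * Q) = pairing n A B"
proof -
  note assoc = assoc_mult_mat[of _ n n _ n _ n] mult_carrier_mat[of _ n n _ n]
  have "(P * A * Q) * (P * B * Q) = P * A * (Q * P) * (B * Q)" using assms(1-4) by (simp add: assoc)
  also have "\<dots> = (P * (A * B)) * Q" using assms by (simp add: assoc)
  finally have "pairing n (P * A * Q) (P * B * Q) = pairing n (P * (A * B)) Q"
    using assms by (simp add: pairing_trace assoc)
  also have "\<dots> = pairing n Q (P * (A * B))" by (rule pairing_commute)
  also have "\<dots> = (\<Sum>a<n. (Q * P * (A * B)) $$ (a, a))" using assms(1-4) by (simp add: pairing_trace assoc)
  also have "\<dots> = pairing n A B" using assms by (simp add: pairing_trace assoc)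
  finally show ?thesis .
qed

lemma regular_functions_sum:
  assumes "finite I" "\<And>i. i \<in> I \<Longrightarrow> f i \<in> regular_functions n G"
  shows "(\<lambda>\<phi>. \<Sum>i\<in>I. f i \<phi>) \<in> regular_functions n G"
  using assms by (induction I rule: finite_induct) (auto intro: regular_functions.intros)

lemma regular_functions_prod:
  assumes "finite I" "\<And>i. i \<in> I \<Longrightarrow> f i \<in> regular_functions n G"
  shows "(\<lambda>\<phi>. \<Prod>i\<in>I. f i \<phi>) \<in> regular_functions n G"
  using assms by (induction I rule: finite_induct) (auto intro: regular_functions.intros)

lemma gram_invariant:
  assumes gs: "\<And>i. gs i \<in> carrier G"
  shows "gram n gs \<in> invariant_functions n G"
  unfolding invariant_functions_def mem_Collect_eq
proof (intro conjI ballI impI)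
  have pairing: "(\<lambda>\<phi>. pairing n (\<phi> (gs i)) (\<phi> (gs j))) \<in> regular_functions n G" for i j
    unfolding pairing_def by (intro regular_functions_sum regular_functions.intros gs) auto
  \<comment> \<open>The Leibniz formula shows that the determinant is a regular function.\<close>
  have "gram n gs = (\<lambda>\<phi>. \<Sum>p\<in>{p. p permutes {0..<n * n}}. signof p *
      (\<Prod>i = 0..<n * n. pairing n (\<phi> (gs i)) (\<phi> (gs (p i)))))" (is "_ = ?f")
  proof
    fix \<phi> :: "'a \<Rightarrow> complex mat"
    show "gram n gs \<phi> = ?f \<phi>"
      unfolding gram_def
    proof (subst det_def'[of _ "n * n"], simp, intro sum.cong arg_cong2[where f = "(*)"] prod.cong)
      fix p i assume "p \<in> {p. p permutes {0..<n * n}}" "i \<in> {0..<n * n}"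
      then have "i < n * n" "p i < n * n" using permutes_in_image[of p "{0..<n * n}" i] by auto
      then show "mat (n * n) (n * n) (\<lambda>(i, j). pairing n (\<phi> (gs i)) (\<phi> (gs j))) $$ (i, p i) =
        pairing n (\<phi> (gs i)) (\<phi> (gs (p i)))" by simp
    qed simp_all
  qed
  also have "\<dots> \<in> regular_functions n G"
  proof (rule regular_functions_sum)
    show "finite {p. p permutes {0..<n * n}}" by (simp add: finite_permutations)
    show "(\<lambda>\<phi>. signof p * (\<Prod>i = 0..<n * n. pairing n (\<phi> (gs i)) (\<phi> (gs (p i))))) \<in> regular_functions n G" for p
      by (rule regular_functions.mult[OF regular_functions.const regular_functions_prod[OF _ pairing]]) simp
  qed
  finally show "gram n gs \<in> regular_functions n G" .
next
  fix \<phi> \<psi> assume \<phi>: "\<phi> \<in> reps n G" and \<psi>: "\<psi> \<in> reps n G" and iso: "rep_iso n G \<phi> \<psi>"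
  obtain P Q where P: "P \<in> carrier_mat n n" and Q: "Q \<in> carrier_mat n n" "P * Q = 1\<^sub>m n" "Q * P = 1\<^sub>m n"
    and PQ: "\<And>g. g \<in> carrier G \<Longrightarrow> \<psi> g = P * \<phi> g * Q"
    using rep_isoE[OF iso \<phi> \<psi>] by metis
  show "gram n gs \<phi> = gram n gs \<psi>"
    using pairing_conjugate[OF rep_mat[OF \<phi> gs] rep_mat[OF \<phi> gs] P Q(1,3)] by (simp add: gram_def PQ[OF gs])
qed

lemma sum_div_mod:
  fixes f :: "nat \<Rightarrow> nat \<Rightarrow> complex"
  shows "(\<Sum>k<n * n. f (k div n) (k mod n)) = (\<Sum>a<n. \<Sum>b<n. f a b)"
proof -
  have "(\<Sum>a<n. \<Sum>b<n. f a b) = (\<Sum>(a, b)\<in>{..<n} \<times> {..<n}. f a b)" by (simp add: sum.cartesian_product)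
  also have "\<dots> = (\<Sum>k<n * n. f (k div n) (k mod n))"
  proof (rule sum.reindex_bij_witness[of _ "\<lambda>k. (k div n, k mod n)" "\<lambda>(a, b). a * n + b"])
    fix k assume "k \<in> {..<n * n}"
    then have "k < n * n" "n > 0" by (auto intro: gr0I)
    then show "(k div n, k mod n) \<in> {..<n} \<times> {..<n}" by (simp add: less_mult_imp_div_less)
  next
    fix p assume "p \<in> {..<n} \<times> {..<n}"
    then obtain a b where p: "p = (a, b)" "a < n" "b < n" by auto
    then show "(case p of (a, b) \<Rightarrow> a * n + b) \<in> {..<n * n}" by (simp add: pair_index_less)
  qed auto
  finally show ?thesis by simp
qed

text \<open>With matrices flattened row by row, the trace form pairs one matrix with the flattened
  transpose of the other; so the Gram matrix is a product of two coordinate matrices.\<close>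

lemma gram_factor:
  "mat (n * n) (n * n) (\<lambda>(i, j). pairing n (\<phi> (gs i)) (\<phi> (gs j))) =
    mat (n * n) (n * n) (\<lambda>(i, k). \<phi> (gs i) $$ (k div n, k mod n)) *
    mat (n * n) (n * n) (\<lambda>(k, j). \<phi> (gs j) $$ (k mod n, k div n))" (is "?G = ?B * ?C")
proof (rule eq_matI)
  fix i j assume "i < dim_row (?B * ?C)" "j < dim_col (?B * ?C)"
  then show "?G $$ (i, j) = (?B * ?C) $$ (i, j)"
    using sum_div_mod[of "\<lambda>a b. \<phi> (gs i) $$ (a, b) * \<phi> (gs j) $$ (b, a)" n]
    by (simp add: pairing_def scalar_prod_def atLeast0LessThan)
qed auto

text \<open>A nonzero w in a proper invariant subspace and a linear form x vanishing on that
  subspace give the nonzero form M \<mapsto> x (M w) on matrices. It kills all group elements,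
  whereas the chosen ones form a basis.\<close>

lemma gram_irreducible:
  assumes \<phi>: "\<phi> \<in> reps n G" and n: "n > 0" and gs: "\<And>i. gs i \<in> carrier G" and gram: "gram n gs \<phi> \<noteq> 0"
  shows "irreducible_rep n G \<phi>"
  unfolding irreducible_rep_def
proof (intro conjI allI impI)
  fix W assume W: "invariant_subspace n G \<phi> W"
  note WD = invariant_subspaceD[OF W]
  show "W = {0\<^sub>v n} \<or> W = carrier_vec n"
  proof (rule ccontr)
    assume *: "\<not> ?thesis"
    then obtain w where w: "w \<in> W" "w \<noteq> 0\<^sub>v n" using WD(2) by auto
    have wn: "w \<in> carrier_vec n" using w WD(1) by auto
    obtain x where x: "\<exists>j<n. x j \<noteq> 0" "\<And>w. w \<in> W \<Longrightarrow> (\<Sum>j<n. x j * w $ j) = 0"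
      using functional_vanishing_on_subspace[OF WD(1-4)] * by metis
    define B where "B = mat (n * n) (n * n) (\<lambda>(i, k). \<phi> (gs i) $$ (k div n, k mod n))"
    have B: "B \<in> carrier_mat (n * n) (n * n)" by (simp add: B_def)
    have "det B \<noteq> 0"
      using gram unfolding gram_def gram_factor by (subst (asm) det_mult[of _ "n * n"]) (auto simp: B_def)
    \<comment> \<open>The coefficients of the form M \<mapsto> x (M w) in flattened
      coordinates.\<close>
    define v where "v = vec (n * n) (\<lambda>k. w $ (k mod n) * x (k div n))"
    have "B *\<^sub>v v = 0\<^sub>v (n * n)"
    proof (rule eq_vecI)
      fix i assume i: "i < dim_vec (0\<^sub>v (n * n) :: complex vec)"
      then have "(B *\<^sub>v v) $ i = (\<Sum>k<n * n. \<phi> (gs i) $$ (k div n, k mod n) * (w $ (k mod n) * x (k div n)))"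
        by (simp add: B_def v_def scalar_prod_def atLeast0LessThan)
      also have "\<dots> = (\<Sum>a<n. \<Sum>b<n. \<phi> (gs i) $$ (a, b) * (w $ b * x a))"
        by (rule sum_div_mod[of "\<lambda>a b. \<phi> (gs i) $$ (a, b) * (w $ b * x a)"])
      also have "\<dots> = (\<Sum>a<n. x a * (\<phi> (gs i) *\<^sub>v w) $ a)"
        using rep_mat[OF \<phi> gs, of i] wn
        by (intro sum.cong) (auto simp: scalar_prod_def atLeast0LessThan sum_distrib_left ac_simps)
      also have "\<dots> = 0" using WD(5)[OF gs w(1)] by (rule x(2))
      finally show "(B *\<^sub>v v) $ i = 0\<^sub>v (n * n) $ i" using i by simp
    qed (use B in auto)
    moreover have "v \<noteq> 0\<^sub>v (n * n)"
    proof
      assume v0: "v = 0\<^sub>v (n * n)"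
      obtain a where a: "a < n" "x a \<noteq> 0" using x(1) by blast
      obtain b where b: "b < n" "w $ b \<noteq> 0" using w(2) wn by (auto simp: vec_eq_iff)
      have lt: "a * n + b < n * n" by (rule pair_index_less[OF a(1) b(1)])
      then have "v $ (a * n + b) = w $ b * x a" using b by (simp add: v_def)
      then show False using v0 lt a b by simp
    qed
    moreover have "v \<in> carrier_vec (n * n)" by (simp add: v_def)
    ultimately have "det B = 0" using det_0_iff_vec_prod_zero[OF B] by blast
    with \<open>det B \<noteq> 0\<close> show False ..
  qed
qed (use assms in auto)

section \<open>The linear span of the group elements\<close>

inductive_set rep_span :: "nat \<Rightarrow> 'g monoid \<Rightarrow> ('g \<Rightarrow> complex mat) \<Rightarrow> complex mat set" for n G \<phi> where
  val: "g \<in> carrier G \<Longrightarrow> \<phi> g \<in> rep_span n G \<phi>"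
| add: "A \<in> rep_span n G \<phi> \<Longrightarrow> B \<in> rep_span n G \<phi> \<Longrightarrow> A + B \<in> rep_span n G \<phi>"
| smult: "A \<in> rep_span n G \<phi> \<Longrightarrow> c \<cdot>\<^sub>m A \<in> rep_span n G \<phi>"

lemma rep_span_carrier: "A \<in> rep_span n G \<phi> \<Longrightarrow> \<phi> \<in> reps n G \<Longrightarrow> A \<in> carrier_mat n n"
  by (induction rule: rep_span.induct) auto

lemma rep_span_mult:
  assumes \<phi>: "\<phi> \<in> reps n G" and G: "Group.group G" and g: "g \<in> carrier G"
  shows "A \<in> rep_span n G \<phi> \<Longrightarrow> \<phi> g * A \<in> rep_span n G \<phi>"
proof (induction rule: rep_span.induct)
  case (val h)
  have "g \<otimes>\<^bsub>G\<^esub> h \<in> carrier G" using G g val by (rule Group.group.subgroup_self[THEN subgroup.m_closed])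
  then show ?case using rep_mult[OF \<phi> g val] rep_span.val[of _ G \<phi> n] by metis
next
  case (add A B)
  then show ?case
    using mult_add_distrib_mat[OF rep_mat[OF \<phi> g] rep_span_carrier[OF _ \<phi>] rep_span_carrier[OF _ \<phi>], of A B]
    by (auto intro: rep_span.add)
next
  case (smult A c)
  then show ?case
    using mult_smult_distrib[OF rep_mat[OF \<phi> g] rep_span_carrier[OF _ \<phi>], of A c] by (auto intro: rep_span.smult)
qed

lemma nev_in_rep_span:
  assumes \<phi>: "\<phi> \<in> reps n ModGrp"
  shows "nev n (s_mat \<phi>) (t_mat \<phi>) f \<in> rep_span n ModGrp \<phi>"
proof -
  interpret Group.group ModGrp by (rule group_presented_group)
  note mult = rep_span_mult[OF \<phi> group_presented_group gen_carrier]
  \<comment> \<open>The induction is on left multiplication by the polynomial, because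
    \<open>rep_span\<close> is closed by definition under sums and multiples only; a product then
    amounts to two such multiplications.\<close>
  have "nev n (s_mat \<phi>) (t_mat \<phi>) f * A \<in> rep_span n ModGrp \<phi>" if "A \<in> rep_span n ModGrp \<phi>" for A
    using that
  proof (induction f arbitrary: A)
    case (NConst c)
    then show ?case using rep_span_carrier[OF NConst \<phi>]
      by (simp add: mult_smult_assoc_mat[of _ n n _ n] rep_span.smult)
  next
    case (NAdd f h)
    have "nev n (s_mat \<phi>) (t_mat \<phi>) p \<in> carrier_mat n n" for p
      using mod_rep_relations[OF \<phi>] by (intro nev_closed) auto
    then show ?case using NAdd rep_span_carrier[OF NAdd.prems \<phi>]
      by (simp add: add_mult_distrib_mat[of _ n n _ _ n] rep_span.add)
  next
    case (NMul f h)
    have "nev n (s_mat \<phi>) (t_mat \<phi>) p \<in> carrier_mat n n" for p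
      using mod_rep_relations[OF \<phi>] by (intro nev_closed) auto
    then show ?case using NMul rep_span_carrier[OF NMul.prems \<phi>]
      by (simp add: assoc_mult_mat[of _ n n _ n _ n])
  qed (auto intro: mult)
  moreover have "1\<^sub>m n \<in> rep_span n ModGrp \<phi>"
  proof -
    have "\<phi> \<one>\<^bsub>ModGrp\<^esub> = 1\<^sub>m n"
      using rep_weval[OF \<phi>, of "[]"] by (simp add: presented_group_def)
    then show ?thesis using rep_span.val[of "\<one>\<^bsub>ModGrp\<^esub>" ModGrp \<phi> n] by simp
  qed
  ultimately have "nev n (s_mat \<phi>) (t_mat \<phi>) f * 1\<^sub>m n \<in> rep_span n ModGrp \<phi>" by blast
  moreover have "nev n (s_mat \<phi>) (t_mat \<phi>) f \<in> carrier_mat n n"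
    using mod_rep_relations[OF \<phi>] by (intro nev_closed) auto
  ultimately show ?thesis by simp
qed

text \<open>Otherwise a nonzero linear form on matrices would vanish on all group elements, hence on
  their span, which contains every matrix unit.\<close>

lemma full_gram:
  assumes \<phi>: "\<phi> \<in> reps n ModGrp" and full: "full n (s_mat \<phi>) (t_mat \<phi>)"
  obtains gs where "\<And>i. gs i \<in> carrier ModGrp" "gram n gs \<phi> \<noteq> 0"
proof -
  interpret Group.group ModGrp by (rule group_presented_group)
  define V where "V = (\<lambda>g k. \<phi> g $$ (k div n, k mod n)) ` carrier ModGrp"
  have idx: "a * n + b < n * n" "(a * n + b) div n = a" "(a * n + b) mod n = b" if "a < n" "b < n" for a b
    using that by (auto simp: pair_index_less)
  have False if x: "\<exists>j<n * n. x j \<noteq> 0" "\<forall>v\<in>V. (\<Sum>j<n * n. v j * x j) = 0" for x :: "nat \<Rightarrow> complex"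
  proof -
    have zero: "(\<Sum>k<n * n. A $$ (k div n, k mod n) * x k) = 0" if "A \<in> rep_span n ModGrp \<phi>" for A
      using that
    proof (induction rule: rep_span.induct)
      case (val g)
      then show ?case using x(2) by (auto simp: V_def)
    next
      case (add A B)
      have "A \<in> carrier_mat n n" "B \<in> carrier_mat n n" using add rep_span_carrier[OF _ \<phi>] by auto
      then have "(A + B) $$ (k div n, k mod n) = A $$ (k div n, k mod n) + B $$ (k div n, k mod n)" if "k < n * n" for k
      proof -
        have "n > 0" using that by (auto intro: gr0I)
        then show ?thesis using that \<open>B \<in> carrier_mat n n\<close> by (simp add: less_mult_imp_div_less)
      qed
      then have "(\<Sum>k<n * n. (A + B) $$ (k div n, k mod n) * x k) =
        (\<Sum>k<n * n. A $$ (k div n, k mod n) * x k + B $$ (k div n, k mod n) * x k)"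
        by (intro sum.cong) (auto simp: distrib_right)
      then show ?case using add.IH by (simp add: sum.distrib)
    next
      case (smult A c)
      have A: "A \<in> carrier_mat n n" using smult rep_span_carrier[OF _ \<phi>] by auto
      have "(c \<cdot>\<^sub>m A) $$ (k div n, k mod n) = c * A $$ (k div n, k mod n)" if "k < n * n" for k
      proof -
        have "n > 0" using that by (auto intro: gr0I)
        then show ?thesis using that A by (simp add: less_mult_imp_div_less)
      qed
      then have "(\<Sum>k<n * n. (c \<cdot>\<^sub>m A) $$ (k div n, k mod n) * x k) =
        c * (\<Sum>k<n * n. A $$ (k div n, k mod n) * x k)"
        unfolding sum_distrib_left by (intro sum.cong) auto
      then show ?case using smult.IH by simp
    qed
    obtain j where j: "j < n * n" "x j \<noteq> 0" using x(1) by blast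
    then have n0: "n > 0" by (auto intro: gr0I)
    obtain f where "nev n (s_mat \<phi>) (t_mat \<phi>) f = E_mat n (j div n) (j mod n)"
      using full E_mat_carrier unfolding full_def by blast
    then have "(\<Sum>k<n * n. E_mat n (j div n) (j mod n) $$ (k div n, k mod n) * x k) = 0"
      using zero[OF nev_in_rep_span[OF \<phi>]] by metis
    moreover have "E_mat n (j div n) (j mod n) $$ (k div n, k mod n) * x k = (if k = j then x k else 0)"
      if "k < n * n" for k
    proof -
      have "k div n = j div n \<and> k mod n = j mod n \<longleftrightarrow> k = j" by (metis div_mult_mod_eq)
      then show ?thesis using that n0 by (auto simp: E_mat_def less_mult_imp_div_less)
    qed
    ultimately show False using j by simp
  qed
  with det_or_annihilator[of "n * n" V] obtain r where
    r: "\<forall>i<n * n. r i \<in> V" "det (mat (n * n) (n * n) (\<lambda>(i, j). r i j)) \<noteq> 0" by blast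
  \<comment> \<open>Indices from n * n on receive the neutral element as a default, because
    \<open>gs\<close> is a total function into the group.\<close>
  have "\<exists>g. g \<in> carrier ModGrp \<and> (i < n * n \<longrightarrow> r i = (\<lambda>k. \<phi> g $$ (k div n, k mod n)))" for i
    using r(1) one_closed by (cases "i < n * n") (auto simp: V_def)
  then obtain gs where gs: "\<And>i. gs i \<in> carrier ModGrp"
    "\<And>i. i < n * n \<Longrightarrow> r i = (\<lambda>k. \<phi> (gs i) $$ (k div n, k mod n))" by metis
  define B C where "B = mat (n * n) (n * n) (\<lambda>(i, k). \<phi> (gs i) $$ (k div n, k mod n))"
    and "C = mat (n * n) (n * n) (\<lambda>(k, j). \<phi> (gs j) $$ (k mod n, k div n))"
  have car: "B \<in> carrier_mat (n * n) (n * n)" "C \<in> carrier_mat (n * n) (n * n)" by (simp_all add: B_def C_def)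
  have "mat (n * n) (n * n) (\<lambda>(i, j). r i j) = B" by (rule eq_matI) (auto simp: B_def gs(2))
  with r have detB: "det B \<noteq> 0" by simp
  \<comment> \<open>C is the transpose of B up to the permutation of rows that interchanges the
    matrix positions (a, b) and (b, a).\<close>
  have "det C \<noteq> 0"
  proof
    assume "det C = 0"
    then obtain v where v: "v \<in> carrier_vec (n * n)" "v \<noteq> 0\<^sub>v (n * n)" "C *\<^sub>v v = 0\<^sub>v (n * n)"
      using det_0_iff_vec_prod_zero[OF car(2)] by blast
    have "B\<^sup>T *\<^sub>v v = 0\<^sub>v (n * n)"
    proof (rule eq_vecI)
      fix k assume "k < dim_vec (0\<^sub>v (n * n) :: complex vec)"
      then have k: "k < n * n" by simp
      then have n0: "n > 0" by (auto intro: gr0I)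
      have lt: "k div n < n" "k mod n < n" using k n0 by (auto simp: less_mult_imp_div_less)
      define k' where "k' = (k mod n) * n + k div n"
      have k': "k' < n * n" "k' mod n = k div n" "k' div n = k mod n" using idx[OF lt(2,1)] by (simp_all add: k'_def)
      have "(B\<^sup>T *\<^sub>v v) $ k = (C *\<^sub>v v) $ k'"
        using k k' v(1) by (simp add: B_def C_def scalar_prod_def)
      then show "(B\<^sup>T *\<^sub>v v) $ k = 0\<^sub>v (n * n) $ k" using v(3) k k' by simp
    qed (use car in auto)
    then have "det B\<^sup>T = 0" using det_0_iff_vec_prod_zero[of "B\<^sup>T" "n * n"] car v by auto
    then show False using detB det_transpose[OF car(1)] by simp
  qed
  then have "gram n gs \<phi> \<noteq> 0"
    unfolding gram_def gram_factor using detB car by (simp add: det_mult[of _ "n * n"] flip: B_def C_def)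
  with gs(1) show ?thesis using that by blast
qed


subsection \<open>Rational families of representations\<close>

text \<open>Fractions whose denominator is a power of d; values at zeros of d are unconstrained.
  Fixing d in advance makes sums and products share a domain of definition.\<close>

definition ratfun :: "complex poly \<Rightarrow> (complex \<Rightarrow> complex) \<Rightarrow> bool" where
  "ratfun d f \<longleftrightarrow> (\<exists>N p. \<forall>\<tau>. poly d \<tau> \<noteq> 0 \<longrightarrow> poly d \<tau> ^ N * f \<tau> = poly p \<tau>)"

lemma ratfun_poly: "ratfun d (poly p)"
  unfolding ratfun_def by (rule exI[of _ 0]) auto

lemma ratfun_const: "ratfun d (\<lambda>_. c)"
  unfolding ratfun_def by (rule exI[of _ 0], rule exI[of _ "[:c:]"]) simp

lemma ratfun_cong: "ratfun d f \<Longrightarrow> (\<And>\<tau>. poly d \<tau> \<noteq> 0 \<Longrightarrow> g \<tau> = f \<tau>) \<Longrightarrow> ratfun d g"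
  unfolding ratfun_def by metis

lemma ratfun_add:
  assumes "ratfun d f" "ratfun d g" shows "ratfun d (\<lambda>\<tau>. f \<tau> + g \<tau>)"
proof -
  obtain N p M q where
    p: "\<And>\<tau>. poly d \<tau> \<noteq> 0 \<Longrightarrow> poly d \<tau> ^ N * f \<tau> = poly p \<tau>" and
    q: "\<And>\<tau>. poly d \<tau> \<noteq> 0 \<Longrightarrow> poly d \<tau> ^ M * g \<tau> = poly q \<tau>"
    using assms unfolding ratfun_def by metis
  have "poly d \<tau> ^ (N + M) * (f \<tau> + g \<tau>) = poly (d ^ M * p + d ^ N * q) \<tau>" if "poly d \<tau> \<noteq> 0" for \<tau>
    unfolding poly_add poly_mult p[OF that, symmetric] q[OF that, symmetric]
    by (simp add: algebra_simps power_add)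
  then show ?thesis unfolding ratfun_def by blast
qed

lemma ratfun_mult:
  assumes "ratfun d f" "ratfun d g" shows "ratfun d (\<lambda>\<tau>. f \<tau> * g \<tau>)"
proof -
  obtain N p M q where
    p: "\<And>\<tau>. poly d \<tau> \<noteq> 0 \<Longrightarrow> poly d \<tau> ^ N * f \<tau> = poly p \<tau>" and
    q: "\<And>\<tau>. poly d \<tau> \<noteq> 0 \<Longrightarrow> poly d \<tau> ^ M * g \<tau> = poly q \<tau>"
    using assms unfolding ratfun_def by metis
  have "poly d \<tau> ^ (N + M) * (f \<tau> * g \<tau>) = poly (p * q) \<tau>" if "poly d \<tau> \<noteq> 0" for \<tau>
    unfolding poly_mult p[OF that, symmetric] q[OF that, symmetric]
    by (simp add: algebra_simps power_add)
  then show ?thesis unfolding ratfun_def by blast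
qed

lemma ratfun_sum: "finite I \<Longrightarrow> (\<And>i. i \<in> I \<Longrightarrow> ratfun d (f i)) \<Longrightarrow> ratfun d (\<lambda>\<tau>. \<Sum>i\<in>I. f i \<tau>)"
  by (induction I rule: finite_induct) (auto intro: ratfun_const ratfun_add)

definition ratmat :: "complex poly \<Rightarrow> nat \<Rightarrow> (complex \<Rightarrow> complex mat) \<Rightarrow> bool" where
  "ratmat d n M \<longleftrightarrow> (\<forall>\<tau>. poly d \<tau> \<noteq> 0 \<longrightarrow> M \<tau> \<in> carrier_mat n n) \<and>
     (\<forall>i<n. \<forall>j<n. ratfun d (\<lambda>\<tau>. M \<tau> $$ (i, j)))"

lemma ratmat_mult:
  assumes "ratmat d n M" "ratmat d n N"
  shows "ratmat d n (\<lambda>\<tau>. M \<tau> * N \<tau>)"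
proof -
  have "ratfun d (\<lambda>\<tau>. (M \<tau> * N \<tau>) $$ (i, j))" if "i < n" "j < n" for i j
  proof (rule ratfun_cong)
    show "ratfun d (\<lambda>\<tau>. \<Sum>k = 0..<n. M \<tau> $$ (i, k) * N \<tau> $$ (k, j))"
      using assms that by (intro ratfun_sum ratfun_mult) (auto simp: ratmat_def)
    show "(M \<tau> * N \<tau>) $$ (i, j) = (\<Sum>k = 0..<n. M \<tau> $$ (i, k) * N \<tau> $$ (k, j))" if "poly d \<tau> \<noteq> 0" for \<tau>
    proof -
      have "M \<tau> \<in> carrier_mat n n" "N \<tau> \<in> carrier_mat n n" using assms that by (auto simp: ratmat_def)
      then show ?thesis using \<open>i < n\<close> \<open>j < n\<close> by (auto simp: scalar_prod_def)
    qed
  qed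
  moreover have "M \<tau> * N \<tau> \<in> carrier_mat n n" if "poly d \<tau> \<noteq> 0" for \<tau>
    using assms that by (intro mult_carrier_mat[of _ n n]) (auto simp: ratmat_def)
  ultimately show ?thesis by (simp add: ratmat_def)
qed

lemma ratmat_const: "A \<in> carrier_mat n n \<Longrightarrow> ratmat d n (\<lambda>_. A)"
  by (simp add: ratmat_def ratfun_const)

lemma ratmat_cong: "ratmat d n M \<Longrightarrow> (\<And>\<tau>. poly d \<tau> \<noteq> 0 \<Longrightarrow> N \<tau> = M \<tau>) \<Longrightarrow> ratmat d n N"
  unfolding ratmat_def using ratfun_cong[of d "\<lambda>\<tau>. M \<tau> $$ (i, j)" "\<lambda>\<tau>. N \<tau> $$ (i, j)" for i j] by simp

lemma ratmat_dvd:
  assumes "ratmat d n M" "d dvd e" shows "ratmat e n M"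
proof -
  obtain c where e: "e = d * c" using assms(2) by (rule dvdE)
  have "ratfun e f" if f: "ratfun d f" for f
  proof -
    obtain N p where p: "\<And>\<tau>. poly d \<tau> \<noteq> 0 \<Longrightarrow> poly d \<tau> ^ N * f \<tau> = poly p \<tau>"
      using f unfolding ratfun_def by metis
    have "poly e \<tau> ^ N * f \<tau> = poly (c ^ N * p) \<tau>" if "poly e \<tau> \<noteq> 0" for \<tau>
      using that p[of \<tau>] by (auto simp: e power_mult_distrib)
    then show ?thesis unfolding ratfun_def by blast
  qed
  then show ?thesis using assms(1) unfolding ratmat_def e by auto
qed

text \<open>The straight segment from the identity to R is invertible away from the zeros of its
  determinant d, which is nonzero at both ends; the inverse is the adjugate divided by d.\<close>

lemma invertible_path:
  assumes R: "R \<in> carrier (GL n)"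
  obtains d P Q where "poly d 0 \<noteq> 0" "poly d 1 \<noteq> 0" "ratmat d n P" "ratmat d n Q"
    "\<And>\<tau>. poly d \<tau> \<noteq> 0 \<Longrightarrow> P \<tau> * Q \<tau> = 1\<^sub>m n" "\<And>\<tau>. poly d \<tau> \<noteq> 0 \<Longrightarrow> Q \<tau> * P \<tau> = 1\<^sub>m n"
    "P 0 = 1\<^sub>m n" "P 1 = R"
proof -
  have Rm: "R \<in> carrier_mat n n" using R by (rule GL_mat)
  define X where "X = mat n n (\<lambda>(i, j). [:if i = j then 1 else 0, R $$ (i, j) - (if i = j then 1 else 0):])"
  have X: "X \<in> carrier_mat n n" by (simp add: X_def)
  define ev where "ev \<tau> = map_mat (\<lambda>p. poly p \<tau>)" for \<tau> :: complex
  have hom: "comm_ring_hom (\<lambda>p. poly p \<tau>)" for \<tau> :: complex by unfold_locales auto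
  define d where "d = det X"
  have ev_det: "det (ev \<tau> X) = poly d \<tau>" for \<tau>
    unfolding ev_def d_def by (rule comm_ring_hom.hom_det[OF hom])
  define Q where "Q \<tau> = (1 / poly d \<tau>) \<cdot>\<^sub>m ev \<tau> (adj_mat X)" for \<tau>
  note adj = adj_mat[OF X, folded d_def]
  have ev_mult: "ev \<tau> (A * B) = ev \<tau> A * ev \<tau> B" if "A \<in> carrier_mat n n" "B \<in> carrier_mat n n" for A B \<tau>
    unfolding ev_def using that
    by (intro semiring_hom.mat_hom_mult[of _ A n n B n]) (auto intro!: comm_ring_hom.axioms hom simp: semiring_hom_def; unfold_locales; auto)
  have one: "ev \<tau> (d \<cdot>\<^sub>m 1\<^sub>m n) = poly d \<tau> \<cdot>\<^sub>m 1\<^sub>m n" for \<tau> by (auto simp: ev_def)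
  have car: "ev \<tau> X \<in> carrier_mat n n" "ev \<tau> (adj_mat X) \<in> carrier_mat n n" for \<tau>
    using X adj by (auto simp: ev_def)
  have scale: "(1 / c) \<cdot>\<^sub>m (c \<cdot>\<^sub>m 1\<^sub>m n) = 1\<^sub>m n" if "c \<noteq> 0" for c :: complex using that by auto
  have "ev \<tau> X * Q \<tau> = 1\<^sub>m n" "Q \<tau> * ev \<tau> X = 1\<^sub>m n" if "poly d \<tau> \<noteq> 0" for \<tau>
  proof -
    have "ev \<tau> X * Q \<tau> = (1 / poly d \<tau>) \<cdot>\<^sub>m ev \<tau> (X * adj_mat X)"
      unfolding Q_def using car X adj(1) by (simp add: mult_smult_distrib[of _ n n _ n] ev_mult)
    then show "ev \<tau> X * Q \<tau> = 1\<^sub>m n" using that adj by (simp add: one scale)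
    have "Q \<tau> * ev \<tau> X = (1 / poly d \<tau>) \<cdot>\<^sub>m ev \<tau> (adj_mat X * X)"
      unfolding Q_def using car X adj(1) by (simp add: mult_smult_assoc_mat[of _ n n _ n] ev_mult)
    then show "Q \<tau> * ev \<tau> X = 1\<^sub>m n" using that adj by (simp add: one scale)
  qed
  moreover have P01: "ev 0 X = 1\<^sub>m n" "ev 1 X = R" using Rm by (auto simp: ev_def X_def)
  moreover have "poly d 0 \<noteq> 0" using ev_det[of 0] P01 by simp
  moreover have "poly d 1 \<noteq> 0"
  proof -
    obtain R' where "R' \<in> carrier_mat n n" "R * R' = 1\<^sub>m n" using R by (auto simp: carrier_GL)
    then have "det R * det R' = 1" using det_mult[OF Rm, of R'] by simp
    then show ?thesis using ev_det[of 1] P01 by auto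
  qed
  moreover have "ratmat d n (\<lambda>\<tau>. ev \<tau> X)"
    unfolding ratmat_def using car X by (auto simp: ev_def ratfun_poly)
  moreover have "ratmat d n Q"
  proof -
    have "ratfun d (\<lambda>\<tau>. Q \<tau> $$ (i, j))" if "i < n" "j < n" for i j
      unfolding ratfun_def
    proof (rule exI[of _ 1], rule exI[of _ "adj_mat X $$ (i, j)"], intro allI impI)
      fix \<tau> assume "poly d \<tau> \<noteq> 0"
      then show "poly d \<tau> ^ 1 * Q \<tau> $$ (i, j) = poly (adj_mat X $$ (i, j)) \<tau>"
        using that adj(1) by (simp add: Q_def ev_def)
    qed
    then show ?thesis using car by (auto simp: ratmat_def Q_def)
  qed
  ultimately show ?thesis using that[of d "\<lambda>\<tau>. ev \<tau> X" Q] by blast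
qed

lemma conjugate_relations:
  fixes P Q A B :: "complex mat"
  assumes "P * Q = 1\<^sub>m n" "Q * P = 1\<^sub>m n" "P \<in> carrier_mat n n" "Q \<in> carrier_mat n n"
    "A \<in> carrier_mat n n" "B \<in> carrier_mat n n"
  shows "(P * A * Q) * (P * B * Q) = P * (A * B) * Q"
proof -
  note assoc = assoc_mult_mat[of _ n n _ n _ n] mult_carrier_mat[of _ n n _ n]
  have "(P * A * Q) * (P * B * Q) = P * A * (Q * P) * (B * Q)" using assms(3-) by (simp add: assoc)
  also have "\<dots> = P * (A * B) * Q" unfolding assms(2) using assms(3-) by (simp add: assoc left_mult_one_mat[of _ n n])
  finally show ?thesis .
qed

text \<open>No relation of the free product involves both s and t, so each may be conjugated along
  its own segment. This keeps the relations and both spectra, and the product of the two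
  determinants serves as common denominator.\<close>

lemma rational_family:
  assumes \<phi>0: "\<phi>0 \<in> reps n ModGrp" and \<phi>1: "\<phi>1 \<in> reps n ModGrp"
    and R: "R \<in> carrier (GL n)" "s_mat \<phi>1 * R = R * s_mat \<phi>0"
    and R': "R' \<in> carrier (GL n)" "t_mat \<phi>1 * R' = R' * t_mat \<phi>0"
  obtains d \<Phi> where "poly d 0 \<noteq> 0" "poly d 1 \<noteq> 0"
    "\<And>\<tau>. poly d \<tau> \<noteq> 0 \<Longrightarrow> \<Phi> \<tau> \<in> reps n ModGrp"
    "\<And>\<tau>. poly d \<tau> \<noteq> 0 \<Longrightarrow> char_poly (s_mat (\<Phi> \<tau>)) = char_poly (s_mat \<phi>0)"
    "\<And>\<tau>. poly d \<tau> \<noteq> 0 \<Longrightarrow> char_poly (t_mat (\<Phi> \<tau>)) = char_poly (t_mat \<phi>0)"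
    "s_mat (\<Phi> 0) = s_mat \<phi>0" "t_mat (\<Phi> 0) = t_mat \<phi>0"
    "s_mat (\<Phi> 1) = s_mat \<phi>1" "t_mat (\<Phi> 1) = t_mat \<phi>1"
    "\<And>g. g \<in> carrier ModGrp \<Longrightarrow> ratmat d n (\<lambda>\<tau>. \<Phi> \<tau> g)"
proof -
  note rel0 = mod_rep_relations[OF \<phi>0] and rel1 = mod_rep_relations[OF \<phi>1]
  obtain d1 P Q where P: "poly d1 0 \<noteq> 0" "poly d1 1 \<noteq> 0" "ratmat d1 n P" "ratmat d1 n Q"
    "\<And>\<tau>. poly d1 \<tau> \<noteq> 0 \<Longrightarrow> P \<tau> * Q \<tau> = 1\<^sub>m n" "\<And>\<tau>. poly d1 \<tau> \<noteq> 0 \<Longrightarrow> Q \<tau> * P \<tau> = 1\<^sub>m n"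
    "P 0 = 1\<^sub>m n" "P 1 = R" using invertible_path[OF R(1)] by metis
  obtain d2 P' Q' where P': "poly d2 0 \<noteq> 0" "poly d2 1 \<noteq> 0" "ratmat d2 n P'" "ratmat d2 n Q'"
    "\<And>\<tau>. poly d2 \<tau> \<noteq> 0 \<Longrightarrow> P' \<tau> * Q' \<tau> = 1\<^sub>m n" "\<And>\<tau>. poly d2 \<tau> \<noteq> 0 \<Longrightarrow> Q' \<tau> * P' \<tau> = 1\<^sub>m n"
    "P' 0 = 1\<^sub>m n" "P' 1 = R'" using invertible_path[OF R'(1)] by metis
  define d where "d = d1 * d2"
  have d_ne: "poly d1 \<tau> \<noteq> 0" "poly d2 \<tau> \<noteq> 0" if "poly d \<tau> \<noteq> 0" for \<tau> using that by (auto simp: d_def)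
  have rat: "ratmat d n P" "ratmat d n Q" "ratmat d n P'" "ratmat d n Q'"
    using P(3,4) P'(3,4) by (auto intro: ratmat_dvd simp: d_def)
  then have car: "P \<tau> \<in> carrier_mat n n" "Q \<tau> \<in> carrier_mat n n" "P' \<tau> \<in> carrier_mat n n" "Q' \<tau> \<in> carrier_mat n n"
    if "poly d \<tau> \<noteq> 0" for \<tau> using that by (auto simp: ratmat_def)
  define Sf where "Sf \<tau> = P \<tau> * s_mat \<phi>0 * Q \<tau>" for \<tau>
  define Tf where "Tf \<tau> = P' \<tau> * t_mat \<phi>0 * Q' \<tau>" for \<tau>
  note mm = mult_carrier_mat[of _ n n _ n]
  have SfTf: "Sf \<tau> \<in> carrier_mat n n" "Tf \<tau> \<in> carrier_mat n n" "Sf \<tau> * Sf \<tau> = 1\<^sub>m n" "Tf \<tau> * (Tf \<tau> * Tf \<tau>) = 1\<^sub>m n"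
    if "poly d \<tau> \<noteq> 0" for \<tau>
  proof -
    note c = car[OF that] and e = d_ne[OF that]
    show "Sf \<tau> \<in> carrier_mat n n" "Tf \<tau> \<in> carrier_mat n n" using c rel0 by (auto simp: Sf_def Tf_def intro!: mm)
    have "Sf \<tau> * Sf \<tau> = P \<tau> * (s_mat \<phi>0 * s_mat \<phi>0) * Q \<tau>"
      unfolding Sf_def by (rule conjugate_relations[OF P(5)[OF e(1)] P(6)[OF e(1)] c(1,2) rel0(3,3)])
    then show "Sf \<tau> * Sf \<tau> = 1\<^sub>m n" using rel0 c P(5)[OF e(1)] by simp
    note conj = conjugate_relations[OF P'(5)[OF e(2)] P'(6)[OF e(2)] c(3,4) rel0(4)]
    have "Tf \<tau> * (Tf \<tau> * Tf \<tau>) = P' \<tau> * (t_mat \<phi>0 * (t_mat \<phi>0 * t_mat \<phi>0)) * Q' \<tau>"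
      unfolding Tf_def conj[OF rel0(4)] by (rule conj) (use rel0 in \<open>auto intro: mm\<close>)
    then show "Tf \<tau> * (Tf \<tau> * Tf \<tau>) = 1\<^sub>m n" using rel0 c P'(5)[OF e(2)] by simp
  qed
  have "\<exists>\<phi>. poly d \<tau> \<noteq> 0 \<longrightarrow> \<phi> \<in> reps n ModGrp \<and> s_mat \<phi> = Sf \<tau> \<and> t_mat \<phi> = Tf \<tau>" for \<tau>
    using mod_rep_exists[OF SfTf] by metis
  then obtain \<Phi> where \<Phi>: "\<And>\<tau>. poly d \<tau> \<noteq> 0 \<Longrightarrow> \<Phi> \<tau> \<in> reps n ModGrp"
    "\<And>\<tau>. poly d \<tau> \<noteq> 0 \<Longrightarrow> s_mat (\<Phi> \<tau>) = Sf \<tau>" "\<And>\<tau>. poly d \<tau> \<noteq> 0 \<Longrightarrow> t_mat (\<Phi> \<tau>) = Tf \<tau>"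
    by metis
  have d01: "poly d 0 \<noteq> 0" "poly d 1 \<noteq> 0" using P P' by (auto simp: d_def)
  have sim: "char_poly (p * A * q) = char_poly A"
    if "p * q = 1\<^sub>m n" "q * p = 1\<^sub>m n" "p \<in> carrier_mat n n" "q \<in> carrier_mat n n" "A \<in> carrier_mat n n"
    for p q A :: "complex mat"
    using that by (intro char_poly_similar similar_matI[of _ _ p q n]) (auto intro!: mm)
  have id: "p * A * q = A" if "p = 1\<^sub>m n" "p * q = 1\<^sub>m n" "q \<in> carrier_mat n n" "A \<in> carrier_mat n n"
    for p q A :: "complex mat" using that by simp
  have ends: "p * A * q = B" if "p * q = 1\<^sub>m n" "B * p = p * A" "p \<in> carrier_mat n n" "q \<in> carrier_mat n n"
    "A \<in> carrier_mat n n" "B \<in> carrier_mat n n" for p q A B :: "complex mat"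
    using assoc_mult_mat[OF that(6,3,4)] that by simp
  have rS: "ratmat d n Sf" "ratmat d n Tf"
    unfolding Sf_def[abs_def] Tf_def[abs_def] using rat rel0 by (auto intro!: ratmat_mult ratmat_const)
  have word: "ratmat d n (\<lambda>\<tau>. \<Phi> \<tau> (word_class mod_rels w))" for w
  proof (induction w)
    case Nil
    show ?case by (rule ratmat_cong[OF ratmat_const[of "1\<^sub>m n"]]) (auto simp: rep_weval[OF \<Phi>(1)])
  next
    case (Cons l w)
    obtain g e where l: "l = (g, e)" by force
    \<comment> \<open>Inverses cost no new denominators: s is its own inverse and t has the inverse
      t^2.\<close>
    define L where "L \<tau> = (if g = M_s then Sf \<tau> else if e then Tf \<tau> else Tf \<tau> * Tf \<tau>)" for \<tau>
    have "ratmat d n L" unfolding L_def[abs_def] using rS by (cases "g = M_s"; cases e) (auto intro: ratmat_mult)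
    then have "ratmat d n (\<lambda>\<tau>. L \<tau> * \<Phi> \<tau> (word_class mod_rels w))" using Cons by (rule ratmat_mult)
    then show ?case
    proof (rule ratmat_cong)
      fix \<tau> assume \<tau>: "poly d \<tau> \<noteq> 0"
      note st = SfTf[OF \<tau>]
      have "inv\<^bsub>GL n\<^esub> Sf \<tau> = Sf \<tau>" using st by (intro GL_inv_eqI) auto
      moreover have "inv\<^bsub>GL n\<^esub> Tf \<tau> = Tf \<tau> * Tf \<tau>"
        using st by (intro GL_inv_eqI) (auto intro: mm simp: assoc_mult_mat[of _ n n _ n _ n])
      ultimately show "\<Phi> \<tau> (word_class mod_rels (l # w)) = L \<tau> * \<Phi> \<tau> (word_class mod_rels w)"
        unfolding rep_weval[OF \<Phi>(1)[OF \<tau>]] l by (cases g; cases e) (simp_all add: L_def \<Phi> \<tau>)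
    qed
  qed
  show ?thesis
  proof (rule that[OF d01 \<Phi>(1)])
    fix \<tau> assume \<tau>: "poly d \<tau> \<noteq> 0"
    show "char_poly (s_mat (\<Phi> \<tau>)) = char_poly (s_mat \<phi>0)"
      unfolding \<Phi>(2)[OF \<tau>] Sf_def using P d_ne[OF \<tau>] car[OF \<tau>] rel0 by (intro sim) auto
    show "char_poly (t_mat (\<Phi> \<tau>)) = char_poly (t_mat \<phi>0)"
      unfolding \<Phi>(3)[OF \<tau>] Tf_def using P' d_ne[OF \<tau>] car[OF \<tau>] rel0 by (intro sim) auto
  next
    show "s_mat (\<Phi> 0) = s_mat \<phi>0" unfolding \<Phi>(2)[OF d01(1)] Sf_def
      by (rule id[OF P(7) P(5)[OF d_ne(1)[OF d01(1)]] car(2)[OF d01(1)] rel0(3)])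
    show "t_mat (\<Phi> 0) = t_mat \<phi>0" unfolding \<Phi>(3)[OF d01(1)] Tf_def
      by (rule id[OF P'(7) P'(5)[OF d_ne(2)[OF d01(1)]] car(4)[OF d01(1)] rel0(4)])
    show "s_mat (\<Phi> 1) = s_mat \<phi>1" unfolding \<Phi>(2)[OF d01(2)] Sf_def
      by (rule ends[OF P(5)[OF d_ne(1)[OF d01(2)]] R(2)[folded P(8)] car(1)[OF d01(2)] car(2)[OF d01(2)] rel0(3) rel1(3)])
    show "t_mat (\<Phi> 1) = t_mat \<phi>1" unfolding \<Phi>(3)[OF d01(2)] Tf_def
      by (rule ends[OF P'(5)[OF d_ne(2)[OF d01(2)]] R'(2)[folded P'(8)] car(3)[OF d01(2)] car(4)[OF d01(2)] rel0(4) rel1(4)])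
  next
    fix g assume "g \<in> carrier ModGrp"
    then show "ratmat d n (\<lambda>\<tau>. \<Phi> \<tau> g)" using word by (auto elim!: presented_group_carrierE)
  qed
qed

lemma regular_function_ratfun:
  assumes "\<And>g. g \<in> carrier G \<Longrightarrow> ratmat d n (\<lambda>\<tau>. \<Phi> \<tau> g)"
  shows "h \<in> regular_functions n G \<Longrightarrow> ratfun d (\<lambda>\<tau>. h (\<Phi> \<tau>))"
proof (induction rule: regular_functions.induct)
  case (coefficient g i j)
  then show ?case using assms by (auto simp: ratmat_def)
qed (auto intro: ratfun_const ratfun_add ratfun_mult)

text \<open>In other words, the representations of a given type form an irreducible variety.\<close>

lemma invariants_common_nonzero:
  assumes \<phi>0: "\<phi>0 \<in> reps n ModGrp" and \<phi>1: "\<phi>1 \<in> reps n ModGrp"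
    and R: "R \<in> carrier (GL n)" "s_mat \<phi>1 * R = R * s_mat \<phi>0"
    and R': "R' \<in> carrier (GL n)" "t_mat \<phi>1 * R' = R' * t_mat \<phi>0"
    and f: "f \<in> invariant_functions n ModGrp" "f \<phi>0 \<noteq> 0"
    and h: "h \<in> invariant_functions n ModGrp" "h \<phi>1 \<noteq> 0"
  obtains \<phi> where "\<phi> \<in> reps n ModGrp" "f \<phi> \<noteq> 0" "h \<phi> \<noteq> 0"
    "char_poly (s_mat \<phi>) = char_poly (s_mat \<phi>0)" "char_poly (t_mat \<phi>) = char_poly (t_mat \<phi>0)"
proof -
  obtain d \<Phi> where d: "poly d 0 \<noteq> 0" "poly d 1 \<noteq> 0"
    and \<Phi>: "\<And>\<tau>. poly d \<tau> \<noteq> 0 \<Longrightarrow> \<Phi> \<tau> \<in> reps n ModGrp"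
    "\<And>\<tau>. poly d \<tau> \<noteq> 0 \<Longrightarrow> char_poly (s_mat (\<Phi> \<tau>)) = char_poly (s_mat \<phi>0)"
    "\<And>\<tau>. poly d \<tau> \<noteq> 0 \<Longrightarrow> char_poly (t_mat (\<Phi> \<tau>)) = char_poly (t_mat \<phi>0)"
    and ends: "s_mat (\<Phi> 0) = s_mat \<phi>0" "t_mat (\<Phi> 0) = t_mat \<phi>0"
    "s_mat (\<Phi> 1) = s_mat \<phi>1" "t_mat (\<Phi> 1) = t_mat \<phi>1"
    and rat: "\<And>g. g \<in> carrier ModGrp \<Longrightarrow> ratmat d n (\<lambda>\<tau>. \<Phi> \<tau> g)"
    using rational_family[OF \<phi>0 \<phi>1 R R'] by metis
  \<comment> \<open>The endpoints of the family agree with the given representations only on the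
    generators, hence on the carrier; invariance under the isomorphism given by the identity matrix
    transfers the values.\<close>
  have same: "k \<psi> = k \<psi>'" if k: "k \<in> invariant_functions n ModGrp" and \<psi>: "\<psi> \<in> reps n ModGrp" "\<psi>' \<in> reps n ModGrp"
    and st: "s_mat \<psi> = s_mat \<psi>'" "t_mat \<psi> = t_mat \<psi>'" for k \<psi> \<psi>'
  proof -
    have gens: "\<psi> (gen mod_rels g) = \<psi>' (gen mod_rels g)" for g using st by (cases g) auto
    have "\<forall>g\<in>carrier ModGrp. 1\<^sub>m n * \<psi> g = \<psi>' g * 1\<^sub>m n"
    proof
      fix g assume g: "g \<in> carrier ModGrp"
      show "1\<^sub>m n * \<psi> g = \<psi>' g * 1\<^sub>m n"
        using rep_eqI[OF \<psi> gens g] rep_mat[OF \<psi>(1) g] rep_mat[OF \<psi>(2) g] by simp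
    qed
    moreover have "1\<^sub>m n \<in> carrier (GL n)" by (rule GL_I[of _ _ "1\<^sub>m n"]) auto
    ultimately have "rep_iso n ModGrp \<psi> \<psi>'" unfolding rep_iso_def ..
    then show ?thesis using k \<psi> by (simp add: invariant_functions_def)
  qed
  have nz: "f (\<Phi> 0) \<noteq> 0" "h (\<Phi> 1) \<noteq> 0"
    using same[OF f(1) \<Phi>(1)[OF d(1)] \<phi>0 ends(1,2)] same[OF h(1) \<Phi>(1)[OF d(2)] \<phi>1 ends(3,4)] f h by auto
  have "ratfun d (\<lambda>\<tau>. f (\<Phi> \<tau>))" "ratfun d (\<lambda>\<tau>. h (\<Phi> \<tau>))"
    using f(1) h(1) regular_function_ratfun[OF rat] by (auto simp: invariant_functions_def)
  then obtain N p M q where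
    p: "\<And>\<tau>. poly d \<tau> \<noteq> 0 \<Longrightarrow> poly d \<tau> ^ N * f (\<Phi> \<tau>) = poly p \<tau>" and
    q: "\<And>\<tau>. poly d \<tau> \<noteq> 0 \<Longrightarrow> poly d \<tau> ^ M * h (\<Phi> \<tau>) = poly q \<tau>"
    unfolding ratfun_def by metis
  \<comment> \<open>f is known to be nonzero at one end of the curve and h at the other; their
    numerators are thus nonzero polynomials and have a common point of non-vanishing.\<close>
  have "poly p 0 \<noteq> 0" "poly q 1 \<noteq> 0" using p[OF d(1)] q[OF d(2)] nz d by (auto simp flip: p q)
  then have "d * p * q \<noteq> 0" using d by auto
  then obtain \<tau> where "poly (d * p * q) \<tau> \<noteq> 0" using poly_all_0_iff_0 by blast
  then have \<tau>: "poly d \<tau> \<noteq> 0" "poly p \<tau> \<noteq> 0" "poly q \<tau> \<noteq> 0" by auto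
  then have "f (\<Phi> \<tau>) \<noteq> 0" "h (\<Phi> \<tau>) \<noteq> 0" using p[OF \<tau>(1)] q[OF \<tau>(1)] by auto
  then show ?thesis using that \<Phi> \<tau> by blast
qed


subsection \<open>Eigenvalue multiplicities and isomorphism\<close>

lemma order_char_poly_diagonalized:
  fixes A :: "complex mat"
  assumes "A \<in> carrier_mat n n" "P \<in> carrier (GL n)" "A * P = P * mat_diag n D"
  shows "eigmult a A = card {i. i < n \<and> D i = a}"
  using char_poly_similar[OF GL_similar[OF assms(2,3,1)]] by (simp add: order_char_poly_diag)

text \<open>One diagonalisation serves T, its square and its multiples, so that their multiplicities
  can be compared index by index.\<close>

lemma order_char_poly_map:
  fixes T :: "complex mat"
  assumes T: "T \<in> carrier_mat n n" "T * (T * T) = 1\<^sub>m n"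
  obtains P D where "P \<in> carrier (GL n)" "T * P = P * mat_diag n D" "\<And>i. i < n \<Longrightarrow> D i ^ 3 = 1"
    "\<And>a. eigmult a T = card {i. i < n \<and> D i = a}"
    "\<And>a. eigmult a (T * T) = card {i. i < n \<and> D i * D i = a}"
    "\<And>a c. eigmult a (c \<cdot>\<^sub>m T) = card {i. i < n \<and> c * D i = a}"
proof -
  have pow: "T ^\<^sub>m 3 = 1\<^sub>m n" using T by (simp add: pow_2_3)
  obtain P D where P: "P \<in> carrier (GL n)" "T * P = P * mat_diag n D" "\<And>i. i < n \<Longrightarrow> D i ^ 3 = 1"
    "\<And>a. eigmult a T = card {i. i < n \<and> D i = a}"
    by (rule finite_order_diagonal[OF T(1) pow zero_less_numeral]) (rule that; assumption)
  have Pm: "P \<in> carrier_mat n n" using P(1) by (rule GL_mat)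
  note assoc = assoc_mult_mat[of _ n n _ n _ n] mult_carrier_mat[of _ n n _ n]
  have "(T * T) * P = T * (T * P)" using T(1) Pm by (simp add: assoc)
  also have "\<dots> = T * (P * mat_diag n D)" by (simp only: P(2))
  also have "\<dots> = (T * P) * mat_diag n D" by (rule assoc(1)[symmetric]) (use T(1) Pm in auto)
  also have "\<dots> = P * mat_diag n (\<lambda>i. D i * D i)" unfolding P(2) using Pm by (simp add: assoc)
  finally have "eigmult a (T * T) = card {i. i < n \<and> D i * D i = a}" for a
    using T(1) P(1) by (intro order_char_poly_diagonalized) (auto intro: assoc)
  moreover have "eigmult a (c \<cdot>\<^sub>m T) = card {i. i < n \<and> c * D i = a}" for a c
  proof (rule order_char_poly_diagonalized)
    have "(c \<cdot>\<^sub>m T) * P = c \<cdot>\<^sub>m (P * mat_diag n D)"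
      using T(1) Pm by (simp add: mult_smult_assoc_mat[of _ n n _ n] P(2))
    also have "\<dots> = P * mat_diag n (\<lambda>i. c * D i)"
      unfolding mat_diag_mult_right[OF Pm] by (rule eq_matI) auto
    finally show "(c \<cdot>\<^sub>m T) * P = P * mat_diag n (\<lambda>i. c * D i)" .
  qed (use T P in auto)
  ultimately show ?thesis using that[of P D] P by blast
qed

lemma rep_iso_refl:
  assumes "\<phi> \<in> reps n G" shows "rep_iso n G \<phi> \<phi>"
proof -
  have "1\<^sub>m n \<in> carrier (GL n)" by (rule GL_I[of _ _ "1\<^sub>m n"]) auto
  moreover have "1\<^sub>m n * \<phi> g = \<phi> g * 1\<^sub>m n" if "g \<in> carrier G" for g using rep_mat[OF assms that] by simp
  ultimately show ?thesis unfolding rep_iso_def by blast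
qed

lemma iso_class_refl: "\<phi> \<in> reps n G \<Longrightarrow> \<phi> \<in> iso_class n G \<phi>"
  by (simp add: iso_class_def rep_iso_refl)

lemma has_dim_type_iso:
  assumes iso: "rep_iso n ModGrp \<phi> \<psi>" and \<phi>: "\<phi> \<in> reps n ModGrp" and \<psi>: "\<psi> \<in> reps n ModGrp"
    and type: "has_dim_type \<rho> \<alpha> \<phi>"
  shows "has_dim_type \<rho> \<alpha> \<psi>"
proof -
  obtain P Q where PQ: "P \<in> carrier_mat n n" "Q \<in> carrier_mat n n" "P * Q = 1\<^sub>m n" "Q * P = 1\<^sub>m n"
    "\<And>g. g \<in> carrier ModGrp \<Longrightarrow> \<psi> g = P * \<phi> g * Q"
    using rep_isoE[OF iso \<phi> \<psi>] by metis
  have "char_poly (\<psi> g) = char_poly (\<phi> g)" if "g \<in> carrier ModGrp" for g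
    using PQ(1-4) PQ(5)[OF that] rep_mat[OF \<phi> that] rep_mat[OF \<psi> that]
    by (intro char_poly_similar similar_matI[of _ _ P Q n]) auto
  then show ?thesis using type by (simp add: has_dim_type_def)
qed

text \<open>Every group element is reached from the neutral one by left multiplications with s and t
  alone, as their inverses are positive powers. Invariance of a subspace thus needs checking for two
  matrices only.\<close>

lemma mod_rep_induct:
  assumes \<phi>: "\<phi> \<in> reps n ModGrp" and g: "g \<in> carrier ModGrp"
    and one: "P (1\<^sub>m n)"
    and S: "\<And>X. X \<in> carrier_mat n n \<Longrightarrow> P X \<Longrightarrow> P (s_mat \<phi> * X)"
    and T: "\<And>X. X \<in> carrier_mat n n \<Longrightarrow> P X \<Longrightarrow> P (t_mat \<phi> * X)"
  shows "P (\<phi> g)"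
proof -
  note rel = mod_rep_relations[OF \<phi>]
  have inv: "inv\<^bsub>GL n\<^esub> s_mat \<phi> = s_mat \<phi>" using rel by (intro GL_inv_eqI) auto
  have inv': "inv\<^bsub>GL n\<^esub> t_mat \<phi> = t_mat \<phi> * t_mat \<phi>"
    using rel by (intro GL_inv_eqI) (auto intro: mult_carrier_mat[of _ n n] simp: assoc_mult_mat[of _ n n _ n _ n])
  have "P (\<phi> (word_class mod_rels w))" for w
  proof (induction w)
    case Nil
    then show ?case using one by (simp add: rep_weval[OF \<phi>])
  next
    case (Cons l w)
    obtain h e where l: "l = (h, e)" by force
    define X where "X = \<phi> (word_class mod_rels w)"
    have X: "X \<in> carrier_mat n n" "P X" using Cons rep_mat[OF \<phi>] by (simp_all add: X_def)
    have TX: "t_mat \<phi> * X \<in> carrier_mat n n" using rel(4) X(1) by (rule mult_carrier_mat)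
    have "\<phi> (word_class mod_rels (l # w)) =
      (case h of M_s \<Rightarrow> s_mat \<phi> * X | M_t \<Rightarrow> (if e then t_mat \<phi> * X else t_mat \<phi> * (t_mat \<phi> * X)))"
      unfolding X_def rep_weval[OF \<phi>] l using inv inv' X rel
      by (cases h; cases e) (simp_all add: X_def rep_weval[OF \<phi>] assoc_mult_mat[of _ n n _ n _ n])
    then show ?case using S[OF X] T[OF X] T[OF TX T[OF X]] by (cases h) auto
  qed
  then show ?thesis using g by (auto elim: presented_group_carrierE)
qed

subsection \<open>Diagonal representations are semisimple\<close>

text \<open>Steinitz exchange: a maximal set I of coordinates whose coordinate subspace meets W
  trivially gives a complement of W, and diagonal matrices preserve every coordinate
  subspace.\<close>

lemma diagonal_semisimple:
  assumes \<phi>: "\<phi> \<in> reps n ModGrp" and st: "s_mat \<phi> = mat_diag n D" "t_mat \<phi> = mat_diag n E"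
  shows "semisimple_rep n ModGrp \<phi>"
  unfolding semisimple_rep_def
proof (intro conjI allI impI \<phi>)
  fix W assume W: "invariant_subspace n ModGrp \<phi> W"
  note WD = invariant_subspaceD[OF W]
  define C where "C I = {v \<in> carrier_vec n. \<forall>i<n. i \<notin> I \<longrightarrow> v $ i = (0 :: complex)}" for I
  define \<F> where "\<F> = {I. I \<subseteq> {..<n} \<and> W \<inter> C I = {0\<^sub>v n}}"
  have C0: "0\<^sub>v n \<in> C I" and Cadd: "v \<in> C I \<Longrightarrow> w \<in> C I \<Longrightarrow> v + w \<in> C I" and Csmult: "v \<in> C I \<Longrightarrow> c \<cdot>\<^sub>v v \<in> C I"
    for I v w c by (auto simp: C_def)
  have "C {} = {0\<^sub>v n}" by (auto simp: C_def vec_eq_iff)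
  then have "{} \<in> \<F>" using WD(2) by (auto simp: \<F>_def)
  moreover have "finite \<F>" by (rule finite_subset[of _ "Pow {..<n}"]) (auto simp: \<F>_def)
  ultimately obtain I where I: "I \<in> \<F>" "\<And>J. J \<in> \<F> \<Longrightarrow> I \<subseteq> J \<Longrightarrow> I = J"
    using finite_has_maximal[of \<F>] by blast
  have WI: "W \<inter> C I = {0\<^sub>v n}" using I(1) by (simp add: \<F>_def)
  define U where "U = {w + w' |w w'. w \<in> W \<and> w' \<in> C I}"
  have U_I: "w \<in> W \<Longrightarrow> w' \<in> C I \<Longrightarrow> u = w + w' \<Longrightarrow> u \<in> U" for u w w' by (auto simp: U_def)
  have Wc: "w \<in> W \<Longrightarrow> w \<in> carrier_vec n" "w \<in> C I \<Longrightarrow> w \<in> carrier_vec n" for w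
    using WD(1) by (auto simp: C_def)
  have Uadd: "u + v \<in> U" if "u \<in> U" "v \<in> U" for u v
  proof -
    obtain a b where a: "a \<in> W" "b \<in> C I" "u = a + b" using \<open>u \<in> U\<close> by (auto simp: U_def)
    obtain c d where c: "c \<in> W" "d \<in> C I" "v = c + d" using \<open>v \<in> U\<close> by (auto simp: U_def)
    have "u + v = (a + c) + (b + d)" unfolding a c
      using Wc(1)[OF a(1)] Wc(2)[OF a(2)] Wc(1)[OF c(1)] Wc(2)[OF c(2)] by (auto intro!: eq_vecI)
    then show ?thesis using WD(3)[OF a(1) c(1)] Cadd[OF a(2) c(2)] by (intro U_I)
  qed
  have Usmult: "k \<cdot>\<^sub>v u \<in> U" if "u \<in> U" for u k
  proof -
    obtain a b where a: "a \<in> W" "b \<in> C I" "u = a + b" using \<open>u \<in> U\<close> by (auto simp: U_def)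
    have "k \<cdot>\<^sub>v u = k \<cdot>\<^sub>v a + k \<cdot>\<^sub>v b" unfolding a
      using Wc(1)[OF a(1)] Wc(2)[OF a(2)] by (simp add: smult_add_distrib_vec[of _ n])
    then show ?thesis using WD(4)[OF a(1)] Csmult[OF a(2)] by (intro U_I)
  qed
  have unit: "unit_vec n j \<in> U" if j: "j < n" for j
  proof (cases "j \<in> I")
    case True
    then have "unit_vec n j \<in> C I" by (auto simp: C_def unit_vec_def)
    then show ?thesis by (rule U_I[OF WD(2)]) simp
  next
    case False
    then have "insert j I \<notin> \<F>" using I(2) by blast
    moreover have "insert j I \<subseteq> {..<n}" using I(1) j by (auto simp: \<F>_def)
    ultimately have "W \<inter> C (insert j I) \<noteq> {0\<^sub>v n}" by (simp add: \<F>_def)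
    then obtain w where w: "w \<in> W" "w \<in> C (insert j I)" "w \<noteq> 0\<^sub>v n" using WD(2) C0 by blast
    have wj: "w $ j \<noteq> 0"
    proof
      assume "w $ j = 0"
      then have "w \<in> C I" using w(2) by (auto simp: C_def)
      then show False using WI w by auto
    qed
    define c where "c = 1 / w $ j"
    \<comment> \<open>Scaled to have coordinate j equal to 1, w differs from the unit vector only in
      coordinates from I.\<close>
    have "unit_vec n j - c \<cdot>\<^sub>v w \<in> C I" using w(2) wj j by (auto simp: C_def c_def unit_vec_def)
    moreover have "unit_vec n j = c \<cdot>\<^sub>v w + (unit_vec n j - c \<cdot>\<^sub>v w)" using Wc(1)[OF w(1)] by (auto intro!: eq_vecI)
    ultimately show ?thesis using WD(4)[OF w(1)] by (intro U_I)
  qed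
  have "v \<in> U" if v: "v \<in> carrier_vec n" for v
  proof -
    have "k \<le> n \<Longrightarrow> vec n (\<lambda>j. if j < k then v $ j else 0) \<in> U" for k
    proof (induction k)
      case 0
      show ?case by (rule U_I[OF WD(2) C0]) auto
    next
      case (Suc k)
      have "vec n (\<lambda>j. if j < Suc k then v $ j else 0) =
        vec n (\<lambda>j. if j < k then v $ j else 0) + v $ k \<cdot>\<^sub>v unit_vec n k"
        using Suc.prems by (intro eq_vecI) (auto simp: less_Suc_eq unit_vec_def)
      then show ?case using Suc Uadd Usmult unit by simp
    qed
    from this[of n] have "vec n (\<lambda>j. if j < n then v $ j else 0) \<in> U" by simp
    also have "vec n (\<lambda>j. if j < n then v $ j else 0) = v" using v by (intro eq_vecI) auto
    finally show ?thesis .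
  qed
  moreover have "U \<subseteq> carrier_vec n" using Wc by (auto simp: U_def)
  ultimately have UV: "U = carrier_vec n" by auto
  have "\<phi> g *\<^sub>v v \<in> C I" if g: "g \<in> carrier ModGrp" and v: "v \<in> C I" for g v
  proof -
    have diag: "mat_diag n D *\<^sub>v v \<in> C I" if "v \<in> C I" for D v
      using that by (auto simp: C_def mat_diag_mult_vec)
    have vc: "v \<in> carrier_vec n" using v by (simp add: C_def)
    show ?thesis
    proof (rule mod_rep_induct[OF \<phi> g, where P = "\<lambda>X. X *\<^sub>v v \<in> C I"])
      show "1\<^sub>m n *\<^sub>v v \<in> C I" using v vc by simp
      show "s_mat \<phi> * X *\<^sub>v v \<in> C I" if "X \<in> carrier_mat n n" "X *\<^sub>v v \<in> C I" for X
        using diag[OF that(2), of D] that(1) vc by (simp add: st assoc_mult_mat_vec[of _ n n _ n])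
      show "t_mat \<phi> * X *\<^sub>v v \<in> C I" if "X \<in> carrier_mat n n" "X *\<^sub>v v \<in> C I" for X
        using diag[OF that(2), of E] that(1) vc by (simp add: st assoc_mult_mat_vec[of _ n n _ n])
    qed
  qed
  then have "invariant_subspace n ModGrp \<phi> (C I)"
    unfolding invariant_subspace_def subspace_iff using C0 Cadd Csmult Wc(2) by blast
  then show "\<exists>W'. invariant_subspace n ModGrp \<phi> W' \<and> W \<inter> W' = {0\<^sub>v n} \<and>
      {w + w' |w w'. w \<in> W \<and> w' \<in> W'} = carrier_vec n"
    using WI UV unfolding U_def by blast
qed

text \<open>A diagonal pair populates every type. This keeps the density statement from being
  satisfied by an empty set in an empty component.\<close>

lemma iss_type_nonempty:
  fixes \<rho> :: complex
  assumes \<rho>: "\<rho> ^ 3 = 1" "\<rho> \<noteq> 1" and n: "a + b = n" "n = x + y + z"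
  shows "iss_type \<rho> n (a, b, x, y, z) \<noteq> {}"
proof -
  note cube = primitive_cube_root[OF \<rho>]
  define D E where "D i = (if i < a then 1 else - 1 :: complex)"
    and "E i = (if i < x then 1 else if i < x + y then \<rho> else \<rho>\<^sup>2)" for i :: nat
  have "D i * D i = 1" "E i * (E i * E i) = 1" for i using cube by (auto simp: D_def E_def)
  then have "mat_diag n D * mat_diag n D = 1\<^sub>m n" "mat_diag n E * (mat_diag n E * mat_diag n E) = 1\<^sub>m n"
    by (simp_all only: mat_diag_diag mat_diag_one)
  then obtain \<phi> where \<phi>: "\<phi> \<in> reps n ModGrp" "s_mat \<phi> = mat_diag n D" "t_mat \<phi> = mat_diag n E"
    using mod_rep_exists[of "mat_diag n D" n "mat_diag n E"] mat_diag_dim by metis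
  have "{i. i < n \<and> D i = 1} = {..<a}" "{i. i < n \<and> D i = - 1} = {a..<n}"
    using n(1) by (auto simp: D_def split: if_splits)
  moreover have "{i. i < n \<and> E i = 1} = {..<x}" "{i. i < n \<and> E i = \<rho>} = {x..<x + y}"
    "{i. i < n \<and> E i = \<rho>\<^sup>2} = {x + y..<n}"
    using n(2) cube \<rho>(2) by (auto simp: E_def split: if_splits)
  ultimately have "has_dim_type \<rho> (a, b, x, y, z) \<phi>"
    using n unfolding has_dim_type_def \<phi>(2,3) order_char_poly_diag by auto
  then show ?thesis using diagonal_semisimple[OF \<phi>] unfolding iss_type_def by blast
qed

subsection \<open>Irreducible types\<close>

text \<open>Otherwise s and t share an eigenvector, which spans an invariant line; in dimension at
  least 2 a line is a proper subspace.\<close>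

lemma irreducible_eigenspaces:
  assumes irr: "irreducible_rep n ModGrp \<phi>" and n: "n \<ge> 2"
  shows "eigmult a (s_mat \<phi>) + eigmult b (t_mat \<phi>) \<le> n"
proof (rule ccontr)
  assume *: "\<not> ?thesis"
  have \<phi>: "\<phi> \<in> reps n ModGrp" using irr by (simp add: irreducible_rep_def)
  note rel = mod_rep_relations[OF \<phi>]
  have "s_mat \<phi> ^\<^sub>m 2 = 1\<^sub>m n" "t_mat \<phi> ^\<^sub>m 3 = 1\<^sub>m n" using rel by (simp_all add: pow_2_3)
  then obtain u where u: "u \<in> carrier_vec n" "u \<noteq> 0\<^sub>v n" "s_mat \<phi> *\<^sub>v u = a \<cdot>\<^sub>v u" "t_mat \<phi> *\<^sub>v u = b \<cdot>\<^sub>v u"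
    using common_eigenvector[OF rel(3) _ _ rel(4), of 2 3 a b] * by auto
  define W where "W = {c \<cdot>\<^sub>v u |c. True}"
  have eigen: "A *\<^sub>v v \<in> W" if "A \<in> carrier_mat n n" "A *\<^sub>v u = k \<cdot>\<^sub>v u" and vW: "v \<in> W" for A k v
  proof -
    obtain c where v: "v = c \<cdot>\<^sub>v u" using vW unfolding W_def by blast
    have "A *\<^sub>v v = (c * k) \<cdot>\<^sub>v u" unfolding v using that u by (simp add: mult_mat_vec[of _ n n] smult_smult_assoc)
    then show ?thesis by (auto simp: W_def)
  qed
  have "\<phi> g *\<^sub>v v \<in> W" if g: "g \<in> carrier ModGrp" and v: "v \<in> W" for g v
  proof -
    have vc: "v \<in> carrier_vec n" using v u by (auto simp: W_def)
    show ?thesis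
    proof (rule mod_rep_induct[OF \<phi> g, where P = "\<lambda>X. X *\<^sub>v v \<in> W"])
      show "1\<^sub>m n *\<^sub>v v \<in> W" using v vc by simp
      show "s_mat \<phi> * X *\<^sub>v v \<in> W" if "X \<in> carrier_mat n n" "X *\<^sub>v v \<in> W" for X
        using eigen[OF rel(3) u(3) that(2)] that(1) rel vc by (simp add: assoc_mult_mat_vec[of _ n n _ n])
      show "t_mat \<phi> * X *\<^sub>v v \<in> W" if "X \<in> carrier_mat n n" "X *\<^sub>v v \<in> W" for X
        using eigen[OF rel(4) u(4) that(2)] that(1) rel vc by (simp add: assoc_mult_mat_vec[of _ n n _ n])
    qed
  qed
  moreover have "v + w \<in> W" if "v \<in> W" "w \<in> W" for v w
  proof -
    obtain c d where "v = c \<cdot>\<^sub>v u" "w = d \<cdot>\<^sub>v u" using \<open>v \<in> W\<close> \<open>w \<in> W\<close> unfolding W_def by blast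
    then have "v + w = (c + d) \<cdot>\<^sub>v u" by (auto intro!: eq_vecI simp: distrib_right)
    then show ?thesis by (auto simp: W_def)
  qed
  moreover have "c \<cdot>\<^sub>v v \<in> W" if "v \<in> W" for c v
    using that by (auto simp: W_def smult_smult_assoc)
  moreover have "0\<^sub>v n \<in> W" using u(1) by (auto simp: W_def intro!: exI[of _ 0] eq_vecI)
  moreover have "W \<subseteq> carrier_vec n" using u(1) by (auto simp: W_def)
  ultimately have "invariant_subspace n ModGrp \<phi> W" by (simp add: invariant_subspace_def subspace_iff)
  then have "W = {0\<^sub>v n} \<or> W = carrier_vec n" using irr by (simp add: irreducible_rep_def)
  moreover have "1 \<cdot>\<^sub>v u \<in> W" unfolding W_def by blast
  then have "u \<in> W" using u(1) by simp
  ultimately have "W = carrier_vec n" using u(2) by auto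
  \<comment> \<open>Two distinct unit vectors do not lie on one line.\<close>
  then have "unit_vec n 0 \<in> W" "unit_vec n 1 \<in> W" by auto
  then obtain c d where cd: "unit_vec n 0 = c \<cdot>\<^sub>v u" "unit_vec n 1 = d \<cdot>\<^sub>v u" by (auto simp: W_def)
  have "c * u $ 0 = 1" "c * u $ 1 = 0" "d * u $ 1 = 1"
    using arg_cong[OF cd(1), of "\<lambda>v. v $ 0"] arg_cong[OF cd(1), of "\<lambda>v. v $ 1"]
      arg_cong[OF cd(2), of "\<lambda>v. v $ 1"] u(1) n by (auto simp: unit_vec_def)
  then show False by auto
qed

subsection \<open>Extension of representations\<close>

text \<open>An involution inverting \<open>T\<close> interchanges the eigenspaces for \<open>\<rho>\<close> and \<open>\<rho>\<^sup>2\<close>.\<close>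

lemma inverting_involution:
  fixes \<rho> :: complex
  assumes \<rho>: "\<rho> ^ 3 = 1" "\<rho> \<noteq> 1"
    and T: "T \<in> carrier_mat n n" "T * (T * T) = 1\<^sub>m n"
    and ord: "eigmult \<rho> T = eigmult (\<rho>\<^sup>2) T"
  obtains A where "A \<in> carrier_mat n n" "A * A = 1\<^sub>m n" "A * T = T * T * A"
proof -
  note cube = primitive_cube_root[OF \<rho>]
  obtain P D where P: "P \<in> carrier (GL n)" "T * P = P * mat_diag n D" "\<And>i. i < n \<Longrightarrow> D i ^ 3 = 1"
    "\<And>a. eigmult a T = card {i. i < n \<and> D i = a}"
    "\<And>a. eigmult a (T * T) = card {i. i < n \<and> D i * D i = a}"
    "\<And>a c. eigmult a (c \<cdot>\<^sub>m T) = card {i. i < n \<and> c * D i = a}"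
    by (rule order_char_poly_map[OF T]) (rule that; assumption)
  define X Y where "X = {i. i < n \<and> D i = \<rho>}" and "Y = {i. i < n \<and> D i = \<rho>\<^sup>2}"
  have "card X = card Y" using ord P(4) by (simp add: X_def Y_def)
  then obtain h where h: "bij_betw h X Y"
    using finite_same_card_bij[of X Y] by (auto simp: X_def Y_def)
  \<comment> \<open>p exchanges the indices of \<rho> and of \<rho>^2 along h and fixes those of 1,
    so its permutation matrix conjugates the diagonal matrix into its square.\<close>
  define p where "p i = (if i \<in> X then h i else if i \<in> Y then inv_into X h i else i)" for i
  have XY: "X \<inter> Y = {}" using cube by (auto simp: X_def Y_def)
  have hY: "h i \<in> Y" if "i \<in> X" for i using h that by (auto simp: bij_betw_def)
  have hX: "inv_into X h i \<in> X" "h (inv_into X h i) = i" if "i \<in> Y" for i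
    using h that by (auto simp: bij_betw_def inv_into_into f_inv_into_f)
  have hh: "inv_into X h (h i) = i" if "i \<in> X" for i using h that by (auto simp: bij_betw_def)
  have pp: "p (p i) = i" for i
    using XY hY hX hh by (auto simp: p_def)
  have p_lt: "p i < n \<longleftrightarrow> i < n" for i
    using hY hX by (auto simp: p_def X_def Y_def)
  have perm: "p permutes {..<n}"
  proof (rule bij_imp_permutes)
    show "bij_betw p {..<n} {..<n}"
      by (rule bij_betw_byWitness[of _ p]) (auto simp: pp p_lt)
    show "p i = i" if "i \<notin> {..<n}" for i using that by (auto simp: p_def X_def Y_def)
  qed
  have Dp: "D (p i) = D i * D i" if "i < n" for i
  proof -
    have "D i = 1 \<or> D i = \<rho> \<or> D i = \<rho>\<^sup>2" by (rule cube(7)[OF P(3)[OF that]])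
    moreover have "D (p i) = 1" if "D i = 1"
      using that \<rho>(2) cube(4) by (auto simp: p_def X_def Y_def)
    moreover have "D (p i) = \<rho>\<^sup>2" if "D i = \<rho>"
      using that \<open>i < n\<close> hY[of i] by (auto simp: p_def X_def Y_def)
    moreover have "D (p i) = \<rho>" if "D i = \<rho>\<^sup>2"
      using that \<open>i < n\<close> hX[of i] cube(5) by (auto simp: p_def X_def Y_def)
    moreover have "\<rho>\<^sup>2 * \<rho>\<^sup>2 = \<rho>" using cube(2) by (simp add: power2_eq_square mult.assoc)
    ultimately show ?thesis by (auto simp: power2_eq_square)
  qed
  define M where "M = mat n n (\<lambda>(i, j). if i = p j then 1 else (0 :: complex))"
  have M: "M \<in> carrier_mat n n" by (simp add: M_def)
  have "mat n n (\<lambda>(i, j). if j = p i then 1 else (0 :: complex)) = M"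
    by (rule eq_matI) (auto simp: M_def pp)
  then have MM: "M * M = 1\<^sub>m n" using perm_mat_GL(2)[OF perm] by (simp add: M_def)
  have DM: "mat_diag n D * M = M * mat_diag n (\<lambda>i. D i * D i)"
    unfolding mat_diag_mult_left[OF M] mat_diag_mult_right[OF M]
    by (rule eq_matI) (auto simp: M_def Dp)
  note assoc = assoc_mult_mat[of _ n n _ n _ n] mult_carrier_mat[of _ n n _ n]
  define E where "E = mat_diag n D"
  have E: "E \<in> carrier_mat n n" by (simp add: E_def)
  have ME: "M * E = E * E * M"
  proof -
    have EM: "E * M = M * (E * E)" using DM by (simp add: E_def)
    have "M * E = M * (E * (M * M))" using E by (simp add: MM)
    also have "\<dots> = M * (E * M) * M" using E M by (simp add: assoc)
    also have "\<dots> = (M * M) * (E * E) * M" unfolding EM using E M by (simp add: assoc)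
    also have "\<dots> = E * E * M" unfolding MM using E M by (simp add: assoc left_mult_one_mat[of _ n n])
    finally show ?thesis .
  qed
  define Q where "Q = inv\<^bsub>GL n\<^esub> P"
  have PQ: "P \<in> carrier_mat n n" "Q \<in> carrier_mat n n" "P * Q = 1\<^sub>m n" "Q * P = 1\<^sub>m n"
    using P(1) by (auto simp: Q_def GL_mat)
  have TE: "T = P * E * Q"
  proof -
    have "T = T * (P * Q)" using T(1) by (simp add: PQ)
    also have "\<dots> = T * P * Q" using T(1) PQ by (intro assoc(1)[symmetric]) auto
    also have "\<dots> = P * E * Q" by (simp only: P(2) E_def)
    finally show ?thesis .
  qed
  note conj = conjugate_relations[OF PQ(3,4,1,2)]
  show ?thesis
  proof (rule that[of "P * M * Q"])
    show "P * M * Q \<in> carrier_mat n n" using PQ M by (auto intro: assoc)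
    show "P * M * Q * (P * M * Q) = 1\<^sub>m n" unfolding conj[OF M M] MM using PQ by simp
    have "P * M * Q * T = P * (E * E * M) * Q" unfolding TE conj[OF M E] ME ..
    also have "\<dots> = T * T * (P * M * Q)"
      unfolding TE conj[OF E E] by (rule conj[symmetric]) (use E M in \<open>auto intro: assoc\<close>)
    finally show "P * M * Q * T = T * T * (P * M * Q)" .
  qed
qed

text \<open>The matrices for s1 and s2 are A and A T: their product is T, and the second is an
  involution because A conjugates T into its inverse T^2. The bracketing is that of evaluated
  words.\<close>

lemma s3_relations:
  fixes A T :: "complex mat"
  assumes A: "A \<in> carrier_mat n n" "A * A = 1\<^sub>m n" and T: "T \<in> carrier_mat n n" "T * (T * T) = 1\<^sub>m n"
    and AT: "A * T = T * T * A"
  shows "A * (A * T) = T" "(A * T) * (A * T) = 1\<^sub>m n" "T * A = A * (T * T)"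
    "A * ((A * T) * A) = (A * T) * (A * (A * T))"
proof -
  note assoc = assoc_mult_mat[of _ n n _ n _ n] mult_carrier_mat[of _ n n _ n]
  have "A * (A * T) = (A * A) * T" using A(1) T(1) by (simp add: assoc)
  then show AAT: "A * (A * T) = T" using A T by simp
  have "(A * T) * (A * T) = (T * T * A) * (A * T)" by (simp add: AT)
  also have "\<dots> = T * T * (A * (A * T))" using A(1) T(1) by (simp add: assoc)
  also have "\<dots> = 1\<^sub>m n" unfolding AAT using T by (simp add: assoc)
  finally show "(A * T) * (A * T) = 1\<^sub>m n" .
  have "T * A = A * (A * T) * A" by (simp add: AAT)
  also have "\<dots> = A * (T * T * A) * A" by (simp add: AT)
  also have "\<dots> = A * (T * T) * (A * A)" using A(1) T(1) by (simp add: assoc)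
  also have "\<dots> = A * (T * T)" unfolding A(2) using A(1) T(1) by (simp add: assoc)
  finally show TA: "T * A = A * (T * T)" .
  have "A * ((A * T) * A) = (A * (A * T)) * A" using A(1) T(1) by (simp add: assoc)
  also have "\<dots> = A * (T * T)" by (simp add: AAT TA)
  also have "\<dots> = (A * T) * (A * (A * T))" unfolding AAT using A(1) T(1) by (simp add: assoc)
  finally show "A * ((A * T) * A) = (A * T) * (A * (A * T))" .
qed

lemma extends_to_amalgam_if:
  fixes \<rho> :: complex
  assumes \<rho>: "\<rho> ^ 3 = 1" "\<rho> \<noteq> 1" and \<psi>: "\<psi> \<in> reps n ModGrp"
    and ord: "eigmult \<rho> (t_mat \<psi>) = eigmult (\<rho>\<^sup>2) (t_mat \<psi>)"
  shows "extends_to_amalgam n \<psi>"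
proof -
  note rel = mod_rep_relations[OF \<psi>]
  interpret GL: Group.group "GL n" by (rule group_GL)
  obtain A where A: "A \<in> carrier_mat n n" "A * A = 1\<^sub>m n" "A * t_mat \<psi> = t_mat \<psi> * t_mat \<psi> * A"
    using inverting_involution[OF \<rho> rel(4,2) ord] .
  note s3 = s3_relations[OF A(1,2) rel(4,2) A(3)]
  have AG: "A \<in> carrier (GL n)" using A by (auto intro: GL_I[of A n A])
  have TG: "t_mat \<psi> \<in> carrier (GL n)" by (rule rep_GL[OF \<psi>]) simp
  have ATG: "A * t_mat \<psi> \<in> carrier (GL n)" using GL.m_closed[OF AG TG] by simp
  define f where "f g = (case g of Inl h \<Rightarrow> \<psi> (gen mod_rels h) | Inr S_s1 \<Rightarrow> A | Inr S_s2 \<Rightarrow> A * t_mat \<psi>)" for g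
  have f: "f g \<in> carrier (GL n)" for g
    using AG ATG rep_GL[OF \<psi> gen_carrier] by (auto simp: f_def split: sum.split s3_gen.split)
  have R: "weval (GL n) f u = weval (GL n) f v" if "(u, v) \<in> amalgam_rels" for u v
  proof -
    from that consider u' v' where "(u', v') \<in> mod_rels" "u = map_word Inl u'" "v = map_word Inl v'"
      | u' v' where "(u', v') \<in> s3_rels" "u = map_word Inr u'" "v = map_word Inr v'"
      | "u = pos [Inl M_t]" "v = pos [Inr S_s1, Inr S_s2]"
      by (auto simp: amalgam_rels_def)
    then show ?thesis
    proof cases
      case 1
      then show ?thesis using rep_relation[OF \<psi> 1(1)] by (simp add: weval_map_word f_def)
    next
      case 2
      then show ?thesis using s3 A GL_mat[OF ATG]
        by (auto simp: s3_rels_def pos_def map_word_def f_def)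
    next
      case 3
      then show ?thesis using s3(1) rel(4) GL_mat[OF ATG] by (simp add: pos_def f_def)
    qed
  qed
  obtain \<psi>' where \<psi>': "\<psi>' \<in> reps n Amalg" "\<And>w. \<psi>' (word_class amalgam_rels w) = weval (GL n) f w"
    using rep_lift[OF f R] by metis
  have "\<psi>' (word_class amalgam_rels (map_word Inl u)) = \<psi> (word_class mod_rels u)" for u
    by (simp add: \<psi>'(2) weval_map_word rep_weval[OF \<psi>] f_def)
  with \<psi>'(1) show ?thesis unfolding extends_to_amalgam_def by blast
qed

text \<open>Conjugation by s1 turns t = s1 s2 into s2 s1 = t^2, so t and t^2 have the same
  multiplicities, while squaring exchanges \<rho> and \<rho>^2.\<close>

lemma extends_to_amalgam_imp:
  fixes \<rho> :: complex
  assumes \<rho>: "\<rho> ^ 3 = 1" "\<rho> \<noteq> 1" and \<psi>: "\<psi> \<in> reps n ModGrp" and ext: "extends_to_amalgam n \<psi>"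
  shows "eigmult \<rho> (t_mat \<psi>) = eigmult (\<rho>\<^sup>2) (t_mat \<psi>)"
proof -
  note cube = primitive_cube_root[OF \<rho>]
  define T where "T = t_mat \<psi>"
  note rel = mod_rep_relations[OF \<psi>, folded T_def]
  obtain \<psi>' where \<psi>': "\<psi>' \<in> reps n Amalg"
    "\<And>u. \<psi>' (word_class amalgam_rels (map_word Inl u)) = \<psi> (word_class mod_rels u)"
    using ext by (auto simp: extends_to_amalgam_def)
  define A B where "A = \<psi>' (gen amalgam_rels (Inr S_s1))" and "B = \<psi>' (gen amalgam_rels (Inr S_s2))"
  have car: "A \<in> carrier_mat n n" "B \<in> carrier_mat n n" using \<psi>'(1) by (auto simp: A_def B_def)
  have T: "\<psi>' (gen amalgam_rels (Inl M_t)) = T"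
    using \<psi>'(2)[of "pos [M_t]"] by (simp add: gen_def T_def pos_def map_word_def)
  have s3: "(map_word Inr u, map_word Inr v) \<in> amalgam_rels" if "(u, v) \<in> s3_rels" for u v
    using that by (auto simp: amalgam_rels_def)
  have "(pos [S_s1, S_s1], []) \<in> s3_rels" "(pos [S_s2, S_s2], []) \<in> s3_rels" by (auto simp: s3_rels_def)
  from rep_relation[OF \<psi>'(1) s3[OF this(1)]] rep_relation[OF \<psi>'(1) s3[OF this(2)]]
  have AA: "A * A = 1\<^sub>m n" and BB: "B * B = 1\<^sub>m n"
    using car by (simp_all add: pos_def map_word_def flip: A_def B_def)
  have "(pos [Inl M_t], pos [Inr S_s1, Inr S_s2]) \<in> amalgam_rels" by (simp add: amalgam_rels_def)
  from rep_relation[OF \<psi>'(1) this] have TAB: "T = A * B"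
    using car rel(4) by (simp add: pos_def T flip: A_def B_def)
  note assoc = assoc_mult_mat[of _ n n _ n _ n] mult_carrier_mat[of _ n n _ n]
  have BA: "T * (B * A) = 1\<^sub>m n"
  proof -
    have "T * (B * A) = A * (B * B) * A" unfolding TAB using car by (simp add: assoc)
    then show ?thesis using car AA BB by simp
  qed
  \<comment> \<open>Both sides are inverse to T.\<close>
  have "T * T = B * A"
  proof -
    have "T * T = (T * T) * (T * (B * A))" using rel(4) by (simp add: BA assoc)
    also have "\<dots> = (T * (T * T)) * (B * A)" using rel(4) car by (simp add: assoc)
    also have "\<dots> = B * A" unfolding rel(2) using car by (simp add: assoc left_mult_one_mat[of _ n n])
    finally show ?thesis .
  qed
  then have "T * A = A * (T * T)" unfolding TAB using car by (simp add: assoc)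
  moreover have "A \<in> carrier (GL n)" using car AA by (auto intro: GL_I[of A n A])
  ultimately have "similar_mat T (T * T)"
    using rel(4) by (intro GL_similar[of A n]) (auto intro: assoc)
  then have eq: "char_poly T = char_poly (T * T)" by (rule char_poly_similar)
  obtain P D where "P \<in> carrier (GL n)" "T * P = P * mat_diag n D"
    and D: "\<And>i. i < n \<Longrightarrow> D i ^ 3 = 1"
    "\<And>a. eigmult a T = card {i. i < n \<and> D i = a}"
    "\<And>a. eigmult a (T * T) = card {i. i < n \<and> D i * D i = a}"
    "\<And>a c. eigmult a (c \<cdot>\<^sub>m T) = card {i. i < n \<and> c * D i = a}"
    by (rule order_char_poly_map[OF rel(4,2)]) (rule that; assumption)
  have r4: "\<rho>\<^sup>2 * \<rho>\<^sup>2 = \<rho>" using cube(2) by (simp add: power2_eq_square mult.assoc)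
  have "D i * D i = \<rho> \<longleftrightarrow> D i = \<rho>\<^sup>2" if "i < n" for i
    using cube(7)[OF D(1)[OF that]] r4 \<rho>(2) cube(5) by (auto simp: power2_eq_square)
  then have "{i. i < n \<and> D i * D i = \<rho>} = {i. i < n \<and> D i = \<rho>\<^sup>2}" by auto
  then show ?thesis using D(2)[of "\<rho>\<^sup>2"] D(3)[of \<rho>] eq by (simp add: T_def)
qed


section \<open>Extension to the loop braid group\<close>

lemma smult_smult_mat: "a \<cdot>\<^sub>m (b \<cdot>\<^sub>m A) = (a * b :: complex) \<cdot>\<^sub>m A"
  by (rule eq_matI) auto

text \<open>Here s1 and s2 act by A and A T, with product T. The first mixed relation becomes T m1 =
  m2 T, which is the braid relation divided by k; the second becomes T A = A T^2, which says that A
  inverts T. Hence it is enough that a scalar multiple of m1 m2 has order 3.\<close>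

lemma extends_to_LB3_if:
  fixes T :: "complex mat" and k :: complex
  assumes \<phi>: "\<phi> \<in> reps n B3" and T: "T \<in> carrier_mat n n" "T * (T * T) = 1\<^sub>m n" and k: "k \<noteq> 0"
    and kT: "\<phi> (gen b3_rels B_sigma1) * \<phi> (gen b3_rels B_sigma2) = k \<cdot>\<^sub>m T"
    and A: "A \<in> carrier_mat n n" "A * A = 1\<^sub>m n" "A * T = T * T * A"
  shows "extends_to_LB3 n \<phi>"
proof -
  interpret GL: Group.group "GL n" by (rule group_GL)
  note s3 = s3_relations[OF A(1,2) T A(3)]
  define m1 m2 where "m1 = \<phi> (gen b3_rels B_sigma1)" and "m2 = \<phi> (gen b3_rels B_sigma2)"
  have car: "m1 \<in> carrier_mat n n" "m2 \<in> carrier_mat n n" using \<phi> by (auto simp: m1_def m2_def)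
  note mm = mult_carrier_mat[of _ n n _ n] and assoc = assoc_mult_mat[of _ n n _ n _ n]
  have AT: "A * T \<in> carrier_mat n n" using A(1) T(1) by (rule mm)
  have "(pos [B_sigma1, B_sigma2, B_sigma1], pos [B_sigma2, B_sigma1, B_sigma2]) \<in> b3_rels"
    by (simp add: b3_rels_def)
  from rep_relation[OF \<phi> this] have braid: "m1 * (m2 * m1) = m2 * (m1 * m2)"
    using car by (simp add: pos_def flip: m1_def m2_def)
  have m12: "m1 * m2 = k \<cdot>\<^sub>m T" using kT by (simp add: m1_def m2_def)
  have cancel: "X = Y" if "k \<cdot>\<^sub>m X = k \<cdot>\<^sub>m Y" "X \<in> carrier_mat n n" "Y \<in> carrier_mat n n" for X Y
  proof (rule eq_matI)
    fix i j assume "i < dim_row Y" "j < dim_col Y"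
    then show "X $$ (i, j) = Y $$ (i, j)"
      using arg_cong[OF that(1), of "\<lambda>M. M $$ (i, j)"] that(2,3) k by auto
  qed (use that in auto)
  have T1: "T * m1 = m2 * T"
  proof (rule cancel)
    have "k \<cdot>\<^sub>m (T * m1) = (m1 * m2) * m1" unfolding m12 using T(1) car by (simp add: mult_smult_assoc_mat[of _ n n _ n])
    also have "\<dots> = m2 * (m1 * m2)" using braid car by (simp add: assoc)
    also have "\<dots> = k \<cdot>\<^sub>m (m2 * T)" unfolding m12 using T(1) car by (simp add: mult_smult_distrib[of _ n n _ n])
    finally show "k \<cdot>\<^sub>m (T * m1) = k \<cdot>\<^sub>m (m2 * T)" .
  qed (use T(1) car in \<open>auto intro: mm\<close>)
  have T2: "m1 * (m2 * A) = (A * T) * (m1 * m2)"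
  proof -
    have "m1 * (m2 * A) = k \<cdot>\<^sub>m (T * A)"
      using assoc[OF car A(1)] T(1) A(1) by (simp add: m12 mult_smult_assoc_mat[of _ n n _ n])
    also have "\<dots> = (A * T) * (k \<cdot>\<^sub>m T)"
      using T(1) A(1) AT by (simp add: s3(3) mult_smult_distrib[of _ n n _ n] assoc)
    finally show ?thesis by (simp add: m12)
  qed
  have G: "m1 \<in> carrier (GL n)" "m2 \<in> carrier (GL n)" unfolding m1_def m2_def by (rule rep_GL[OF \<phi>], simp)+
  have AG: "A \<in> carrier (GL n)" using A by (auto intro: GL_I[of A n A])
  have ATG: "A * T \<in> carrier (GL n)" using s3(2) AT by (auto intro: GL_I[of _ n "A * T"])
  define f where "f g = (case g of L_sigma1 \<Rightarrow> m1 | L_sigma2 \<Rightarrow> m2 | L_s1 \<Rightarrow> A | L_s2 \<Rightarrow> A * T)" for g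
  have f: "f g \<in> carrier (GL n)" for g using G AG ATG by (cases g) (auto simp: f_def)
  have R: "weval (GL n) f u = weval (GL n) f v" if "(u, v) \<in> lb3_rels" for u v
  proof -
    have "A * ((A * T) * m1) = m2 * (A * (A * T))"
      using assoc[OF A(1) AT car(1)] by (simp add: s3(1) T1)
    then show ?thesis using that braid s3 T2 A(2) car AT A(1)
      by (auto simp: lb3_rels_def pos_def f_def)
  qed
  obtain \<phi>' where \<phi>': "\<phi>' \<in> reps n LB3" "\<And>w. \<phi>' (word_class lb3_rels w) = weval (GL n) f w"
    using rep_lift[OF f R] by metis
  have "\<phi>' (gen lb3_rels L_sigma1) = m1" "\<phi>' (gen lb3_rels L_sigma2) = m2"
    using car by (simp_all add: gen_def pos_def \<phi>' f_def)
  then show ?thesis using \<phi>'(1) unfolding extends_to_LB3_def m1_def m2_def by blast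
qed

text \<open>Twisting \<open>t\<close> by a cube root of unity permutes its eigenvalue multiplicities cyclically, so two
  equal ones can be moved to the eigenvalues \<open>\<rho>\<close> and \<open>\<rho>\<^sup>2\<close>.\<close>

lemma irr_type_extends:
  fixes \<rho> :: complex
  assumes \<rho>: "\<rho> ^ 3 = 1" "\<rho> \<noteq> 1" and X: "X \<in> irr_type \<rho> n (a, b, x, y, z)" and \<phi>: "\<phi> \<in> X"
    and eq: "x = y \<or> y = z \<or> x = z"
  shows "extends_to_LB3 n \<phi>"
proof -
  note cube = primitive_cube_root[OF \<rho>]
  obtain \<phi>0 c \<psi> where \<phi>0: "\<phi>0 \<in> reps n B3" "X = iso_class n B3 \<phi>0" and c: "c \<noteq> 0"
    and irr: "irreducible_rep n ModGrp \<psi>" and type: "has_dim_type \<rho> (a, b, x, y, z) \<psi>"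
    and sig: "\<phi>0 (gen b3_rels B_sigma1) = c \<cdot>\<^sub>m \<psi> sigma1_bar" "\<phi>0 (gen b3_rels B_sigma2) = c \<cdot>\<^sub>m \<psi> sigma2_bar"
    using X unfolding irr_type_def by blast
  have \<phi>r: "\<phi> \<in> reps n B3" and iso: "rep_iso n B3 \<phi>0 \<phi>" using \<phi> \<phi>0(2) by (auto simp: iso_class_def)
  obtain P Q where PQ: "P \<in> carrier_mat n n" "Q \<in> carrier_mat n n" "P * Q = 1\<^sub>m n" "Q * P = 1\<^sub>m n"
    and conj: "\<And>g. g \<in> carrier B3 \<Longrightarrow> \<phi> g = P * \<phi>0 g * Q"
    using rep_isoE[OF iso \<phi>0(1) \<phi>r] by metis
  have \<psi>: "\<psi> \<in> reps n ModGrp" using irr by (simp add: irreducible_rep_def)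
  note rel = mod_rep_relations[OF \<psi>]
  interpret M: Group.group ModGrp by (rule group_presented_group)
  have sc: "sigma1_bar \<in> carrier ModGrp" "sigma2_bar \<in> carrier ModGrp"
    by (simp_all add: sigma1_bar_def sigma2_bar_def)
  have st: "\<psi> sigma1_bar * \<psi> sigma2_bar = t_mat \<psi>" by (simp add: sigma_bar_t flip: rep_mult[OF \<psi> sc])
  note mm = mult_carrier_mat[of _ n n _ n]
  note cr = conjugate_relations[OF PQ(3,4,1,2)]
  define T1 where "T1 = P * t_mat \<psi> * Q"
  have T1: "T1 \<in> carrier_mat n n" unfolding T1_def using PQ rel by (auto intro: mm)
  have T13: "T1 * (T1 * T1) = 1\<^sub>m n"
  proof -
    have "T1 * (T1 * T1) = P * (t_mat \<psi> * (t_mat \<psi> * t_mat \<psi>)) * Q"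
      unfolding T1_def cr[OF rel(4,4)] by (rule cr) (use rel in \<open>auto intro: mm\<close>)
    then show ?thesis using rel PQ by simp
  qed
  have cpT1: "char_poly T1 = char_poly (t_mat \<psi>)"
    using PQ rel T1 by (intro char_poly_similar similar_matI[of _ _ P Q n]) (auto simp: T1_def)
  have m12: "\<phi> (gen b3_rels B_sigma1) * \<phi> (gen b3_rels B_sigma2) = (c * c) \<cdot>\<^sub>m T1"
  proof -
    have cs: "\<psi> sigma1_bar \<in> carrier_mat n n" "\<psi> sigma2_bar \<in> carrier_mat n n" using sc \<psi> by auto
    have "\<phi> (gen b3_rels B_sigma1) * \<phi> (gen b3_rels B_sigma2) =
      P * ((c \<cdot>\<^sub>m \<psi> sigma1_bar) * (c \<cdot>\<^sub>m \<psi> sigma2_bar)) * Q"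
      unfolding conj[OF gen_carrier] sig by (rule cr) (use cs in auto)
    also have "(c \<cdot>\<^sub>m \<psi> sigma1_bar) * (c \<cdot>\<^sub>m \<psi> sigma2_bar) = (c * c) \<cdot>\<^sub>m t_mat \<psi>"
      using cs by (simp add: mult_smult_assoc_mat[of _ n n _ n] mult_smult_distrib[of _ n n _ n] st smult_smult_mat)
    also have "P * ((c * c) \<cdot>\<^sub>m t_mat \<psi>) * Q = (c * c) \<cdot>\<^sub>m T1"
      using PQ rel by (simp add: T1_def mult_smult_assoc_mat[of _ n n _ n] mult_smult_distrib[of _ n n _ n] mm)
    finally show ?thesis .
  qed
  obtain P' D where "P' \<in> carrier (GL n)" "T1 * P' = P' * mat_diag n D"
    and D: "\<And>i. i < n \<Longrightarrow> D i ^ 3 = 1"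
    "\<And>a. eigmult a T1 = card {i. i < n \<and> D i = a}"
    "\<And>a. eigmult a (T1 * T1) = card {i. i < n \<and> D i * D i = a}"
    "\<And>a c. eigmult a (c \<cdot>\<^sub>m T1) = card {i. i < n \<and> c * D i = a}"
    by (rule order_char_poly_map[OF T1 T13]) (rule that; assumption)
  have ord: "eigmult 1 T1 = x" "eigmult \<rho> T1 = y"
    "eigmult (\<rho>\<^sup>2) T1 = z"
    using type by (simp_all add: has_dim_type_def cpT1)
  have twist: "eigmult e (w \<cdot>\<^sub>m T1) = eigmult e' T1"
    if "e = w * e'" "w \<noteq> 0" for e e' w
    using that by (simp add: D(2,4))
  have r3: "\<rho> * \<rho>\<^sup>2 = 1" "\<rho>\<^sup>2 * \<rho> = 1" "\<rho> * \<rho> = \<rho>\<^sup>2" "\<rho>\<^sup>2 * \<rho>\<^sup>2 = \<rho>"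
    using cube(2) by (simp_all add: power2_eq_square mult.assoc)
  obtain w where w: "w ^ 3 = 1" "w \<noteq> 0"
    and ordw: "eigmult \<rho> (w \<cdot>\<^sub>m T1) = eigmult (\<rho>\<^sup>2) (w \<cdot>\<^sub>m T1)"
  proof -
    consider "y = z" | "x = y" | "x = z" using eq by blast
    then show ?thesis
    proof cases
      case 1
      then show ?thesis using that[of 1] twist[of \<rho> 1 \<rho>] twist[of "\<rho>\<^sup>2" 1 "\<rho>\<^sup>2"] ord by simp
    next
      case 2
      then show ?thesis using that[of \<rho>] twist[of \<rho> \<rho> 1] twist[of "\<rho>\<^sup>2" \<rho> \<rho>] ord r3 \<rho> cube(1) by simp
    next
      case 3
      have "(\<rho>\<^sup>2) ^ 3 = 1" using \<rho>(1) by (metis power_mult mult.commute power_one)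
      then show ?thesis
        using that[of "\<rho>\<^sup>2"] twist[of \<rho> "\<rho>\<^sup>2" "\<rho>\<^sup>2"] twist[of "\<rho>\<^sup>2" "\<rho>\<^sup>2" 1] 3 ord r3 cube(1) by simp
    qed
  qed
  define T where "T = w \<cdot>\<^sub>m T1"
  have T: "T \<in> carrier_mat n n" using T1 by (simp add: T_def)
  have T3: "T * (T * T) = 1\<^sub>m n"
  proof -
    have "T * (T * T) = (w * (w * w)) \<cdot>\<^sub>m (T1 * (T1 * T1))"
      unfolding T_def using T1 by (simp add: mult_smult_assoc_mat[of _ n n _ n] mult_smult_distrib[of _ n n _ n] mm smult_smult_mat mult.assoc)
    also have "w * (w * w) = 1" using w(1) by (simp add: power3_eq_cube mult.assoc)
    finally have "T * (T * T) = 1 \<cdot>\<^sub>m 1\<^sub>m n" by (simp only: T13)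
    also have "\<dots> = 1\<^sub>m n" by auto
    finally show ?thesis .
  qed
  obtain A where A: "A \<in> carrier_mat n n" "A * A = 1\<^sub>m n" "A * T = T * T * A"
    using inverting_involution[OF \<rho> T T3] ordw by (auto simp: T_def)
  \<comment> \<open>The twist by w is compensated in the scalar, so \<phi> itself stays
    unchanged.\<close>
  have "(c * c / w) \<cdot>\<^sub>m T = (c * c) \<cdot>\<^sub>m T1" using w(2) by (simp add: T_def smult_smult_mat)
  then show ?thesis
    using extends_to_LB3_if[OF \<phi>r T T3 _ _ A, of "c * c / w"] c w(2) m12 by simp
qed

subsection \<open>Zariski topologies\<close>

lemma topspace_zariski_iss: "topspace (zariski_iss n G) = iss n G"
proof
  show "topspace (zariski_iss n G) \<subseteq> iss n G"
    using openin_topspace[of "zariski_iss n G"] unfolding openin_zariski_iss by blast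
  have "(\<lambda>_. 1) \<in> invariant_functions n G"
    by (simp add: invariant_functions_def regular_functions.const)
  moreover have "iss n G = {X \<in> iss n G. \<exists>f\<in>{\<lambda>_. 1}. \<exists>\<phi>\<in>X. f \<phi> \<noteq> (0 :: complex)}"
    using iso_class_refl by (force simp: iss_def semisimple_rep_def)
  ultimately have "openin (zariski_iss n G) (iss n G)"
    unfolding openin_zariski_iss by (intro exI[of _ "{\<lambda>_. 1}"]) auto
  then show "iss n G \<subseteq> topspace (zariski_iss n G)" by (rule openin_subset)
qed

lemma iss_type_subset: "iss_type \<rho> n \<alpha> \<subseteq> iss n ModGrp"
  by (auto simp: iss_type_def iss_def)

lemma topspace_iss_type: "topspace (subtopology (zariski_iss n ModGrp) (iss_type \<rho> n \<alpha>)) = iss_type \<rho> n \<alpha>"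
  unfolding topspace_subtopology topspace_zariski_iss using iss_type_subset by (rule inf_absorb2)

lemma iss_type_member:
  assumes "X \<in> iss_type \<rho> n \<alpha>" "\<psi> \<in> X"
  shows "\<psi> \<in> reps n ModGrp" "has_dim_type \<rho> \<alpha> \<psi>"
  using assms has_dim_type_iso[where \<alpha> = \<alpha>] by (auto simp: iss_type_def iso_class_def semisimple_rep_def)

lemma same_type_conjugate:
  fixes \<rho> :: complex
  assumes \<rho>: "\<rho> ^ 3 = 1" "\<rho> \<noteq> 1" and \<phi>: "\<phi> \<in> reps n ModGrp" "has_dim_type \<rho> \<alpha> \<phi>"
    and \<psi>: "\<psi> \<in> reps n ModGrp" "has_dim_type \<rho> \<alpha> \<psi>"
  obtains R R' where "R \<in> carrier (GL n)" "s_mat \<psi> * R = R * s_mat \<phi>"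
    "R' \<in> carrier (GL n)" "t_mat \<psi> * R' = R' * t_mat \<phi>"
proof -
  note r = mod_rep_relations[OF \<phi>(1)] and r' = mod_rep_relations[OF \<psi>(1)]
  obtain a b x y z where \<alpha>: "\<alpha> = (a, b, x, y, z)" by (cases \<alpha>)
  have "e = 1 \<or> e = - 1" if "e ^ 2 = 1" for e :: complex using that by (simp add: power2_eq_1_iff)
  then have s: "eigmult e (s_mat \<phi>) = eigmult e (s_mat \<psi>)" if "e ^ 2 = 1" for e
    using that \<phi>(2) \<psi>(2) by (fastforce simp: has_dim_type_def \<alpha>)
  have t: "eigmult e (t_mat \<phi>) = eigmult e (t_mat \<psi>)" if "e ^ 3 = 1" for e
    using primitive_cube_root(7)[OF \<rho> that] \<phi>(2) \<psi>(2) by (auto simp: has_dim_type_def \<alpha>)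
  have pow: "s_mat \<phi> ^\<^sub>m 2 = 1\<^sub>m n" "s_mat \<psi> ^\<^sub>m 2 = 1\<^sub>m n" "t_mat \<phi> ^\<^sub>m 3 = 1\<^sub>m n" "t_mat \<psi> ^\<^sub>m 3 = 1\<^sub>m n"
    using r r' by (simp_all add: pow_2_3)
  obtain R where "R \<in> carrier (GL n)" "s_mat \<psi> * R = R * s_mat \<phi>"
    using finite_order_conjugate[OF r(3) pow(1) r'(3) pow(2) _ s] by auto
  moreover obtain R' where "R' \<in> carrier (GL n)" "t_mat \<psi> * R' = R' * t_mat \<phi>"
    using finite_order_conjugate[OF r(4) pow(3) r'(4) pow(4) _ t] by auto
  ultimately show ?thesis using that by blast
qed

text \<open>U is the locus where some Gram determinant is nonzero. It meets every nonempty open set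
  of the component: an invariant nonzero at one of its points and a Gram determinant nonzero at the
  full representation \<open>\<phi>1\<close> are simultaneously nonzero at some representation of
  the same type.\<close>

lemma open_dense_irreducibles:
  fixes \<rho> :: complex
  assumes \<rho>: "\<rho> ^ 3 = 1" "\<rho> \<noteq> 1" and n: "n > 0"
    and \<phi>1: "\<phi>1 \<in> reps n ModGrp" "has_dim_type \<rho> \<alpha> \<phi>1" "full n (s_mat \<phi>1) (t_mat \<phi>1)"
  obtains U where "open_dense_in (subtopology (zariski_iss n ModGrp) (iss_type \<rho> n \<alpha>)) U"
    "U \<subseteq> iss_type \<rho> n \<alpha>" "\<And>X \<psi>. X \<in> U \<Longrightarrow> \<psi> \<in> X \<Longrightarrow> irreducible_rep n ModGrp \<psi>"
proof -
  define F where "F = {gram n gs |gs :: nat \<Rightarrow> mod_gen word set. \<forall>i. gs i \<in> carrier ModGrp}"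
  have F: "F \<subseteq> invariant_functions n ModGrp" using gram_invariant by (auto simp: F_def)
  define V\<^sub>0 where "V\<^sub>0 = {X \<in> iss n ModGrp. \<exists>f\<in>F. \<exists>\<phi>\<in>X. f \<phi> \<noteq> 0}"
  define U where "U = V\<^sub>0 \<inter> iss_type \<rho> n \<alpha>"
  define \<T> where "\<T> = subtopology (zariski_iss n ModGrp) (iss_type \<rho> n \<alpha>)"
  have "openin (zariski_iss n ModGrp) V\<^sub>0" unfolding openin_zariski_iss V\<^sub>0_def using F by blast
  then have "openin \<T> U" unfolding \<T>_def openin_subtopology U_def by blast
  moreover have "\<T> closure_of U = topspace \<T>"
  proof
    show "topspace \<T> \<subseteq> \<T> closure_of U"
    proof
      fix X assume X: "X \<in> topspace \<T>"
      have "\<exists>Y. Y \<in> U \<and> Y \<in> V" if V: "X \<in> V" "openin \<T> V" for V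
      proof -
        obtain H where H: "H \<subseteq> invariant_functions n ModGrp"
          "V = {X \<in> iss n ModGrp. \<exists>f\<in>H. \<exists>\<phi>\<in>X. f \<phi> \<noteq> 0} \<inter> iss_type \<rho> n \<alpha>"
          using V(2) unfolding \<T>_def openin_subtopology openin_zariski_iss by blast
        then obtain h \<phi>0 where h: "h \<in> H" "\<phi>0 \<in> X" "h \<phi>0 \<noteq> 0" and Xt: "X \<in> iss_type \<rho> n \<alpha>" using V(1) by blast
        note \<phi>0 = iss_type_member[OF Xt h(2)]
        obtain gs where gs: "\<And>i. gs i \<in> carrier ModGrp" "gram n gs \<phi>1 \<noteq> 0"
          using full_gram[OF \<phi>1(1,3)] by metis
        obtain R R' where R: "R \<in> carrier (GL n)" "s_mat \<phi>1 * R = R * s_mat \<phi>0"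
          "R' \<in> carrier (GL n)" "t_mat \<phi>1 * R' = R' * t_mat \<phi>0"
          using same_type_conjugate[OF \<rho> \<phi>0 \<phi>1(1,2)] .
        have hi: "h \<in> invariant_functions n ModGrp" using h H by blast
        obtain \<phi> where \<phi>: "\<phi> \<in> reps n ModGrp" "h \<phi> \<noteq> 0" "gram n gs \<phi> \<noteq> 0"
          "char_poly (s_mat \<phi>) = char_poly (s_mat \<phi>0)" "char_poly (t_mat \<phi>) = char_poly (t_mat \<phi>0)"
          using invariants_common_nonzero[OF \<phi>0(1) \<phi>1(1) R hi h(3) gram_invariant[OF gs(1)] gs(2)] .
        have "semisimple_rep n ModGrp \<phi>"
          using irreducible_imp_semisimple gram_irreducible[OF \<phi>(1) n gs(1) \<phi>(3)] by blast
        moreover have "has_dim_type \<rho> \<alpha> \<phi>" using \<phi>0(2) \<phi>(4,5) by (simp add: has_dim_type_def)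
        ultimately have Y: "iso_class n ModGrp \<phi> \<in> iss_type \<rho> n \<alpha>" by (auto simp: iss_type_def)
        have mem: "\<phi> \<in> iso_class n ModGrp \<phi>" by (rule iso_class_refl[OF \<phi>(1)])
        have Yi: "iso_class n ModGrp \<phi> \<in> iss n ModGrp" using Y iss_type_subset by blast
        have "gram n gs \<in> F" using gs(1) by (auto simp: F_def)
        then have "iso_class n ModGrp \<phi> \<in> U" unfolding U_def V\<^sub>0_def using Y Yi mem \<phi>(3) by blast
        moreover have "iso_class n ModGrp \<phi> \<in> V" unfolding H(2) using Y Yi mem \<phi>(2) h(1) by blast
        ultimately show ?thesis by blast
      qed
      then show "X \<in> \<T> closure_of U" using X by (auto simp: in_closure_of)
    qed
  qed (rule closure_of_subset_topspace)
  ultimately have "open_dense_in \<T> U" by (simp add: open_dense_in_def)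
  moreover have "irreducible_rep n ModGrp \<psi>" if X: "X \<in> U" and \<psi>: "\<psi> \<in> X" for X \<psi>
  proof -
    obtain gs \<phi> where gs: "\<And>i. gs i \<in> carrier ModGrp" and \<phi>: "\<phi> \<in> X" "gram n gs \<phi> \<noteq> 0" and Xi: "X \<in> iss n ModGrp"
      using X unfolding U_def V\<^sub>0_def F_def by blast
    have "gram n gs \<psi> \<noteq> 0" using invariant_nonzero_iff[OF gram_invariant[of gs, OF gs] \<psi> Xi] \<phi> by blast
    moreover have "\<psi> \<in> reps n ModGrp" using iss_type_member(1)[of X \<rho> n \<alpha> \<psi>] X \<psi> by (simp add: U_def)
    ultimately show ?thesis using gram_irreducible n gs by blast
  qed
  ultimately show ?thesis using that[of U] unfolding \<T>_def U_def by blast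
qed

theorem theorem1:
  fixes \<rho> :: complex
  assumes "\<rho> ^ 3 = 1" and "\<rho> \<noteq> 1"
  shows
    "(\<forall>n a b x y z :: nat.
        a + b = n \<and> n = x + y + z \<and> (a, b, x, y, z) \<notin> degenerate_types \<longrightarrow>
        ((\<exists>U. open_dense_in (subtopology (zariski_iss n ModGrp) (iss_type \<rho> n (a, b, x, y, z))) U \<and>
              (\<forall>X\<in>U. \<forall>\<psi>\<in>X. irreducible_rep n ModGrp \<psi> \<and> extends_to_amalgam n \<psi>))
         \<longleftrightarrow>
         (\<exists>u v w :: nat. w \<ge> max u v \<and>
              (a, b, x, y, z) = (v + w, u + w, u + v, w, w)))) \<and>
     (\<forall>n a b x y z :: nat.
        a + b = n \<and> n = x + y + z \<and> a \<ge> b \<and> b \<ge> x \<and> x = Max {x, y, z} \<and>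
        (\<exists>u v w :: nat. u \<le> v \<and> v \<le> w \<and> a = v + w \<and> b = u + w \<and>
              {#x, y, z#} = {#u + v, w, w#}) \<longrightarrow>
        (\<exists>U. open_dense_in (subtopology (zariski_irr n B3) (irr_type \<rho> n (a, b, x, y, z))) U \<and>
              (\<forall>X\<in>U. \<forall>\<phi>\<in>X. irreducible_rep n B3 \<phi> \<and> extends_to_LB3 n \<phi>)))"
proof (intro conjI allI impI iffI)
  note \<rho> = assms and cube = primitive_cube_root[OF assms]
  fix n a b x y z :: nat
  assume *: "a + b = n \<and> n = x + y + z \<and> (a, b, x, y, z) \<notin> degenerate_types"
  let ?T = "subtopology (zariski_iss n ModGrp) (iss_type \<rho> n (a, b, x, y, z))"
  {
    assume "\<exists>U. open_dense_in ?T U \<and>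
      (\<forall>X\<in>U. \<forall>\<psi>\<in>X. irreducible_rep n ModGrp \<psi> \<and> extends_to_amalgam n \<psi>)"
    then obtain U where U: "open_dense_in ?T U"
      "\<And>X \<psi>. X \<in> U \<Longrightarrow> \<psi> \<in> X \<Longrightarrow> irreducible_rep n ModGrp \<psi> \<and> extends_to_amalgam n \<psi>" by blast
    have "U \<noteq> {}"
    proof
      assume "U = {}"
      then have "iss_type \<rho> n (a, b, x, y, z) = {}"
        using U(1) by (simp add: open_dense_in_def topspace_iss_type del: topspace_subtopology)
      with iss_type_nonempty[OF \<rho>, of a b n x y z] * show False by simp
    qed
    then obtain X where X: "X \<in> U" by blast
    have Xt: "X \<in> iss_type \<rho> n (a, b, x, y, z)"
      using openin_subset[of ?T U] U(1) X by (auto simp: open_dense_in_def topspace_iss_type simp del: topspace_subtopology)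
    then obtain \<psi> where \<psi>: "\<psi> \<in> X" using iso_class_refl by (auto simp: iss_type_def semisimple_rep_def)
    note r = iss_type_member[OF Xt \<psi>] and irr = conjunct1[OF U(2)[OF X \<psi>]] and ext = conjunct2[OF U(2)[OF X \<psi>]]
    have ord: "eigmult 1 (s_mat \<psi>) = a" "eigmult (- 1) (s_mat \<psi>) = b"
      "eigmult 1 (t_mat \<psi>) = x" "eigmult \<rho> (t_mat \<psi>) = y"
      "eigmult (\<rho>\<^sup>2) (t_mat \<psi>) = z"
      using r(2) by (simp_all add: has_dim_type_def)
    have yz: "y = z" using extends_to_amalgam_imp[OF \<rho> r(1) ext] ord by simp
    \<comment> \<open>In dimension 1 equal multiplicities of \<rho> and \<rho>^2 mean that t acts
      trivially, which leaves the two excluded characters.\<close>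
    have "n \<ge> 2"
    proof (rule ccontr)
      assume "\<not> n \<ge> 2"
      moreover have "n > 0" using irr by (simp add: irreducible_rep_def)
      ultimately have "n = 1" by simp
      then have "x + y + y = 1" "a + b = 1" using * yz by auto
      then have "y = 0" "z = 0" "x = 1" "(a = 1 \<and> b = 0) \<or> (a = 0 \<and> b = 1)"
        unfolding yz[symmetric] by presburger+
      then show False using * by (auto simp: degenerate_types_def)
    qed
    note dims = irreducible_eigenspaces[OF irr this]
    \<comment> \<open>With w = y, the inequalities for the eigenvalue \<rho> make u = b - y and v =
      a - y genuine subtractions, and those for the eigenvalue 1 bound u and v by w.\<close>
    have "a + x \<le> n" "a + y \<le> n" "b + x \<le> n" "b + y \<le> n"
      using dims[of 1 1] dims[of 1 \<rho>] dims[of "- 1" 1] dims[of "- 1" \<rho>] ord by auto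
    then have "y \<ge> max (b - y) (a - y) \<and> (a, b, x, y, z) = ((a - y) + y, (b - y) + y, (b - y) + (a - y), y, y)"
      using * yz by auto
    then show "\<exists>u v w :: nat. w \<ge> max u v \<and> (a, b, x, y, z) = (v + w, u + w, u + v, w, w)" by blast
  next
    assume "\<exists>u v w :: nat. w \<ge> max u v \<and> (a, b, x, y, z) = (v + w, u + w, u + v, w, w)"
    then obtain u v w where uvw: "u \<le> w" "v \<le> w" "a = v + w" "b = u + w" "x = u + v" "y = w" "z = w" by auto
    have w: "w > 0" using * uvw by (auto simp: degenerate_types_def intro: gr0I)
    \<comment> \<open>x = 0 forces u = v = 0 and so the type (w, w; 0, w, w), which is degenerate
      from w = 2 on. For w = 1 the dimension is 2, where \<open>full_pair_exists\<close> does not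
      ask for positivity.\<close>
    have x0: "x > 0 \<or> n = 2"
    proof (rule ccontr)
      assume "\<not> ?thesis"
      then have "u = 0" "v = 0" "w \<ge> 2" using w uvw * by auto
      then show False using * uvw by (auto simp: degenerate_types_def)
    qed
    \<comment> \<open>Multiplicities become functions of the eigenvalue: b is the value at -1, and
      y, which equals z, is the value at both nontrivial cube roots.\<close>
    define A B where "A e = (if e = 1 then a else b)" and "B e = (if e = 1 then x else y)" for e :: complex
    have ne: "(- 1 :: complex) \<noteq> 1" by simp
    obtain S T where ST: "S \<in> carrier_mat n n" "S * S = 1\<^sub>m n" "T \<in> carrier_mat n n" "T * (T * T) = 1\<^sub>m n"
      "full n S T" "\<forall>e\<in>{1, - 1}. eigmult e S = A e"
      "\<forall>e\<in>{1, \<rho>, \<rho>\<^sup>2}. eigmult e T = B e"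
      using full_pair_exists[OF \<rho>, of n A B] * uvw w x0 ne cube(4) \<rho>(2) by (auto simp: A_def B_def)
    obtain \<phi>1 where \<phi>1: "\<phi>1 \<in> reps n ModGrp" "s_mat \<phi>1 = S" "t_mat \<phi>1 = T"
      using mod_rep_exists[OF ST(1,3,2,4)] by metis
    have type: "has_dim_type \<rho> (a, b, x, y, z) \<phi>1"
      using ST(6,7) ne cube(4) \<rho>(2) uvw by (simp add: has_dim_type_def \<phi>1 A_def B_def)
    have "n > 0" using * uvw w by simp
    then obtain U where U: "open_dense_in ?T U" "U \<subseteq> iss_type \<rho> n (a, b, x, y, z)"
      "\<And>X \<psi>. X \<in> U \<Longrightarrow> \<psi> \<in> X \<Longrightarrow> irreducible_rep n ModGrp \<psi>"
      using open_dense_irreducibles[OF \<rho> _ \<phi>1(1) type] ST(5) \<phi>1 by metis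
    have "extends_to_amalgam n \<psi>" if "X \<in> U" "\<psi> \<in> X" for X \<psi>
    proof -
      have "X \<in> iss_type \<rho> n (a, b, x, y, z)" using that U(2) by blast
      note r = iss_type_member[OF this that(2)]
      show ?thesis using r(2) uvw by (intro extends_to_amalgam_if[OF \<rho> r(1)]) (simp add: has_dim_type_def)
    qed
    with U show "\<exists>U. open_dense_in ?T U \<and>
      (\<forall>X\<in>U. \<forall>\<psi>\<in>X. irreducible_rep n ModGrp \<psi> \<and> extends_to_amalgam n \<psi>)" by blast
  }
next
  fix n a b x y z :: nat
  assume *: "a + b = n \<and> n = x + y + z \<and> a \<ge> b \<and> b \<ge> x \<and> x = Max {x, y, z} \<and>
        (\<exists>u v w :: nat. u \<le> v \<and> v \<le> w \<and> a = v + w \<and> b = u + w \<and> {#x, y, z#} = {#u + v, w, w#})"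
  let ?T = "subtopology (zariski_irr n B3) (irr_type \<rho> n (a, b, x, y, z))"
  \<comment> \<open>The value w occurs twice among x, y, z, so two of these multiplicities
    agree.\<close>
  from * obtain p w where "{#x, y, z#} = {#p, w, w#}" by blast
  then have "count {#x, y, z#} w \<ge> 2" by simp
  then have eq: "x = y \<or> y = z \<or> x = z" by (auto split: if_splits)
  have "irreducible_rep n B3 \<phi> \<and> extends_to_LB3 n \<phi>" if X: "X \<in> topspace ?T" and \<phi>: "\<phi> \<in> X" for X \<phi>
  proof
    have Xi: "X \<in> irr n B3" and Xt: "X \<in> irr_type \<rho> n (a, b, x, y, z)"
      using X by (auto simp: zariski_irr_def)
    then show "irreducible_rep n B3 \<phi>"
      using \<phi> irreducible_rep_iso by (auto simp: irr_def iso_class_def)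
    show "extends_to_LB3 n \<phi>" by (rule irr_type_extends[OF assms Xt \<phi> eq])
  qed
  moreover have "open_dense_in ?T (topspace ?T)"
    unfolding open_dense_in_def by (simp only: openin_topspace closure_of_topspace simp_thms)
  ultimately show "\<exists>U. open_dense_in ?T U \<and> (\<forall>X\<in>U. \<forall>\<phi>\<in>X. irreducible_rep n B3 \<phi> \<and> extends_to_LB3 n \<phi>)"
    by blast
qed

end
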